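(* Let $m,n\ge 2$ be integers with $mn\ge 6$. There are affine homeomorphisms $$\mu:(X_{m,n},\omega_{m,n})\to(Y_{m,n},\eta_{m,n})\quad\text{and}\quad \nu:(X_{m,n},\omega_{m,n})\to(Y_{n,m},\eta_{n,m})$$ with derivatives $$D(\mu)=\begin{bmatrix}\csc\frac{\pi}{n}&-\cot\frac{\pi}{n}\\0&1\end{bmatrix}\quad\text{and}\quad D(\nu)=\begin{bmatrix}-\csc\frac{\pi}{m}&-\cot\frac{\pi}{m}\\0&1\end{bmatrix}.$$
   Context: A translation surface is a closed Riemann surface with a non-zero holomorphic $1$-form; equivalently a finite union of polygons in $\mathbb{C}=\mathbb{R}^2$ with edges glued in pairs by translations (with $1$-form induced by $dz$). Away from the zeros of the $1$-form it has charts to $\mathbb{R}^2$ defined up to translation. An affine homeomorphism $f$ between translation surfaces is a homeomorphism of the form $v\mapsto Mv+\text{const}$ in these charts, for a fixed $M\in\mathrm{GL}(2,\mathbb{R})$ (orientation reversing allowed); $D(f)=M$ is its derivative. The surface $(X_{m,n},\omega_{m,n})$, for integers $m,n\ge2$ with $mn\ge6$: Let $\mathcal{G}_{m,n}$ be the graph with vertices $v_{i,j}$, $1\le i<m$, $1\le j<n$, placed at $(i,j)\in\mathbb{R}^2$, with an edge between vertices at distance $1$. Let $\mathcal{E}$ be the edge set, $\mathcal{A}$ the set of $v_{i,j}$ with $i+j$ even, $\mathcal{B}$ the set of $v_{i,j}$ with $i+j$ odd. Every edge $e$ joins a vertex $\alpha(e)\in\mathcal{A}$ to a vertex $\beta(e)\in\mathcal{B}$.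 Order the edges at $v_{i,j}$ cyclically using the planar embedding: clockwise if $i$ is even, counter-clockwise if $i$ is odd. Define permutations $\mathfrak{e},\mathfrak{n}$ of $\mathcal{E}$: $\mathfrak{e}(e)$ is the edge following $e$ in the cyclic order at $\alpha(e)$, and $\mathfrak{n}(e)$ is the edge following $e$ in the cyclic order at $\beta(e)$. Let $w(v_{i,j})=\sin(\frac{i\pi}{m})\sin(\frac{j\pi}{n})$. Then $(X_{m,n},\omega_{m,n})$ is the union of the rectangles $R_e=[0,w(\beta(e))]\times[0,w(\alpha(e))]$, $e\in\mathcal{E}$, where the right side of $R_e$ is glued by translation to the left side of $R_{\mathfrak{e}(e)}$ and the top side of $R_e$ to the bottom side of $R_{\mathfrak{n}(e)}$. The surface $(Y_{m,n},\eta_{m,n})$: For $a,b\ge0$ not both zero, $P_n(a,b)$ is the convex $2n$-gon whose edge vectors, in counterclockwise order, are $\mathbf{v}_i=a(\cos\frac{i\pi}{n},\sin\frac{i\pi}{n})$ for $i$ even and $\mathbf{v}_i=b(\cos\frac{i\pi}{n},\sin\frac{i\pi}{n})$ for $i$ odd, $i=0,\dots,2n-1$. Edges with $i$ even (odd) are called even (odd) edges. If $a=0$ or $b=0$ it degenerates to a regular $n$-gon (to a segment, viewed as a $2$-gon, if $n=2$). For $k=0,\dots,m-1$ let $$P(k)=\begin{cases}P_n(\sin\frac{(k+1)\pi}{m},\sin\frac{k\pi}{m})& n\text{ odd}\\ P_n(\sin\frac{k\pi}{m},\sin\frac{(k+1)\pi}{m})& n\text{ even},\ k\text{ even}\\ P_n(\sin\frac{(k+1)\pi}{m},\sin\frac{k\pi}{m})&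 n\text{ even},\ k\text{ odd.}\end{cases}$$ For each odd $k$, glue by translation each even side of $P(k)$ to the opposite side of $P(k+1)$ and each odd side of $P(k)$ to the opposite side of $P(k-1)$ (the side with edge vector $\mathbf v$ is glued to the side with edge vector $-\mathbf v$; sides of length zero are ignored). The resulting translation surface is $(Y_{m,n},\eta_{m,n})$. (If $n=2$, $P(0)$ and $P(m-1)$ are segments, and gluing through such a segment identifies the two parallel sides glued to it.) $(Y_{n,m},\eta_{n,m})$ is the same construction with $m$ and $n$ exchanged. *)

theory Defs
  imports "HOL-Analysis.Analysis"
begin

text \<open>
  A gluing \<open>((i, x), (j, y), v)\<close> identifies the side from \<open>x\<close> to \<open>x + v\<close> of the face \<open>i\<close> with the side
  from \<open>y\<close> to \<open>y + v\<close> of the face \<open>j\<close> by the translation taking \<open>x\<close> to \<open>y\<close>.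
  Faces are closed plane regions. A face may be a segment: two sides glued to the same segment are
  then identified with each other, because identifications are closed under transitivity.
\<close>

type_synonym plane = "real^2"

record 'i glued_polygons =
  faces :: "'i set"
  face :: "'i \<Rightarrow> plane set"
  gluings :: "(('i \<times> plane) \<times> ('i \<times> plane) \<times> plane) set"

definition side_identification :: "'i glued_polygons \<Rightarrow> (('i \<times> plane) \<times> ('i \<times> plane)) set" where
  "side_identification S =
     {((i, x + s *\<^sub>R v), (j, y + s *\<^sub>R v)) | i x j y v s. ((i, x), (j, y), v) \<in> gluings S \<and> 0 \<le> s \<and> s \<le> 1}"

text \<open>A point of the surface is a class of the generated equivalence relation.\<close>

definition surface_point :: "'i glued_polygons \<Rightarrow> 'i \<times> plane \<Rightarrow> ('i \<times> plane) set" where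
  "surface_point S p = (side_identification S \<union> (side_identification S)\<inverse>)\<^sup>* `` {p}"

definition quotient_topology :: "'a topology \<Rightarrow> ('a \<Rightarrow> 'b) \<Rightarrow> 'b topology" where
  "quotient_topology X q =
     topology (\<lambda>U. U \<subseteq> q ` topspace X \<and> openin X {x \<in> topspace X. q x \<in> U})"

lemma openin_quotient_topology:
  "openin (quotient_topology X q) U \<longleftrightarrow>
     U \<subseteq> q ` topspace X \<and> openin X {x \<in> topspace X. q x \<in> U}"
proof -
  have "istopology (\<lambda>U. U \<subseteq> q ` topspace X \<and> openin X {x \<in> topspace X. q x \<in> U})"
    unfolding istopology_def
  proof (intro conjI allI impI)
    fix U V
    assume U: "U \<subseteq> q ` topspace X \<and> openin X {x \<in> topspace X. q x \<in> U}"
      and V: "V \<subseteq> q ` topspace X \<and> openin X {x \<in> topspace X. q x \<in> V}"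
    show "U \<inter> V \<subseteq> q ` topspace X" using U by blast
    have "{x \<in> topspace X. q x \<in> U \<inter> V} = {x \<in> topspace X. q x \<in> U} \<inter> {x \<in> topspace X. q x \<in> V}"
      by blast
    then show "openin X {x \<in> topspace X. q x \<in> U \<inter> V}"
      using U V by (simp add: openin_Int)
  next
    fix K
    assume K: "\<forall>U\<in>K. U \<subseteq> q ` topspace X \<and> openin X {x \<in> topspace X. q x \<in> U}"
    show "\<Union>K \<subseteq> q ` topspace X" using K by blast
    have "{x \<in> topspace X. q x \<in> \<Union>K} = (\<Union>U\<in>K. {x \<in> topspace X. q x \<in> U})"
      by blast
    then show "openin X {x \<in> topspace X. q x \<in> \<Union>K}"
      using K by auto
  qed
  then show ?thesis
    by (simp add: quotient_topology_def)
qed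

lemma topspace_quotient_topology: "topspace (quotient_topology X q) = q ` topspace X"
proof
  show "topspace (quotient_topology X q) \<subseteq> q ` topspace X"
    using openin_topspace[of "quotient_topology X q"] by (simp only: openin_quotient_topology)
  have "{x \<in> topspace X. q x \<in> q ` topspace X} = topspace X" by blast
  then have "openin (quotient_topology X q) (q ` topspace X)"
    by (simp add: openin_quotient_topology)
  then show "q ` topspace X \<subseteq> topspace (quotient_topology X q)"
    by (rule openin_subset)
qed

lemma quotient_map_quotient_topology: "quotient_map X (quotient_topology X q) q"
  by (simp add: quotient_map_def topspace_quotient_topology openin_quotient_topology)

definition surface :: "'i glued_polygons \<Rightarrow> ('i \<times> plane) set topology" where
  "surface S =
     quotient_topology (sum_topology (\<lambda>i. top_of_set (face S i)) (faces S)) (surface_point S)"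

text \<open>
  A chart is a homeomorphism onto an open subset of the plane that is a translation, locally, in the
  interior of every face (equivalently, by continuity, it pulls \<open>dz\<close> back to the 1-form).
  No such chart exists around a cone point of angle \<open>2 * k * pi\<close> with \<open>k \<ge> 2\<close>, so the
  domains of charts cover exactly the complement of the zeros of the 1-form; a vertex of total
  angle \<open>2 * pi\<close> does lie in the domain of a chart.
\<close>

definition translation_chart ::
  "'i glued_polygons \<Rightarrow> ('i \<times> plane) set set \<Rightarrow> (('i \<times> plane) set \<Rightarrow> plane) \<Rightarrow> bool" where
  "translation_chart S U \<phi> \<longleftrightarrow>
     openin (surface S) U \<and> open (\<phi> ` U) \<and>
     homeomorphic_map (subtopology (surface S) U) (top_of_set (\<phi> ` U)) \<phi> \<and>
     (\<forall>i\<in>faces S. \<forall>x\<in>interior (face S i). surface_point S (i, x) \<in> U \<longrightarrow>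
        (\<exists>c. \<forall>\<^sub>F y in nhds x. \<phi> (surface_point S (i, y)) = y + c))"

definition affine_homeomorphism ::
  "'i glued_polygons \<Rightarrow> 'j glued_polygons \<Rightarrow> real^2^2 \<Rightarrow>
     (('i \<times> plane) set \<Rightarrow> ('j \<times> plane) set) \<Rightarrow> bool" where
  "affine_homeomorphism S T M f \<longleftrightarrow>
     invertible M \<and> homeomorphic_map (surface S) (surface T) f \<and>
     (\<forall>U \<phi> V \<psi>. translation_chart S U \<phi> \<and> translation_chart T V \<psi> \<longrightarrow>
        (\<forall>p\<in>U. f p \<in> V \<longrightarrow>
           (\<exists>W c. openin (surface S) W \<and> p \<in> W \<and> W \<subseteq> U \<and> f ` W \<subseteq> V \<and>
              (\<forall>q\<in>W. \<psi> (f q) = M *v \<phi> q + c))))"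

type_synonym vertex = "int \<times> int"

definition grid_vertices :: "nat \<Rightarrow> nat \<Rightarrow> vertex set" where
  "grid_vertices m n = {(i, j). 1 \<le> i \<and> i < int m \<and> 1 \<le> j \<and> j < int n}"

text \<open>
  An edge is represented by the ordered pair of its endpoints \<open>\<alpha>(e)\<close> (even coordinate sum) and
  \<open>\<beta>(e)\<close> (odd coordinate sum).
\<close>

definition grid_edges :: "nat \<Rightarrow> nat \<Rightarrow> (vertex \<times> vertex) set" where
  "grid_edges m n =
     {(a, b). a \<in> grid_vertices m n \<and> b \<in> grid_vertices m n \<and>
        even (fst a + snd a) \<and> odd (fst b + snd b) \<and>
        \<bar>fst a - fst b\<bar> + \<bar>snd a - snd b\<bar> = 1}"

text \<open>
  Quarter turn in the direction in which the edges at \<open>v\<close> are ordered: clockwise if the first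
  coordinate of \<open>v\<close> is even, counterclockwise if it is odd.
\<close>

definition quarter_turn :: "vertex \<Rightarrow> vertex \<Rightarrow> vertex" where
  "quarter_turn v d = (if even (fst v) then (snd d, - fst d) else (- snd d, fst d))"

text \<open>
  The edges at \<open>v\<close> point along the coordinate axes, so the edge following the edge from \<open>v\<close> to \<open>u\<close>
  is met first when turning the latter about \<open>v\<close> by quarter turns; it is the same edge if \<open>v\<close> has
  degree one.
\<close>

definition next_neighbour :: "nat \<Rightarrow> nat \<Rightarrow> vertex \<Rightarrow> vertex \<Rightarrow> vertex" where
  "next_neighbour m n v u =
     v + (quarter_turn v ^^ (LEAST k. 0 < k \<and> v + (quarter_turn v ^^ k) (u - v) \<in> grid_vertices m n))
       (u - v)"

definition east :: "nat \<Rightarrow> nat \<Rightarrow> vertex \<times> vertex \<Rightarrow> vertex \<times> vertex" where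
  "east m n e = (fst e, next_neighbour m n (fst e) (snd e))"

definition north :: "nat \<Rightarrow> nat \<Rightarrow> vertex \<times> vertex \<Rightarrow> vertex \<times> vertex" where
  "north m n e = (next_neighbour m n (snd e) (fst e), snd e)"

definition weight :: "nat \<Rightarrow> nat \<Rightarrow> vertex \<Rightarrow> real" where
  "weight m n v = sin (of_int (fst v) * pi / of_nat m) * sin (of_int (snd v) * pi / of_nat n)"

definition surface_X :: "nat \<Rightarrow> nat \<Rightarrow> (vertex \<times> vertex) glued_polygons" where
  "surface_X m n =
     \<lparr> faces = grid_edges m n,
       face = (\<lambda>e. {x. 0 \<le> x $ 1 \<and> x $ 1 \<le> weight m n (snd e) \<and>
                       0 \<le> x $ 2 \<and> x $ 2 \<le> weight m n (fst e)}),
       gluings =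
         {((e, vector [weight m n (snd e), 0]), (east m n e, 0), vector [0, weight m n (fst e)])
            | e. e \<in> grid_edges m n} \<union>
         {((e, vector [0, weight m n (fst e)]), (north m n e, 0), vector [weight m n (snd e), 0])
            | e. e \<in> grid_edges m n} \<rparr>"

definition polygon_edge :: "nat \<Rightarrow> real \<Rightarrow> real \<Rightarrow> nat \<Rightarrow> plane" where
  "polygon_edge n a b i =
     (if even i then a else b) *\<^sub>R vector [cos (of_nat i * pi / of_nat n), sin (of_nat i * pi / of_nat n)]"

text \<open>The polygon is only determined up to translation; its initial vertex is placed at the origin.\<close>

definition polygon_vertex :: "nat \<Rightarrow> real \<Rightarrow> real \<Rightarrow> nat \<Rightarrow> plane" where
  "polygon_vertex n a b i = (\<Sum>l<i. polygon_edge n a b l)"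

definition semiregular_polygon :: "nat \<Rightarrow> real \<Rightarrow> real \<Rightarrow> plane set" where
  "semiregular_polygon n a b = convex hull (polygon_vertex n a b ` {..<2 * n})"

definition even_length :: "nat \<Rightarrow> nat \<Rightarrow> nat \<Rightarrow> real" where
  "even_length m n k =
     (if odd n \<or> odd k then sin (of_nat (k + 1) * pi / of_nat m) else sin (of_nat k * pi / of_nat m))"

definition odd_length :: "nat \<Rightarrow> nat \<Rightarrow> nat \<Rightarrow> real" where
  "odd_length m n k =
     (if odd n \<or> odd k then sin (of_nat k * pi / of_nat m) else sin (of_nat (k + 1) * pi / of_nat m))"

definition side_vector :: "nat \<Rightarrow> nat \<Rightarrow> nat \<Rightarrow> nat \<Rightarrow> plane" where
  "side_vector m n k i = polygon_edge n (even_length m n k) (odd_length m n k) i"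

definition side_start :: "nat \<Rightarrow> nat \<Rightarrow> nat \<Rightarrow> nat \<Rightarrow> plane" where
  "side_start m n k i = polygon_vertex n (even_length m n k) (odd_length m n k) i"

text \<open>
  Meant for odd \<open>k\<close> only: every gluing of \<open>surface_Y\<close> joins an odd-numbered polygon to an
  even-numbered one and is listed from the odd side.
\<close>

definition glued_to :: "nat \<Rightarrow> nat \<Rightarrow> nat" where
  "glued_to k i = (if even i then k + 1 else k - 1)"

definition opposite :: "nat \<Rightarrow> nat \<Rightarrow> nat" where
  "opposite n i = (i + n) mod (2 * n)"

lemma side_vector_opposite:
  assumes "0 < n" "odd k" "i < 2 * n"
  shows "side_vector m n (glued_to k i) (opposite n i) = - side_vector m n k i"
proof -
  have trig: "cos (of_nat (opposite n i) * pi / of_nat n) = - cos (of_nat i * pi / of_nat n)"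
             "sin (of_nat (opposite n i) * pi / of_nat n) = - sin (of_nat i * pi / of_nat n)"
  proof -
    have "of_nat (opposite n i) * pi / of_nat n = of_nat i * pi / of_nat n + pi \<or>
          of_nat (opposite n i) * pi / of_nat n = of_nat i * pi / of_nat n - pi"
    proof (cases "i < n")
      case True
      then have "opposite n i = i + n" by (simp add: opposite_def)
      then show ?thesis using assms(1) by (simp add: field_simps)
    next
      case False
      then have "opposite n i = i - n"
        using assms by (simp add: opposite_def mod_if)
      then have "real (opposite n i) = real i - real n"
        using False by (simp add: of_nat_diff)
      then show ?thesis using assms(1) by (simp add: left_diff_distrib diff_divide_distrib)
    qed
    then show "cos (of_nat (opposite n i) * pi / of_nat n) = - cos (of_nat i * pi / of_nat n)"
              "sin (of_nat (opposite n i) * pi / of_nat n) = - sin (of_nat i * pi / of_nat n)"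
      by (auto simp: cos_diff sin_diff)
  qed
  have par: "even (opposite n i) \<longleftrightarrow> (even i \<longleftrightarrow> even n)"
    unfolding opposite_def by (subst dvd_mod_iff) auto
  have "1 \<le> k" using assms(2) by (cases k) auto
  then have len: "(if even (opposite n i) then even_length m n (glued_to k i) else odd_length m n (glued_to k i)) =
             (if even i then even_length m n k else odd_length m n k)"
    using assms(2) by (auto simp: par glued_to_def even_length_def odd_length_def)
  have "(vector [- c, - s] :: plane) = - vector [c, s]" for c s :: real
    by (simp add: vec_eq_iff forall_2)
  then show ?thesis
    by (simp only: side_vector_def polygon_edge_def trig len scaleR_minus_right)
qed

text \<open>
  The opposite side runs in the direction of the negated side vector, so the start of side \<open>i\<close> is
  matched with the end of the opposite side.
\<close>

definition surface_Y :: "nat \<Rightarrow> nat \<Rightarrow> nat glued_polygons" where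
  "surface_Y m n =
     \<lparr> faces = {..<m},
       face = (\<lambda>k. semiregular_polygon n (even_length m n k) (odd_length m n k)),
       gluings =
         {((k, side_start m n k i),
           (glued_to k i, side_start m n (glued_to k i) (opposite n i + 1)),
           side_vector m n k i)
            | k i. k < m \<and> odd k \<and> i < 2 * n \<and> side_vector m n k i \<noteq> 0} \<rparr>"

end

theory Submission
  imports Defs
begin

text \<open>
  \<open>shear n\<close> is the derivative of \<open>\<mu>\<close>. Its inverse takes the edge vector of direction \<open>i * pi / n\<close>
  and length \<open>sin (c * pi / m)\<close> to the vector with coordinates \<open>weight m n (c, i + 1)\<close> and
  \<open>weight m n (c, i)\<close>, that is, to the diagonal of a rectangle of \<open>surface_X\<close>. So the sheared polygon
  \<open>k\<close> is cut by a grid with columns and rows of widths \<open>weight m n u\<close> and heights \<open>weight m n v\<close>,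
  for \<open>u\<close> and \<open>v\<close> in the columns \<open>k\<close> and \<open>k + 1\<close> of the graph, into the rectangles of the edges
  between these two columns and half rectangles of the edges inside each of them; the other halves
  lie in the neighbouring polygons, and the gluings of \<open>surface_Y\<close> join the halves along the diagonal.
  The cyclic order of the edges at a vertex is the order of the cells along a row or a column.

  Vertices on the boundary of the grid have weight zero. Cells belonging to edges with exactly one
  such endpoint are segments; passing through them corresponds to skipping the missing edges in the
  cyclic order. Two points of cells are identified in \<open>surface_X\<close> iff they are in \<open>surface_Y\<close>, and
  the finitely many compact cells make the resulting bijection a homeomorphism.

  For \<open>\<nu>\<close>, exchanging the coordinates of the graph inverts \<open>east\<close> and preserves \<open>north\<close>, so that
  reflecting the rectangles horizontally identifies \<open>surface_X m n\<close> with \<open>surface_X n m\<close>.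
\<close>

subsection \<open>Surfaces glued from polygons\<close>

text \<open>The weights come from sin((i+1)x) - cos(x) sin(ix) = sin(x) cos(ix) with x = pi/n: this
  identity turns edge vectors into products of two sines and dictates the entries csc and -cot.
  Following points around corners would require the local picture at every vertex. Instead, a
  function of labelled cell points is shown to be constant on classes, which needs two facts: labels
  naming one point of the first surface agree in the second, and every generating gluing is realised
  by a pair of cells. From X to Y the first fact concerns the cells of one edge; from Y to X it
  concerns cells overlapping in a polygon, and is delicate because cells flat in both directions are
  absent and have to be walked around. Charts are constrained only in the interiors of faces,
  whereas the affine form is demanded at every chart point, including seams and vertices of total
  angle 2 pi. There the difference of the target chart after \<open>f\<close> and \<open>M\<close>
  applied to the source chart is controlled by continuity from the interiors of solid cells.\<close>

lemma surface_point_eq_iff: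
  "surface_point S p = surface_point S q \<longleftrightarrow>
     (p, q) \<in> (side_identification S \<union> (side_identification S)\<inverse>)\<^sup>*" (is "_ \<longleftrightarrow> _ \<in> ?R\<^sup>*")
proof
  assume "surface_point S p = surface_point S q"
  then show "(p, q) \<in> ?R\<^sup>*"
    by (auto simp: surface_point_def)
next
  assume pq: "(p, q) \<in> ?R\<^sup>*"
  have "sym (?R\<^sup>*)"
    by (intro sym_rtrancl sym_Un_converse)
  then have "(q, p) \<in> ?R\<^sup>*"
    using pq by (rule symD)
  with pq show "surface_point S p = surface_point S q"
    by (auto simp: surface_point_def intro: rtrancl_trans)
qed

lemma surface_point_side_identification:
  "(p, q) \<in> side_identification S \<Longrightarrow> surface_point S p = surface_point S q"
  by (auto simp: surface_point_eq_iff)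

lemma surface_point_gluing:
  assumes "((i, x), (j, y), v) \<in> gluings S" "0 \<le> r" "r \<le> 1"
  shows "surface_point S (i, x + r *\<^sub>R v) = surface_point S (j, y + r *\<^sub>R v)"
  by (rule surface_point_side_identification) (use assms in \<open>auto simp: side_identification_def\<close>)

text \<open>Induction along a chain of identifications. The labels supplied for two consecutive
  links may differ although they name the same point; \<open>eq\<close> bridges them. This device
  carries identifications of one surface to the other, in both directions.\<close>

lemma surface_point_lift:
  assumes eq: "\<And>z w. z \<in> Z \<Longrightarrow> w \<in> Z \<Longrightarrow> e z = e w \<Longrightarrow> g z = g w"
    and glue: "\<And>p q. (p, q) \<in> side_identification S \<Longrightarrow>
                 \<exists>z\<in>Z. \<exists>w\<in>Z. e z = p \<and> e w = q \<and> g z = g w"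
    and same: "surface_point S (e z) = surface_point S (e w)" "z \<in> Z" "w \<in> Z"
  shows "g z = g w"
proof -
  let ?R = "side_identification S \<union> (side_identification S)\<inverse>"
  have "\<forall>w\<in>Z. e w = q \<longrightarrow> g z = g w" if "(e z, q) \<in> ?R\<^sup>*" for q
    using that
  proof (induction rule: rtrancl_induct)
    case base
    show ?case
      using eq[OF same(2)] by (metis (no_types))
  next
    case (step q r)
    show ?case
    proof (intro ballI impI)
      fix w assume w: "w \<in> Z" "e w = r"
      have "(q, r) \<in> side_identification S \<or> (r, q) \<in> side_identification S"
        using step.hyps(2) by blast
      then obtain u v where uv: "u \<in> Z" "v \<in> Z" "e u = q" "e v = r" "g u = g v"
        using glue[of q r] glue[of r q] by metis
      have "g z = g u" using step.IH uv by blast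
      moreover have "g v = g w" using eq[OF uv(2) w(1)] uv w by simp
      ultimately show "g z = g w" using uv by simp
    qed
  qed
  then show ?thesis using same by (simp add: surface_point_eq_iff)
qed

section \<open>Topology of glued surfaces and piecewise affine maps between them\<close>

lemma topspace_surface:
  "topspace (surface S) = surface_point S ` (SIGMA i:faces S. face S i)"
  by (auto simp: surface_def topspace_quotient_topology o_def)

lemma openin_surface:
  "openin (surface S) U \<longleftrightarrow> U \<subseteq> surface_point S ` (SIGMA i:faces S. face S i) \<and>
     (\<forall>i\<in>faces S. openin (top_of_set (face S i)) {x \<in> face S i. surface_point S (i, x) \<in> U})"
proof -
  have "{x. (i, x) \<in> {p \<in> Sigma (faces S) (face S). surface_point S p \<in> U}} =
         {x \<in> face S i. surface_point S (i, x) \<in> U}" if "i \<in> faces S" for i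
    using that by auto
  then show ?thesis
    by (auto simp: surface_def openin_quotient_topology openin_sum_topology o_def)
qed

lemma continuous_map_surface_point:
  assumes "i \<in> faces S"
  shows "continuous_map (top_of_set (face S i)) (surface S) (\<lambda>x. surface_point S (i, x))"
  using assms by (auto simp: continuous_map_def openin_surface topspace_surface)

text \<open>The complement of \<open>A\<close> in \<open>F\<close> is a finite union of continuous
  images of compact sets, hence closed. The pieces may overlap arbitrarily.\<close>

lemma openin_finite_compact_cover:
  fixes u :: "'c \<Rightarrow> 'a::metric_space \<Rightarrow> 'b::metric_space"
  assumes fin: "finite C" and cpt: "\<And>c. c \<in> C \<Longrightarrow> compact (D c)"
    and cont: "\<And>c. c \<in> C \<Longrightarrow> continuous_on (D c) (u c)"
    and F: "F = (\<Union>c\<in>C. u c ` D c)" and A: "A \<subseteq> F"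
    and op: "\<And>c. c \<in> C \<Longrightarrow> openin (top_of_set (D c)) {z \<in> D c. u c z \<in> A}"
  shows "openin (top_of_set F) A"
proof -
  let ?K = "\<lambda>c. D c - {z \<in> D c. u c z \<in> A}"
  have "compact (u c ` ?K c)" if c: "c \<in> C" for c
  proof (rule compact_continuous_image)
    show "continuous_on (?K c) (u c)"
      using cont[OF c] by (rule continuous_on_subset) auto
    have "closedin (top_of_set (D c)) (?K c)"
      using op[OF c] by (simp add: closedin_diff)
    then show "compact (?K c)"
      using cpt[OF c] closedin_compact by blast
  qed
  then have "compact (\<Union>c\<in>C. u c ` ?K c)"
    using fin by auto
  then have "open (- (\<Union>c\<in>C. u c ` ?K c))"
    by (intro open_Compl compact_imp_closed)
  then have op: "openin (top_of_set F) (F \<inter> - (\<Union>c\<in>C. u c ` ?K c))"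
    by (rule openin_open_Int)
  have "A = F \<inter> - (\<Union>c\<in>C. u c ` ?K c)"
    using A unfolding F by auto
  with op show ?thesis by simp
qed

text \<open>No compatibility along seams is asked for: \<open>f\<close> is already a function on
  surface points, and openness of a preimage is tested on the compact pieces of each face.\<close>

lemma continuous_map_surface:
  fixes D :: "'c \<Rightarrow> 'a::metric_space set"
  assumes fin: "finite C" and cpt: "\<And>c. c \<in> C \<Longrightarrow> compact (D c)"
    and iS: "\<And>c. c \<in> C \<Longrightarrow> i c \<in> faces S"
    and u: "\<And>c. c \<in> C \<Longrightarrow> continuous_on (D c) (u c)" "\<And>c. c \<in> C \<Longrightarrow> u c ` D c \<subseteq> face S (i c)"
    and cov: "\<And>k x. k \<in> faces S \<Longrightarrow> x \<in> face S k \<Longrightarrow> \<exists>c\<in>C. \<exists>z\<in>D c. i c = k \<and> u c z = x"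
    and jT: "\<And>c. c \<in> C \<Longrightarrow> j c \<in> faces T"
    and v: "\<And>c. c \<in> C \<Longrightarrow> continuous_on (D c) (v c)" "\<And>c. c \<in> C \<Longrightarrow> v c ` D c \<subseteq> face T (j c)"
    and f: "\<And>c z. c \<in> C \<Longrightarrow> z \<in> D c \<Longrightarrow>
              f (surface_point S (i c, u c z)) = surface_point T (j c, v c z)"
  shows "continuous_map (surface S) (surface T) f"
  unfolding continuous_map_def
proof (intro conjI allI impI)
  show "f \<in> topspace (surface S) \<rightarrow> topspace (surface T)"
  proof
    fix p assume "p \<in> topspace (surface S)"
    then obtain k x where "k \<in> faces S" "x \<in> face S k" and p: "p = surface_point S (k, x)"
      by (auto simp: topspace_surface)
    then obtain c z where c: "c \<in> C" "z \<in> D c" "i c = k" "u c z = x"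
      using cov by blast
    have "(j c, v c z) \<in> (SIGMA i:faces T. face T i)"
      using c jT v(2) by auto
    then show "f p \<in> topspace (surface T)"
      using f[OF c(1,2)] c p by (auto simp: topspace_surface)
  qed
  fix U assume U: "openin (surface T) U"
  show "openin (surface S) {x \<in> topspace (surface S). f x \<in> U}"
    unfolding openin_surface
  proof (intro conjI ballI)
    show "{x \<in> topspace (surface S). f x \<in> U} \<subseteq> surface_point S ` Sigma (faces S) (face S)"
      by (simp add: topspace_surface)
    fix k assume k: "k \<in> faces S"
    let ?A = "{x \<in> face S k. surface_point S (k, x) \<in> {x \<in> topspace (surface S). f x \<in> U}}"
    let ?C = "{c \<in> C. i c = k}"
    show "openin (top_of_set (face S k)) ?A"
    proof (rule openin_finite_compact_cover[where C = ?C and D = D and u = u])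
      show "face S k = (\<Union>c\<in>?C. u c ` D c)"
      proof (intro set_eqI iffI)
        fix x assume "x \<in> face S k"
        then show "x \<in> (\<Union>c\<in>?C. u c ` D c)" using cov[OF k] by blast
      next
        fix x assume "x \<in> (\<Union>c\<in>?C. u c ` D c)"
        then show "x \<in> face S k" using u(2) by blast
      qed
      fix c assume c: "c \<in> ?C"
      have "continuous_map (top_of_set (D c)) (top_of_set (face T (j c))) (v c)"
        using v c by (auto simp: continuous_map_in_subtopology)
      then have "continuous_map (top_of_set (D c)) (surface T) (\<lambda>z. surface_point T (j c, v c z))"
        using continuous_map_surface_point[of "j c" T] jT c
        by (auto dest: continuous_map_compose[OF \<open>continuous_map (top_of_set (D c)) _ (v c)\<close>] simp: o_def)
      then have "openin (top_of_set (D c)) {z \<in> D c. surface_point T (j c, v c z) \<in> U}"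
        using U by (auto simp: continuous_map_def)
      moreover have "{z \<in> D c. surface_point T (j c, v c z) \<in> U} = {z \<in> D c. u c z \<in> ?A}"
      proof -
        have "u c z \<in> face S k" "surface_point S (k, u c z) \<in> topspace (surface S)"
          "f (surface_point S (k, u c z)) = surface_point T (j c, v c z)" if "z \<in> D c" for z
          using that c k f[of c z] u(2)[of c] by (auto simp: topspace_surface)
        then show ?thesis by auto
      qed
      ultimately show "openin (top_of_set (D c)) {z \<in> D c. u c z \<in> ?A}"
        by simp
    qed (use fin cpt u in auto)
  qed
qed

text \<open>In a small ball the interior of \<open>D\<close> is convex, hence connected, and
  \<open>h\<close> is constant on it. It is also dense in the part of \<open>D\<close> in the ball,
  so continuity extends the constant to boundary points. This lets information about charts in the
  interiors of faces reach the seams.\<close>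

lemma openin_level_set_of_locally_constant:
  fixes h :: "'a::euclidean_space \<Rightarrow> 'b::t1_space"
  assumes D: "convex D" "interior D \<noteq> {}" and Q: "openin (top_of_set D) Q"
    and cont: "continuous_on Q h"
    and const: "\<And>z. z \<in> Q \<Longrightarrow> z \<in> interior D \<Longrightarrow> \<forall>\<^sub>F y in nhds z. h y = h z"
  shows "openin (top_of_set D) {z \<in> Q. h z = a}"
  unfolding openin_euclidean_subtopology_iff
proof (intro conjI ballI)
  obtain G where G: "open G" "Q = D \<inter> G"
    using Q by (auto simp: openin_open)
  then show "{z \<in> Q. h z = a} \<subseteq> D" by auto
  fix z assume z: "z \<in> {z \<in> Q. h z = a}"
  then obtain r where r: "r > 0" "ball z r \<subseteq> G"
    using G open_contains_ball by blast
  let ?B = "ball z r" and ?I = "ball z r \<inter> interior D"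
  have sub: "?B \<inter> D \<subseteq> Q" using r G by auto
  have clos: "?B \<inter> D \<subseteq> closure ?I"
  proof -
    have "?B \<inter> D \<subseteq> ?B \<inter> closure (interior D)"
      using convex_closure_interior[OF D] closure_subset[of D] by auto
    then show ?thesis
      using open_Int_closure_subset[OF open_ball, of z r "interior D"] by order
  qed
  have "connected ?I"
    using D by (intro convex_connected convex_Int) auto
  have "\<forall>x\<in>?I. \<forall>\<^sub>F y in at x within ?I. h x = h y"
  proof
    fix x assume x: "x \<in> ?I"
    then have "x \<in> Q" using sub interior_subset by blast
    then have "\<forall>\<^sub>F y in nhds x. h y = h x" using x const by auto
    then have "\<forall>\<^sub>F y in nhds x. y \<noteq> x \<longrightarrow> y \<in> ?I \<longrightarrow> h x = h y"
      by eventually_elim auto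
    then show "\<forall>\<^sub>F y in at x within ?I. h x = h y"
      by (simp add: eventually_at_filter)
  qed
  then have eq: "h x = h y" if "x \<in> ?I" "y \<in> ?I" for x y
    using connected_local_const[OF \<open>connected ?I\<close> that] by blast
  have zB: "z \<in> ?B \<inter> D" using z r(1) G(2) by simp
  have "?I \<noteq> {}"
    using subsetD[OF clos zB] by (intro notI) simp
  then obtain w where w: "w \<in> ?I" by (elim exE[OF ex_in_conv[THEN iffD2]])
  have "continuous_on (?B \<inter> D) h"
    using cont sub by (rule continuous_on_subset)
  then have "closedin (top_of_set (?B \<inter> D)) {x \<in> ?B \<inter> D. h x = h w}"
    by (rule continuous_closedin_preimage_constant)
  then obtain K where K: "closed K" "{x \<in> ?B \<inter> D. h x = h w} = (?B \<inter> D) \<inter> K"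
    by (auto simp: closedin_closed)
  have "?I \<subseteq> {x \<in> ?B \<inter> D. h x = h w}"
    using eq[OF _ w] interior_subset[of D] by auto
  then have "?I \<subseteq> K" unfolding K(2) by simp
  then have "closure ?I \<subseteq> K" using K by (simp add: closure_minimal)
  then have const': "h x = h w" if "x \<in> ?B \<inter> D" for x
  proof -
    have "x \<in> {x \<in> ?B \<inter> D. h x = h w}"
      unfolding K(2) using that subsetD[OF clos that] \<open>closure ?I \<subseteq> K\<close> by (simp add: subset_iff)
    then show ?thesis by simp
  qed
  show "\<exists>e>0. \<forall>x'\<in>D. dist x' z < e \<longrightarrow> x' \<in> {z \<in> Q. h z = a}"
  proof (intro exI[of _ r] conjI ballI impI)
    fix x assume "x \<in> D" "dist x z < r"
    then have x: "x \<in> ?B \<inter> D" by (simp add: dist_commute)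
    then have "x \<in> Q" by (rule subsetD[OF sub])
    then show "x \<in> {z \<in> Q. h z = a}"
      using const'[OF x] const'[OF zB] z by simp
  qed (rule r(1))
qed

lemma affine_image_interior:
  fixes A :: "real^'n^'n"
  assumes A: "invertible A" and im: "\<And>w. w \<in> D \<Longrightarrow> A *v w + r \<in> F" and z: "z \<in> interior D"
  shows "A *v z + r \<in> interior F"
proof -
  have "surj ((*v) A)"
    using A by (simp add: invertible_eq_bij bij_is_surj)
  then have "open ((*v) A ` interior D)"
    by (intro open_surjective_linear_image) (auto simp: matrix_vector_mul_linear)
  then have "open ((+) r ` (*v) A ` interior D)"
    by (rule open_translation)
  moreover have "(+) r ` (*v) A ` interior D \<subseteq> F"
    using im interior_subset[of D] by (auto simp: add.commute)
  ultimately have "(+) r ` (*v) A ` interior D \<subseteq> interior F"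
    by (intro interior_maximal)
  then show ?thesis using z by (auto simp: add.commute)
qed

lemma tendsto_affine_map:
  fixes A :: "real^'n^'m"
  shows "((\<lambda>y. A *v y + r) \<longlongrightarrow> A *v z + r) (nhds z)"
  by (intro tendsto_add bounded_linear.tendsto[OF matrix_vector_mul_bounded_linear]
      tendsto_const filterlim_ident)

text \<open>A common subdivision: the pieces \<open>D c\<close> map to faces of \<open>S\<close>
  with linear part \<open>L\<close> and to faces of \<open>T\<close> with linear part
  \<open>M ** L\<close>. The pieces that cover \<open>S\<close> must be solid, since the derivative
  is read off in interiors; flat pieces may cover parts of \<open>T\<close>, which a face that is a
  segment requires.\<close>

lemma affine_homeomorphism_of_refinement:
  fixes S :: "'i glued_polygons" and T :: "'j glued_polygons"
    and C :: "'c set" and D :: "'c \<Rightarrow> plane set" and i :: "'c \<Rightarrow> 'i" and j :: "'c \<Rightarrow> 'j"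
    and L M :: "real^2^2" and s t :: "'c \<Rightarrow> plane"
  assumes fin: "finite C" and cpt: "\<And>c. c \<in> C \<Longrightarrow> compact (D c)"
    and iS: "\<And>c. c \<in> C \<Longrightarrow> i c \<in> faces S"
    and imS: "\<And>c z. c \<in> C \<Longrightarrow> z \<in> D c \<Longrightarrow> L *v z + s c \<in> face S (i c)"
    and jT: "\<And>c. c \<in> C \<Longrightarrow> j c \<in> faces T"
    and imT: "\<And>c z. c \<in> C \<Longrightarrow> z \<in> D c \<Longrightarrow> (M ** L) *v z + t c \<in> face T (j c)"
    and L: "invertible L" and M: "invertible M"
    and covS: "\<And>k x. k \<in> faces S \<Longrightarrow> x \<in> face S k \<Longrightarrow>
      \<exists>c\<in>C. \<exists>z\<in>D c. i c = k \<and> L *v z + s c = x \<and> convex (D c) \<and> interior (D c) \<noteq> {}"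
    and covT: "\<And>k x. k \<in> faces T \<Longrightarrow> x \<in> face T k \<Longrightarrow>
      \<exists>c\<in>C. \<exists>z\<in>D c. j c = k \<and> (M ** L) *v z + t c = x"
    and same: "\<And>c d z w. c \<in> C \<Longrightarrow> d \<in> C \<Longrightarrow> z \<in> D c \<Longrightarrow> w \<in> D d \<Longrightarrow>
      surface_point S (i c, L *v z + s c) = surface_point S (i d, L *v w + s d) \<longleftrightarrow>
      surface_point T (j c, (M ** L) *v z + t c) = surface_point T (j d, (M ** L) *v w + t d)"
  shows "\<exists>f. affine_homeomorphism S T M f"
proof -
  define u where "u = (\<lambda>c z. L *v z + s c)"
  define v where "v = (\<lambda>c z. (M ** L) *v z + t c)"
  define p where "p = (\<lambda>(c, z). surface_point S (i c, u c z))"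
  define q where "q = (\<lambda>(c, z). surface_point T (j c, v c z))"
  define Z where "Z = Sigma C D"
  have pq: "p y = p z \<longleftrightarrow> q y = q z" if yz: "y \<in> Z" "z \<in> Z" for y z
  proof -
    obtain c y' d z' where "y = (c, y')" "c \<in> C" "y' \<in> D c" "z = (d, z')" "d \<in> C" "z' \<in> D d"
      using yz by (auto simp: Z_def)
    then show ?thesis using same[of c d y' z'] by (simp add: p_def q_def u_def v_def)
  qed
  define f where "f = (\<lambda>P. q (SOME y. y \<in> Z \<and> p y = P))"
  define g where "g = (\<lambda>Q. p (SOME y. y \<in> Z \<and> q y = Q))"
  have f: "f (p z) = q z" if "z \<in> Z" for z
  proof -
    have "(SOME y. y \<in> Z \<and> p y = p z) \<in> Z \<and> p (SOME y. y \<in> Z \<and> p y = p z) = p z"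
      by (rule someI[where x = z]) (use that in simp)
    then show ?thesis unfolding f_def using pq that by blast
  qed
  have g: "g (q z) = p z" if "z \<in> Z" for z
  proof -
    have "(SOME y. y \<in> Z \<and> q y = q z) \<in> Z \<and> q (SOME y. y \<in> Z \<and> q y = q z) = q z"
      by (rule someI[where x = z]) (use that in simp)
    then show ?thesis unfolding g_def using pq that by blast
  qed
  have cont_u: "continuous_on (D c) (u c)" for c
    unfolding u_def by (intro continuous_intros)
  have cont_v: "continuous_on (D c) (v c)" for c
    unfolding v_def by (intro continuous_intros)
  have im_u: "u c ` D c \<subseteq> face S (i c)" if "c \<in> C" for c
    using imS[OF that] by (auto simp: u_def)
  have im_v: "v c ` D c \<subseteq> face T (j c)" if "c \<in> C" for c
    using imT[OF that] by (auto simp: v_def)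
  have covS': "\<exists>c\<in>C. \<exists>z\<in>D c. i c = k \<and> u c z = x" if "k \<in> faces S" "x \<in> face S k" for k x
    using covS[OF that] unfolding u_def by blast
  have covT': "\<exists>c\<in>C. \<exists>z\<in>D c. j c = k \<and> v c z = x" if "k \<in> faces T" "x \<in> face T k" for k x
    using covT[OF that] unfolding v_def by blast
  have topS: "topspace (surface S) = p ` Z"
  proof (intro equalityI subsetI)
    fix P assume "P \<in> topspace (surface S)"
    then obtain k x where kx: "k \<in> faces S" "x \<in> face S k" "P = surface_point S (k, x)"
      by (auto simp: topspace_surface)
    obtain c z where "c \<in> C" "z \<in> D c" "i c = k" "u c z = x"
      using covS'[OF kx(1,2)] by blast
    then have "(c, z) \<in> Z" "P = p (c, z)"
      using kx by (auto simp: Z_def p_def)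
    then show "P \<in> p ` Z" by blast
  qed (use iS imS in \<open>auto simp: topspace_surface Z_def p_def u_def intro!: imageI\<close>)
  have topT: "topspace (surface T) = q ` Z"
  proof (intro equalityI subsetI)
    fix P assume "P \<in> topspace (surface T)"
    then obtain k x where kx: "k \<in> faces T" "x \<in> face T k" "P = surface_point T (k, x)"
      by (auto simp: topspace_surface)
    obtain c z where "c \<in> C" "z \<in> D c" "j c = k" "v c z = x"
      using covT'[OF kx(1,2)] by blast
    then have "(c, z) \<in> Z" "P = q (c, z)"
      using kx by (auto simp: Z_def q_def)
    then show "P \<in> q ` Z" by blast
  qed (use jT imT in \<open>auto simp: topspace_surface Z_def q_def v_def intro!: imageI\<close>)
  have cont_f: "continuous_map (surface S) (surface T) f"
  proof (rule continuous_map_surface[OF fin cpt iS cont_u im_u covS' jT cont_v im_v])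
    show "f (surface_point S (i c, u c z)) = surface_point T (j c, v c z)"
      if "c \<in> C" "z \<in> D c" for c z
      using f[of "(c, z)"] that by (simp add: Z_def p_def q_def)
  qed
  have cont_g: "continuous_map (surface T) (surface S) g"
  proof (rule continuous_map_surface[OF fin cpt jT cont_v im_v covT' iS cont_u im_u])
    show "g (surface_point T (j c, v c z)) = surface_point S (i c, u c z)"
      if "c \<in> C" "z \<in> D c" for c z
      using g[of "(c, z)"] that by (simp add: Z_def p_def q_def)
  qed
  have homeo: "homeomorphic_map (surface S) (surface T) f"
    unfolding homeomorphic_map_maps homeomorphic_maps_def
    by (rule exI[of _ g]) (use cont_f cont_g f g in \<open>auto simp: topS topT\<close>)
  have "\<exists>W b. openin (surface S) W \<and> P \<in> W \<and> W \<subseteq> U \<and> f ` W \<subseteq> V \<and> (\<forall>Q\<in>W. \<psi> (f Q) = M *v \<phi> Q + b)"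
    if \<phi>: "translation_chart S U \<phi>" and \<psi>: "translation_chart T V \<psi>" and P: "P \<in> U" "f P \<in> V"
    for U \<phi> V \<psi> P
  proof -
    have U: "openin (surface S) U" and V: "openin (surface T) V"
      using \<phi> \<psi> by (auto simp: translation_chart_def)
    define U' where "U' = {Q \<in> U. f Q \<in> V}"
    have "U' = U \<inter> {Q \<in> topspace (surface S). f Q \<in> V}"
      using openin_subset[OF U] by (auto simp: U'_def)
    then have U': "openin (surface S) U'"
      using U V cont_f by (auto simp: continuous_map_def)
    \<comment> \<open>Having derivative \<open>M\<close> near \<open>P\<close> means that
      \<open>h\<close> is locally constant there, so the neighbourhood sought is the level set of
      \<open>h\<close> through \<open>P\<close>.\<close>
    define h where "h = (\<lambda>Q. \<psi> (f Q) - M *v \<phi> Q)"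
    define W where "W = {Q \<in> U'. h Q = h P}"
    have cont_\<phi>: "continuous_map (subtopology (surface S) U) euclidean \<phi>"
      using \<phi> by (auto simp: translation_chart_def continuous_map_in_subtopology
          dest!: homeomorphic_imp_continuous_map)
    have cont_\<psi>: "continuous_map (subtopology (surface T) V) euclidean \<psi>"
      using \<psi> by (auto simp: translation_chart_def continuous_map_in_subtopology
          dest!: homeomorphic_imp_continuous_map)
    have level: "openin (top_of_set (D c)) {z \<in> D c. p (c, z) \<in> W}"
      if c: "c \<in> C" and solid: "convex (D c)" "interior (D c) \<noteq> {}" for c
    proof -
      define G where "G = {z \<in> D c. p (c, z) \<in> U'}"
      have cont_p: "continuous_map (top_of_set (D c)) (surface S) (\<lambda>z. p (c, z))"
      proof -
        have "continuous_map (top_of_set (D c)) (top_of_set (face S (i c))) (u c)"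
          using cont_u im_u[OF c] by (auto simp: continuous_map_in_subtopology)
        from continuous_map_compose[OF this continuous_map_surface_point[OF iS[OF c]]]
        show ?thesis by (simp add: o_def p_def)
      qed
      have cont_q: "continuous_map (top_of_set (D c)) (surface T) (\<lambda>z. q (c, z))"
      proof -
        have "continuous_map (top_of_set (D c)) (top_of_set (face T (j c))) (v c)"
          using cont_v im_v[OF c] by (auto simp: continuous_map_in_subtopology)
        from continuous_map_compose[OF this continuous_map_surface_point[OF jT[OF c]]]
        show ?thesis by (simp add: o_def q_def)
      qed
      have G: "openin (top_of_set (D c)) G"
        using openin_continuous_map_preimage[OF cont_p U'] by (simp add: G_def)
      have GD: "G \<subseteq> D c" by (auto simp: G_def)
      have fp: "f (p (c, z)) = q (c, z)" if "z \<in> D c" for z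
        using f[of "(c, z)"] c that by (simp add: Z_def)
      have c\<phi>: "continuous_on G (\<lambda>z. \<phi> (p (c, z)))"
      proof -
        have "continuous_map (top_of_set G) (subtopology (surface S) U) (\<lambda>z. p (c, z))"
          using continuous_map_from_subtopology_mono[OF cont_p GD]
          by (auto simp: continuous_map_in_subtopology G_def U'_def)
        from continuous_map_compose[OF this cont_\<phi>] show ?thesis by (simp add: o_def)
      qed
      have c\<psi>: "continuous_on G (\<lambda>z. \<psi> (q (c, z)))"
      proof -
        have "continuous_map (top_of_set G) (subtopology (surface T) V) (\<lambda>z. q (c, z))"
          using continuous_map_from_subtopology_mono[OF cont_q GD] fp GD
          by (auto simp: continuous_map_in_subtopology G_def U'_def)
        from continuous_map_compose[OF this cont_\<psi>] show ?thesis by (simp add: o_def)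
      qed
      have "openin (top_of_set (D c)) {z \<in> G. \<psi> (q (c, z)) - M *v \<phi> (p (c, z)) = h P}"
      proof (rule openin_level_set_of_locally_constant[OF solid G])
        show "continuous_on G (\<lambda>z. \<psi> (q (c, z)) - M *v \<phi> (p (c, z)))"
          using c\<phi> c\<psi>
          by (intro continuous_on_diff
              bounded_linear.continuous_on[OF matrix_vector_mul_bounded_linear])
        fix z assume z: "z \<in> G" "z \<in> interior (D c)"
        have "u c z \<in> interior (face S (i c))" "surface_point S (i c, u c z) \<in> U"
          using affine_image_interior[OF L imS[OF c] z(2)] z(1)
          by (auto simp: u_def G_def U'_def p_def)
        then obtain a where a: "\<forall>\<^sub>F x in nhds (u c z). \<phi> (surface_point S (i c, x)) = x + a"
          using \<phi> iS[OF c] unfolding translation_chart_def by blast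
        have "v c z \<in> interior (face T (j c))" "surface_point T (j c, v c z) \<in> V"
          using affine_image_interior[OF invertible_mult[OF M L] imT[OF c] z(2)] z(1) GD fp
          by (auto simp: v_def G_def U'_def q_def)
        then obtain b where b: "\<forall>\<^sub>F x in nhds (v c z). \<psi> (surface_point T (j c, x)) = x + b"
          using \<psi> jT[OF c] unfolding translation_chart_def by blast
        have "\<forall>\<^sub>F y in nhds z. \<phi> (p (c, y)) = u c y + a"
          using filterlim_iff[THEN iffD1, OF tendsto_affine_map[of L "s c" z], rule_format] a
          by (simp add: u_def p_def)
        moreover have "\<forall>\<^sub>F y in nhds z. \<psi> (q (c, y)) = v c y + b"
          using filterlim_iff[THEN iffD1, OF tendsto_affine_map[of "M ** L" "t c" z], rule_format] b
          by (simp add: v_def q_def)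
        ultimately have "\<forall>\<^sub>F y in nhds z. \<psi> (q (c, y)) - M *v \<phi> (p (c, y)) =
            t c + b - M *v (s c + a)"
          by eventually_elim
            (simp add: u_def v_def matrix_vector_mul_assoc[symmetric] matrix_vector_right_distrib)
        moreover from this have "\<psi> (q (c, z)) - M *v \<phi> (p (c, z)) = t c + b - M *v (s c + a)"
          by (rule eventually_nhds_x_imp_x)
        ultimately show "\<forall>\<^sub>F y in nhds z. \<psi> (q (c, y)) - M *v \<phi> (p (c, y)) = \<psi> (q (c, z)) - M *v \<phi> (p (c, z))"
          by simp
      qed
      also have "{z \<in> G. \<psi> (q (c, z)) - M *v \<phi> (p (c, z)) = h P} = {z \<in> D c. p (c, z) \<in> W}"
        using fp by (auto simp: G_def W_def h_def)
      finally show ?thesis .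
    qed
    have "openin (surface S) W"
      unfolding openin_surface
    proof (intro conjI ballI)
      show "W \<subseteq> surface_point S ` (SIGMA i:faces S. face S i)"
        using openin_subset[OF U'] by (auto simp: W_def topspace_surface)
      fix k assume k: "k \<in> faces S"
      \<comment> \<open>Solid pieces alone still cover the face by \<open>covS\<close>, and
        \<open>level\<close> is available for them only.\<close>
      let ?C = "{c \<in> C. i c = k \<and> convex (D c) \<and> interior (D c) \<noteq> {}}"
      show "openin (top_of_set (face S k)) {x \<in> face S k. surface_point S (k, x) \<in> W}"
      proof (rule openin_finite_compact_cover[where C = ?C and D = D and u = u])
        show "face S k = (\<Union>c\<in>?C. u c ` D c)"
        proof (intro set_eqI iffI)
          fix x assume "x \<in> face S k"
          from covS[OF k this] show "x \<in> (\<Union>c\<in>?C. u c ` D c)" unfolding u_def by blast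
        next
          fix x assume "x \<in> (\<Union>c\<in>?C. u c ` D c)"
          then show "x \<in> face S k" using im_u by blast
        qed
        fix c assume c: "c \<in> ?C"
        have "{z \<in> D c. p (c, z) \<in> W} = {z \<in> D c. u c z \<in> {x \<in> face S k. surface_point S (k, x) \<in> W}}"
          using c im_u[of c] by (auto simp: p_def)
        with level[of c] c show "openin (top_of_set (D c))
            {z \<in> D c. u c z \<in> {x \<in> face S k. surface_point S (k, x) \<in> W}}"
          by simp
      qed (use fin cpt cont_u in auto)
    qed
    moreover have "\<psi> (f Q) = M *v \<phi> Q + h P" if "Q \<in> W" for Q
    proof -
      have "h Q = h P" using that by (simp add: W_def)
      then show ?thesis by (simp add: h_def algebra_simps)
    qed
    ultimately show ?thesis
      using P by (intro exI[of _ W] exI[of _ "h P"]) (auto simp: W_def U'_def)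
  qed
  then show ?thesis
    using M homeo unfolding affine_homeomorphism_def by blast
qed

subsection \<open>Neighbours in the grid graph\<close>

lemma quarter_turn_unit:
  "\<bar>fst (quarter_turn v d)\<bar> + \<bar>snd (quarter_turn v d)\<bar> = \<bar>fst d\<bar> + \<bar>snd d\<bar>"
  by (auto simp: quarter_turn_def)

lemma quarter_turn_funpow_unit:
  "\<bar>fst ((quarter_turn v ^^ k) d)\<bar> + \<bar>snd ((quarter_turn v ^^ k) d)\<bar> = \<bar>fst d\<bar> + \<bar>snd d\<bar>"
  by (induction k) (auto simp: quarter_turn_unit)

text \<open>From \<open>m * n \<ge> 6\<close> one of the two is at least 3, so no vertex is
  isolated. The fourth turn is the identity, which is how a vertex of degree one gets its only edge
  as its own successor.\<close>

lemma ex_grid_neighbour: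
  assumes v: "v \<in> grid_vertices m n" and "m * n \<ge> 6" and d: "\<bar>fst d\<bar> + \<bar>snd d\<bar> = 1"
  shows "\<exists>k>0. v + (quarter_turn v ^^ k) d \<in> grid_vertices m n"
proof -
  obtain i j where ij: "v = (i, j)" "1 \<le> i" "i < int m" "1 \<le> j" "j < int n"
    using v by (auto simp: grid_vertices_def)
  have "m \<ge> 3 \<or> n \<ge> 3"
  proof (rule ccontr)
    assume "\<not> (m \<ge> 3 \<or> n \<ge> 3)"
    then have "m * n \<le> 2 * 2" by (intro mult_mono) auto
    then show False using assms by simp
  qed
  then have "v + (1, 0) \<in> grid_vertices m n \<or> v + (-1, 0) \<in> grid_vertices m n \<or>
      v + (0, 1) \<in> grid_vertices m n \<or> v + (0, -1) \<in> grid_vertices m n"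
    using ij by (auto simp: grid_vertices_def)
  then obtain u where u: "v + u \<in> grid_vertices m n" "u \<in> {(1, 0), (-1, 0), (0, 1), (0, -1)}"
    by blast
  have "d \<in> {(1, 0), (-1, 0), (0, 1), (0, -1)}"
    using d by (cases d) (auto simp: abs_if split: if_splits)
  then have "u = (quarter_turn v ^^ 1) d \<or> u = (quarter_turn v ^^ 2) d \<or>
      u = (quarter_turn v ^^ 3) d \<or> u = (quarter_turn v ^^ 4) d"
    using u(2) by (auto simp: quarter_turn_def eval_nat_numeral)
  then obtain k where "k > 0" "u = (quarter_turn v ^^ k) d"
    by (metis zero_less_numeral zero_less_one)
  with u show ?thesis by auto
qed

text \<open>The first return is unfolded by one quarter turn. Since \<open>u\<close> may lie outside
  the grid, this also applies to neighbours on the boundary, which occur in the flat cells.\<close>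

lemma next_neighbour_step:
  fixes v u :: vertex
  defines "u' \<equiv> v + quarter_turn v (u - v)"
  assumes ex: "\<exists>k>0. v + (quarter_turn v ^^ k) (u - v) \<in> grid_vertices m n"
  shows "next_neighbour m n v u =
           (if u' \<in> grid_vertices m n then u' else next_neighbour m n v u')"
proof -
  define P where "P = (\<lambda>k. v + (quarter_turn v ^^ k) (u - v) \<in> grid_vertices m n)"
  define K where "K = (LEAST k. 0 < k \<and> P k)"
  have K: "0 < K" "P K" "\<And>l. 0 < l \<Longrightarrow> P l \<Longrightarrow> K \<le> l"
    using LeastI_ex[of "\<lambda>k. 0 < k \<and> P k"] Least_le[of "\<lambda>k. 0 < k \<and> P k"] ex
    by (auto simp: K_def P_def)
  have nn: "next_neighbour m n v u = v + (quarter_turn v ^^ K) (u - v)"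
    by (simp add: next_neighbour_def K_def P_def)
  have shift: "(quarter_turn v ^^ k) (u' - v) = (quarter_turn v ^^ Suc k) (u - v)" for k
    by (simp add: u'_def funpow_swap1)
  show ?thesis
  proof (cases "u' \<in> grid_vertices m n")
    case True
    then have "P 1" by (simp add: P_def u'_def)
    then have "K = 1" using K(1) K(3)[of 1] by simp
    then show ?thesis using True by (simp add: nn u'_def)
  next
    case False
    then have "\<not> P 1" by (simp add: P_def u'_def)
    then have "K \<noteq> 1" using K by auto
    then obtain l where l: "K = Suc l" "0 < l" using K(1) by (cases K) auto
    have "(LEAST k. 0 < k \<and> v + (quarter_turn v ^^ k) (u' - v) \<in> grid_vertices m n) = l"
    proof (rule Least_equality)
      show "0 < l \<and> v + (quarter_turn v ^^ l) (u' - v) \<in> grid_vertices m n"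
        using K(2) l by (simp only: shift P_def)
      fix k assume "0 < k \<and> v + (quarter_turn v ^^ k) (u' - v) \<in> grid_vertices m n"
      then have "P (Suc k)" by (simp only: shift P_def)
      then show "l \<le> k" using K(3)[of "Suc k"] l by simp
    qed
    then have "next_neighbour m n v u' = v + (quarter_turn v ^^ K) (u - v)"
      by (simp only: next_neighbour_def shift l)
    then show ?thesis using False nn by simp
  qed
qed

lemma next_neighbour_props:
  assumes v: "v \<in> grid_vertices m n" and "m * n \<ge> 6"
    and u: "\<bar>fst v - fst u\<bar> + \<bar>snd v - snd u\<bar> = 1"
  shows "next_neighbour m n v u \<in> grid_vertices m n"
    and "\<bar>fst v - fst (next_neighbour m n v u)\<bar> + \<bar>snd v - snd (next_neighbour m n v u)\<bar> = 1"
proof -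
  have d: "\<bar>fst (u - v)\<bar> + \<bar>snd (u - v)\<bar> = 1"
    using u by simp
  show "next_neighbour m n v u \<in> grid_vertices m n"
    using LeastI_ex[OF ex_grid_neighbour[OF v assms(2) d]] by (simp add: next_neighbour_def)
  show "\<bar>fst v - fst (next_neighbour m n v u)\<bar> + \<bar>snd v - snd (next_neighbour m n v u)\<bar> = 1"
    using quarter_turn_funpow_unit[of _ v "u - v"] d
    by (simp add: next_neighbour_def abs_minus_commute)
qed

lemma odd_sum_neighbour:
  fixes u v :: vertex
  assumes "\<bar>fst v - fst u\<bar> + \<bar>snd v - snd u\<bar> = 1"
  shows "odd (fst u + snd u) \<longleftrightarrow> even (fst v + snd v)"
proof -
  have "fst u = fst v \<and> (snd u = snd v + 1 \<or> snd u = snd v - 1) \<or>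
        snd u = snd v \<and> (fst u = fst v + 1 \<or> fst u = fst v - 1)"
    using assms by (auto simp: abs_if split: if_splits)
  then show ?thesis by auto
qed

lemma east_in_grid_edges:
  assumes e: "e \<in> grid_edges m n" and "m * n \<ge> 6"
  shows "east m n e \<in> grid_edges m n"
proof -
  obtain a b where ab: "e = (a, b)" "a \<in> grid_vertices m n" "even (fst a + snd a)"
    "\<bar>fst a - fst b\<bar> + \<bar>snd a - snd b\<bar> = 1"
    using e by (auto simp: grid_edges_def)
  then show ?thesis
    using next_neighbour_props[OF ab(2) assms(2) ab(4)]
      odd_sum_neighbour[of a "next_neighbour m n a b"]
    by (simp add: east_def grid_edges_def)
qed

text \<open>Undoing \<open>K\<close> steps runs through the same orbit backwards, and no point
  strictly between its ends satisfies \<open>P\<close>.\<close>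

lemma first_return_inverse:
  fixes R R' :: "'a \<Rightarrow> 'a"
  assumes inv: "\<And>x. R' (R x) = x" and d: "P d" and ex: "\<exists>k>0. P ((R ^^ k) d)"
    and K_def: "K = (LEAST k. 0 < k \<and> P ((R ^^ k) d))"
  shows "(LEAST k. 0 < k \<and> P ((R' ^^ k) ((R ^^ K) d))) = K" and "(R' ^^ K) ((R ^^ K) d) = d"
proof -
  have K: "0 < K" "\<And>l. 0 < l \<Longrightarrow> P ((R ^^ l) d) \<Longrightarrow> K \<le> l"
    using LeastI_ex[OF ex] Least_le[of "\<lambda>k. 0 < k \<and> P ((R ^^ k) d)"] by (auto simp: K_def)
  have undo: "(R' ^^ k) ((R ^^ K) d) = (R ^^ (K - k)) d" if "k \<le> K" for k
    using that
  proof (induction k)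
    case (Suc k)
    then have "(R ^^ (K - k)) d = R ((R ^^ (K - Suc k)) d)"
      by (metis Suc_diff_le diff_Suc_Suc funpow.simps(2) o_apply)
    then show ?case using Suc by (simp add: inv)
  qed simp
  show "(R' ^^ K) ((R ^^ K) d) = d" using undo[of K] by simp
  show "(LEAST k. 0 < k \<and> P ((R' ^^ k) ((R ^^ K) d))) = K"
  proof (rule Least_equality)
    show "0 < K \<and> P ((R' ^^ K) ((R ^^ K) d))" using K d undo[of K] by simp
    fix k assume k: "0 < k \<and> P ((R' ^^ k) ((R ^^ K) d))"
    show "K \<le> k"
    proof (rule ccontr)
      assume "\<not> K \<le> k"
      then have "P ((R ^^ (K - k)) d)" "0 < K - k" using k undo[of k] by auto
      then have "K \<le> K - k" using K(2) by blast
      then show False using K(1) conjunct1[OF k] by linarith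
    qed
  qed
qed

section \<open>Exchanging the coordinates of the graph\<close>

lemma grid_vertices_swap: "prod.swap v \<in> grid_vertices n m \<longleftrightarrow> v \<in> grid_vertices m n"
  by (cases v) (auto simp: grid_vertices_def)

text \<open>Transposition reverses the orientation of the plane. At an even-sum vertex both
  coordinates have the same parity, so the prescribed sense stays and the turn is inverted; at an
  odd-sum vertex the prescribed sense is reversed too and the turn is preserved.\<close>

lemma quarter_turn_swap_even:
  assumes "even (fst v + snd v)"
  shows "quarter_turn (prod.swap v) (prod.swap (quarter_turn v d)) = prod.swap d"
  using assms by (cases d) (auto simp: quarter_turn_def)

lemma quarter_turn_swap_odd:
  assumes "odd (fst v + snd v)"
  shows "quarter_turn (prod.swap v) (prod.swap d) = prod.swap (quarter_turn v d)"
  using assms by (cases d) (auto simp: quarter_turn_def)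

text \<open>The inverse turn has the inverse first return, and grid membership is symmetric under
  the exchange.\<close>

lemma next_neighbour_swap_even:
  assumes v: "v \<in> grid_vertices m n" "even (fst v + snd v)" and u: "u \<in> grid_vertices m n"
    and uv: "\<bar>fst v - fst u\<bar> + \<bar>snd v - snd u\<bar> = 1" and "m * n \<ge> 6"
  shows "next_neighbour n m (prod.swap v) (prod.swap (next_neighbour m n v u)) = prod.swap u"
proof -
  let ?R = "quarter_turn v" and ?R' = "\<lambda>d. prod.swap (quarter_turn (prod.swap v) (prod.swap d))"
  let ?P = "\<lambda>d. v + d \<in> grid_vertices m n"
  define K where "K = (LEAST k. 0 < k \<and> ?P ((?R ^^ k) (u - v)))"
  have ex: "\<exists>k>0. ?P ((?R ^^ k) (u - v))"
    using uv by (intro ex_grid_neighbour[OF v(1) assms(5)]) simp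
  have inv: "?R' (?R x) = x" for x
    by (simp add: quarter_turn_swap_even[OF v(2)])
  have fr: "(LEAST k. 0 < k \<and> ?P ((?R' ^^ k) ((?R ^^ K) (u - v)))) = K"
    "(?R' ^^ K) ((?R ^^ K) (u - v)) = u - v"
    using first_return_inverse[of ?R' ?R ?P "u - v", OF inv _ ex K_def] u by simp_all
  have pow: "(quarter_turn (prod.swap v) ^^ k) (prod.swap d) = prod.swap ((?R' ^^ k) d)" for k d
    by (induction k) simp_all
  have sub: "prod.swap (next_neighbour m n v u) - prod.swap v = prod.swap ((?R ^^ K) (u - v))"
    by (simp add: next_neighbour_def K_def prod_eq_iff)
  have mem: "prod.swap v + prod.swap d \<in> grid_vertices n m \<longleftrightarrow> ?P d" for d
    using grid_vertices_swap[of "v + d" n m] by (simp add: prod_eq_iff plus_prod_def)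
  have "next_neighbour n m (prod.swap v) (prod.swap (next_neighbour m n v u)) =
      prod.swap v + prod.swap (u - v)"
    unfolding next_neighbour_def[of n m] sub pow mem fr ..
  also have "\<dots> = prod.swap u"
    by (simp add: prod_eq_iff)
  finally show ?thesis .
qed

lemma next_neighbour_swap_odd:
  assumes "odd (fst v + snd v)"
  shows "next_neighbour n m (prod.swap v) (prod.swap u) = prod.swap (next_neighbour m n v u)"
proof -
  have sub: "prod.swap u - prod.swap v = prod.swap (u - v)"
    by (simp add: prod_eq_iff)
  have pow: "(quarter_turn (prod.swap v) ^^ k) (prod.swap d) = prod.swap ((quarter_turn v ^^ k) d)"
    for k d
    by (induction k) (simp_all add: quarter_turn_swap_odd[OF assms])
  have mem: "prod.swap v + prod.swap d \<in> grid_vertices n m \<longleftrightarrow> v + d \<in> grid_vertices m n" for d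
    using grid_vertices_swap[of "v + d" n m] by (simp add: prod_eq_iff plus_prod_def)
  show ?thesis
    unfolding next_neighbour_def sub pow mem by (simp add: prod_eq_iff)
qed

text \<open>Coordinate sums are symmetric, so the even and the odd endpoint keep their places in the
  pair.\<close>

definition swap_edge :: "vertex \<times> vertex \<Rightarrow> vertex \<times> vertex" where
  "swap_edge e = (prod.swap (fst e), prod.swap (snd e))"

lemma swap_edge_swap_edge [simp]: "swap_edge (swap_edge e) = e"
  by (simp add: swap_edge_def)

lemma swap_edge_in_grid_edges: "e \<in> grid_edges m n \<Longrightarrow> swap_edge e \<in> grid_edges n m"
  by (auto simp: grid_edges_def swap_edge_def grid_vertices_swap add.commute)

lemma weight_pos:
  assumes "v \<in> grid_vertices m n"
  shows "weight m n v > 0"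
proof -
  have "sin (of_int i * pi / of_nat l) > 0" if "0 < i" "i < int l" for i l
  proof (rule sin_gt_zero)
    have l: "0 < real l" "of_int i < real l" using that by linarith+
    then show "0 < of_int i * pi / real l" using that by simp
    show "of_int i * pi / real l < pi" using l by (simp add: field_simps)
  qed
  then show ?thesis
    using assms by (auto simp: weight_def grid_vertices_def)
qed

lemma weight_swap: "weight n m (prod.swap v) = weight m n v"
  by (simp add: weight_def)

lemma east_swap_edge:
  assumes "e \<in> grid_edges m n" "m * n \<ge> 6"
  shows "east n m (swap_edge (east m n e)) = swap_edge e"
proof -
  have e: "fst e \<in> grid_vertices m n" "even (fst (fst e) + snd (fst e))" "snd e \<in> grid_vertices m n"
    "\<bar>fst (fst e) - fst (snd e)\<bar> + \<bar>snd (fst e) - snd (snd e)\<bar> = 1"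
    using assms(1) by (auto simp: grid_edges_def)
  show ?thesis
    by (simp add: east_def swap_edge_def next_neighbour_swap_even[OF e assms(2)])
qed

lemma north_swap_edge:
  assumes "e \<in> grid_edges m n"
  shows "north n m (swap_edge e) = swap_edge (north m n e)"
proof -
  have "odd (fst (snd e) + snd (snd e))"
    using assms by (auto simp: grid_edges_def)
  then show ?thesis
    by (simp add: north_def swap_edge_def next_neighbour_swap_odd)
qed

section \<open>Gluings of the rectangles and their horizontal reflection\<close>

lemma vector_2_eq_iff: "(vector [a, b] :: plane) = x \<longleftrightarrow> x $ 1 = a \<and> x $ 2 = b"
  by (auto simp: vec_eq_iff forall_2)

lemma gluings_surface_X:
  "gluings (surface_X m n) =
     {((e, vector [weight m n (snd e), 0]), (east m n e, 0), vector [0, weight m n (fst e)])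
        | e. e \<in> grid_edges m n} \<union>
     {((e, vector [0, weight m n (fst e)]), (north m n e, 0), vector [weight m n (snd e), 0])
        | e. e \<in> grid_edges m n}"
  by (simp add: surface_X_def)

text \<open>The side is parametrised by length here, not by the fraction used in
  \<open>side_identification\<close>.\<close>

lemma surface_X_east:
  assumes "e \<in> grid_edges m n" "0 \<le> r" "r \<le> weight m n (fst e)"
  shows "surface_point (surface_X m n) (e, vector [weight m n (snd e), r]) =
         surface_point (surface_X m n) (east m n e, vector [0, r])"
proof -
  let ?h = "weight m n (fst e)"
  have r: "0 \<le> r / ?h" "r / ?h \<le> 1"
    using assms(2,3) by (auto simp: divide_le_eq_1)
  have "((e, vector [weight m n (snd e), 0]), (east m n e, 0), vector [0, ?h]) \<in> gluings (surface_X m n)"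
    using assms(1) unfolding gluings_surface_X by blast
  from surface_point_gluing[OF this r]
  have "surface_point (surface_X m n) (e, vector [weight m n (snd e), 0] + (r / ?h) *\<^sub>R vector [0, ?h]) =
         surface_point (surface_X m n) (east m n e, 0 + (r / ?h) *\<^sub>R vector [0, ?h])"
    .
  moreover have "vector [x, 0] + (r / ?h) *\<^sub>R vector [0, ?h] = (vector [x, r] :: plane)" for x
    using assms by (auto simp: vec_eq_iff forall_2)
  moreover have "(0 :: plane) = vector [0, 0]"
    by (simp add: vec_eq_iff forall_2)
  ultimately show ?thesis by metis
qed

lemma surface_X_north:
  assumes "e \<in> grid_edges m n" "0 \<le> r" "r \<le> weight m n (snd e)"
  shows "surface_point (surface_X m n) (e, vector [r, weight m n (fst e)]) =
         surface_point (surface_X m n) (north m n e, vector [r, 0])"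
proof -
  let ?w = "weight m n (snd e)"
  have r: "0 \<le> r / ?w" "r / ?w \<le> 1"
    using assms(2,3) by (auto simp: divide_le_eq_1)
  have "((e, vector [0, weight m n (fst e)]), (north m n e, 0), vector [?w, 0]) \<in> gluings (surface_X m n)"
    using assms(1) unfolding gluings_surface_X by blast
  from surface_point_gluing[OF this r]
  have "surface_point (surface_X m n) (e, vector [0, weight m n (fst e)] + (r / ?w) *\<^sub>R vector [?w, 0]) =
         surface_point (surface_X m n) (north m n e, 0 + (r / ?w) *\<^sub>R vector [?w, 0])"
    .
  moreover have "vector [0, x] + (r / ?w) *\<^sub>R vector [?w, 0] = (vector [r, x] :: plane)" for x
    using assms by (auto simp: vec_eq_iff forall_2)
  moreover have "(0 :: plane) = vector [0, 0]"
    by (simp add: vec_eq_iff forall_2)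
  ultimately show ?thesis by metis
qed

lemma fst_east [simp]: "fst (east m n e) = fst e" and snd_north [simp]: "snd (north m n e) = snd e"
  by (simp_all add: east_def north_def)

lemma side_identification_surface_X:
  assumes "(p, q) \<in> side_identification (surface_X m n)"
  obtains e r where "e \<in> grid_edges m n" "0 \<le> r" "r \<le> weight m n (fst e)"
      "p = (e, vector [weight m n (snd e), r])" "q = (east m n e, vector [0, r])"
  | e r where "e \<in> grid_edges m n" "0 \<le> r" "r \<le> weight m n (snd e)"
      "p = (e, vector [r, weight m n (fst e)])" "q = (north m n e, vector [r, 0])"
proof -
  obtain i x j y v t where g: "((i, x), (j, y), v) \<in> gluings (surface_X m n)" and t: "0 \<le> t" "t \<le> 1"
    and p: "p = (i, x + t *\<^sub>R v)" and q: "q = (j, y + t *\<^sub>R v)"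
    using assms unfolding side_identification_def by blast
  have pos: "0 \<le> t * weight m n u" "t * weight m n u \<le> weight m n u" if "u \<in> grid_vertices m n" for u
    using weight_pos[OF that] t by (auto simp: mult_le_cancel_right1)
  from g show ?thesis
    unfolding gluings_surface_X
  proof (elim UnE CollectE exE conjE)
    fix e assume e: "((i, x), (j, y), v) =
      ((e, vector [weight m n (snd e), 0]), (east m n e, 0), vector [0, weight m n (fst e)])"
      "e \<in> grid_edges m n"
    then have "fst e \<in> grid_vertices m n" by (auto simp: grid_edges_def)
    then show ?thesis
      using that(1)[of e "t * weight m n (fst e)"] e pos p q by (simp add: vec_eq_iff forall_2)
  next
    fix e assume e: "((i, x), (j, y), v) =
      ((e, vector [0, weight m n (fst e)]), (north m n e, 0), vector [weight m n (snd e), 0])"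
      "e \<in> grid_edges m n"
    then have "snd e \<in> grid_vertices m n" by (auto simp: grid_edges_def)
    then show ?thesis
      using that(2)[of e "t * weight m n (snd e)"] e pos p q by (simp add: vec_eq_iff forall_2)
  qed
qed

definition reflect :: "nat \<Rightarrow> nat \<Rightarrow> (vertex \<times> vertex) \<times> plane \<Rightarrow> (vertex \<times> vertex) \<times> plane" where
  "reflect m n p = (swap_edge (fst p), vector [weight m n (snd (fst p)) - snd p $ 1, snd p $ 2])"

text \<open>Reflection carries generating identifications to generating ones. The right side of
  \<open>e\<close> becomes the left side of the reflected rectangle, which is why inverting
  \<open>east\<close> is what fits; top and bottom sides are kept, with the parameter
  reversed.\<close>

lemma surface_point_reflect:
  assumes "surface_point (surface_X m n) p = surface_point (surface_X m n) q" and mn: "m * n \<ge> 6"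
  shows "surface_point (surface_X n m) (reflect m n p) = surface_point (surface_X n m) (reflect m n q)"
proof -
  let ?S = "surface_X m n" and ?g = "\<lambda>p. surface_point (surface_X n m) (reflect m n p)"
  have gen: "?g p = ?g q" if "(p, q) \<in> side_identification ?S" for p q
    using that
  proof (cases rule: side_identification_surface_X)
    case (1 e r)
    have e: "swap_edge (east m n e) \<in> grid_edges n m"
      using 1(1) mn by (intro swap_edge_in_grid_edges east_in_grid_edges)
    have w: "weight n m (fst (swap_edge (east m n e))) = weight m n (fst e)"
      "weight n m (snd (swap_edge (east m n e))) = weight m n (snd (east m n e))"
      by (simp_all add: swap_edge_def weight_swap)
    have "surface_point (surface_X n m) (swap_edge (east m n e), vector [weight m n (snd (east m n e)), r]) =
          surface_point (surface_X n m) (swap_edge e, vector [0, r])"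
      using surface_X_east[OF e] 1 mn w by (simp add: east_swap_edge)
    then show ?thesis using 1 by (simp add: reflect_def)
  next
    case (2 e r)
    have e: "swap_edge e \<in> grid_edges n m"
      using 2(1) by (rule swap_edge_in_grid_edges)
    have w: "weight n m (fst (swap_edge e)) = weight m n (fst e)"
      "weight n m (snd (swap_edge e)) = weight m n (snd e)"
      by (simp_all add: swap_edge_def weight_swap)
    show ?thesis
      using surface_X_north[OF e, of "weight m n (snd e) - r"] 2 w
      by (simp add: reflect_def north_swap_edge)
  qed
  have "?g p = ?g q" if "(p, q) \<in> (side_identification ?S \<union> (side_identification ?S)\<inverse>)\<^sup>*"
    using that
  proof (induction rule: rtrancl_induct)
    case (step r q)
    then have "(r, q) \<in> side_identification ?S \<or> (q, r) \<in> side_identification ?S" by blast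
    then show ?case using step.IH gen[of r q] gen[of q r] by auto
  qed simp
  then show ?thesis using assms(1) by (simp add: surface_point_eq_iff)
qed

lemma reflect_reflect [simp]: "reflect n m (reflect m n p) = p"
  by (cases p) (simp add: reflect_def swap_edge_def weight_swap vector_2_eq_iff)

lemma surface_point_reflect_iff:
  assumes "m * n \<ge> 6"
  shows "surface_point (surface_X n m) (reflect m n p) = surface_point (surface_X n m) (reflect m n q) \<longleftrightarrow>
    surface_point (surface_X m n) p = surface_point (surface_X m n) q"
  using surface_point_reflect[of m n p q] surface_point_reflect[of n m "reflect m n p" "reflect m n q"]
    assms by (auto simp: mult.commute)

subsection \<open>Cells of the sheared polygons\<close>

text \<open>
  In the sheared polygon \<open>k\<close>, columns \<open>a\<close> and rows \<open>b\<close> of the grid are numbered from \<open>0\<close>; column \<open>a\<close>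
  belongs to the vertex \<open>odd_vertex n k a\<close> and row \<open>b\<close> to \<open>even_vertex n k b\<close>, whose parities are
  those of the sums of their coordinates. The second coordinate runs upwards for odd \<open>k\<close> and
  downwards for even \<open>k\<close>.
\<close>

definition side_length :: "nat \<Rightarrow> nat \<Rightarrow> nat \<Rightarrow> nat \<Rightarrow> real" where
  "side_length m n k l = (if even l then even_length m n k else odd_length m n k)"

definition row_height :: "nat \<Rightarrow> nat \<Rightarrow> nat \<Rightarrow> nat \<Rightarrow> real" where
  "row_height m n k b = side_length m n k b * sin (real b * pi / real n)"

text \<open>The index of the side is shifted so that \<open>column_width m n k (Suc i)\<close> and
  \<open>row_height m n k i\<close> are the coordinates of side \<open>i\<close> after the inverse
  shear. Lengths depend on parity only, so \<open>Suc a\<close> stands for the side before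
  \<open>a\<close> without a subtraction.\<close>

definition column_width :: "nat \<Rightarrow> nat \<Rightarrow> nat \<Rightarrow> nat \<Rightarrow> real" where
  "column_width m n k a = side_length m n k (Suc a) * sin (real a * pi / real n)"

text \<open>The integer \<open>c\<close> with \<open>side_length m n k l = sin (c * pi / m)\<close>:
  the two side lengths of polygon \<open>k\<close> correspond to two neighbouring columns of the
  graph.\<close>

definition column :: "nat \<Rightarrow> nat \<Rightarrow> nat \<Rightarrow> nat" where
  "column n k l = (if even l \<longleftrightarrow> odd n \<or> odd k then k + 1 else k)"

definition row :: "nat \<Rightarrow> nat \<Rightarrow> nat \<Rightarrow> int" where
  "row n k l = (if odd k then int l else int n - int l)"

definition even_vertex :: "nat \<Rightarrow> nat \<Rightarrow> nat \<Rightarrow> vertex" where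
  "even_vertex n k b = (int (column n k b), row n k b)"

definition odd_vertex :: "nat \<Rightarrow> nat \<Rightarrow> nat \<Rightarrow> vertex" where
  "odd_vertex n k a = (int (column n k (Suc a)), row n k a)"

lemma side_length_Suc_Suc [simp]: "side_length m n k (Suc (Suc l)) = side_length m n k l"
  by (simp add: side_length_def)

lemma column_Suc_Suc [simp]: "column n k (Suc (Suc l)) = column n k l"
  by (simp add: column_def)

lemma side_length_column: "side_length m n k l = sin (real (column n k l) * pi / real m)"
  by (auto simp: side_length_def column_def even_length_def odd_length_def)

lemma column_le: "k < m \<Longrightarrow> column n k l \<le> m"
  by (auto simp: column_def)

lemma sin_multiple_pi_div:
  assumes "l \<le> m" "0 < m"
  shows "sin (real l * pi / real m) \<ge> 0"
    and "sin (real l * pi / real m) > 0 \<longleftrightarrow> 0 < l \<and> l < m"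
proof -
  show "sin (real l * pi / real m) \<ge> 0"
    using assms by (intro sin_ge_zero) (auto simp: field_simps)
  show "sin (real l * pi / real m) > 0 \<longleftrightarrow> 0 < l \<and> l < m"
  proof
    assume "0 < l \<and> l < m"
    then show "sin (real l * pi / real m) > 0"
      by (intro sin_gt_zero) (auto simp: field_simps)
  next
    assume *: "sin (real l * pi / real m) > 0"
    have "l \<noteq> 0" using * by (intro notI) simp
    moreover have "l \<noteq> m" using * assms by (intro notI) simp
    ultimately show "0 < l \<and> l < m" using assms by simp
  qed
qed

lemma side_length_nonneg: "k < m \<Longrightarrow> side_length m n k l \<ge> 0"
  by (simp add: side_length_column sin_multiple_pi_div column_le)

lemma side_length_pos_iff:
  "k < m \<Longrightarrow> side_length m n k l > 0 \<longleftrightarrow> 0 < column n k l \<and> column n k l < m"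
  by (simp add: side_length_column sin_multiple_pi_div column_le)

lemma side_length_pos_or:
  assumes "k < m" "2 \<le> m"
  shows "side_length m n k l > 0 \<or> side_length m n k (Suc l) > 0"
  using assms by (auto simp: side_length_pos_iff column_def)

lemma row_height_nonneg:
  assumes "k < m" "b \<le> n" "0 < n"
  shows "row_height m n k b \<ge> 0"
  using assms by (simp add: row_height_def side_length_nonneg sin_multiple_pi_div)

lemma column_width_nonneg:
  assumes "k < m" "a \<le> n" "0 < n"
  shows "column_width m n k a \<ge> 0"
  using assms by (simp add: column_width_def side_length_nonneg sin_multiple_pi_div)

lemma row_height_pos_iff:
  assumes "k < m" "b \<le> n" "0 < n"
  shows "row_height m n k b > 0 \<longleftrightarrow> side_length m n k b > 0 \<and> 0 < b \<and> b < n"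
  using side_length_nonneg[OF assms(1), of n b] sin_multiple_pi_div[OF assms(2,3)]
  by (auto simp: row_height_def zero_less_mult_iff)

lemma column_width_pos_iff:
  assumes "k < m" "a \<le> n" "0 < n"
  shows "column_width m n k a > 0 \<longleftrightarrow> side_length m n k (Suc a) > 0 \<and> 0 < a \<and> a < n"
  using side_length_nonneg[OF assms(1), of n "Suc a"] sin_multiple_pi_div[OF assms(2,3)]
  by (auto simp: column_width_def zero_less_mult_iff)

text \<open>For even \<open>k\<close> the row is \<open>n - l\<close>, whose angle is
  supplementary.\<close>

lemma sin_row:
  assumes "0 < n"
  shows "sin (of_int (row n k l) * pi / real n) = sin (real l * pi / real n)"
proof (cases "odd k")
  case False
  have "(real n - real l) * pi / real n = pi - real l * pi / real n"
    using assms by (simp add: field_simps)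
  then show ?thesis using False by (simp add: row_def)
qed (simp add: row_def)

lemma weight_even_vertex: "0 < n \<Longrightarrow> weight m n (even_vertex n k b) = row_height m n k b"
  by (simp add: weight_def even_vertex_def row_height_def side_length_column sin_row)

lemma weight_odd_vertex: "0 < n \<Longrightarrow> weight m n (odd_vertex n k a) = column_width m n k a"
  by (simp add: weight_def odd_vertex_def column_width_def side_length_column sin_row)

lemma even_vertex_in_grid:
  assumes "k < m" "b \<le> n" "0 < n"
  shows "even_vertex n k b \<in> grid_vertices m n \<longleftrightarrow> row_height m n k b > 0"
  using assms
  by (auto simp: row_height_pos_iff side_length_pos_iff even_vertex_def grid_vertices_def row_def)

lemma odd_vertex_in_grid:
  assumes "k < m" "a \<le> n" "0 < n"
  shows "odd_vertex n k a \<in> grid_vertices m n \<longleftrightarrow> column_width m n k a > 0"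
  using assms
  by (auto simp: column_width_pos_iff side_length_pos_iff odd_vertex_def grid_vertices_def row_def)

lemma even_sum_even_vertex: "even (fst (even_vertex n k b) + snd (even_vertex n k b))"
  by (auto simp: even_vertex_def column_def row_def)

lemma odd_sum_odd_vertex: "odd (fst (odd_vertex n k a) + snd (odd_vertex n k a))"
  by (auto simp: odd_vertex_def column_def row_def)

lemma adjacent_vertices:
  assumes "a \<le> Suc b" "b \<le> Suc a"
  shows "\<bar>fst (even_vertex n k b) - fst (odd_vertex n k a)\<bar> +
         \<bar>snd (even_vertex n k b) - snd (odd_vertex n k a)\<bar> = 1"
proof -
  have "a = b \<or> a = Suc b \<or> b = Suc a" using assms by linarith
  then show ?thesis
    by (elim disjE) (auto simp: even_vertex_def odd_vertex_def column_def row_def)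
qed

text \<open>The sense of turning prescribed at a vertex alternates between the columns
  \<open>k\<close> and \<open>k + 1\<close>, and so does the side on which the odd vertex of the
  same row lies; reversing the rows for even \<open>k\<close> accounts for the remaining sign. So
  the turn always raises the index.\<close>

lemma turn_to_odd_vertex:
  assumes "b = a \<or> b = Suc a"
  shows "even_vertex n k b + quarter_turn (even_vertex n k b) (odd_vertex n k a - even_vertex n k b) =
         odd_vertex n k (Suc a)"
  using assms
  by (elim disjE) (auto simp: even_vertex_def odd_vertex_def column_def row_def quarter_turn_def)

lemma turn_to_even_vertex:
  assumes "a = b \<or> a = Suc b"
  shows "odd_vertex n k a + quarter_turn (odd_vertex n k a) (even_vertex n k b - odd_vertex n k a) =
         even_vertex n k (Suc b)"
  using assms
  by (elim disjE) (auto simp: even_vertex_def odd_vertex_def column_def row_def quarter_turn_def)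

text \<open>
  The column \<open>column n k b\<close> of the graph belongs to two sheared polygons, \<open>k\<close> and
  \<open>mirror n k b\<close>. Truncated subtraction only matters in column \<open>0\<close>, whose sides have length zero.
\<close>

definition mirror :: "nat \<Rightarrow> nat \<Rightarrow> nat \<Rightarrow> nat" where
  "mirror n k b = (if column n k b = k then k - 1 else k + 1)"

text \<open>Neighbouring polygons number the rows in opposite directions, so index \<open>l\<close>
  becomes \<open>n - l\<close>. The odd vertices concerned are those next to
  \<open>even_vertex n k b\<close> in its own column of the graph.\<close>

lemma mirror_vertices:
  assumes "0 < column n k b" "b \<le> n"
  shows "even_vertex n (mirror n k b) (n - b) = even_vertex n k b"
    and "Suc b \<le> n \<Longrightarrow> odd_vertex n (mirror n k b) (n - Suc b) = odd_vertex n k (Suc b)"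
    and "b = Suc a \<Longrightarrow> odd_vertex n (mirror n k b) (n - a) = odd_vertex n k a"
    and "mirror n (mirror n k b) (n - b) = k"
proof -
  have k: "column n k b = k \<Longrightarrow> k \<noteq> 0" using assms by auto
  show "even_vertex n (mirror n k b) (n - b) = even_vertex n k b"
    using k assms(2) by (auto simp: even_vertex_def mirror_def column_def row_def of_nat_diff)
  show "odd_vertex n (mirror n k b) (n - Suc b) = odd_vertex n k (Suc b)" if "Suc b \<le> n"
    using k that by (auto simp: odd_vertex_def mirror_def column_def row_def of_nat_diff)
  show "odd_vertex n (mirror n k b) (n - a) = odd_vertex n k a" if "b = Suc a"
    using k assms(2) that by (auto simp: odd_vertex_def mirror_def column_def row_def of_nat_diff)
  show "mirror n (mirror n k b) (n - b) = k"
    using k assms(2) by (auto simp: mirror_def column_def)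
qed

text \<open>Cells flat in one direction are kept since identifications pass through them. Those flat
  in both directions are excluded, because their edge has no endpoint in the grid about which to
  turn.\<close>

definition cells :: "nat \<Rightarrow> nat \<Rightarrow> (nat \<times> nat \<times> nat) set" where
  "cells m n = {(k, a, b). k < m \<and> a \<le> n \<and> b \<le> n \<and> a \<le> Suc b \<and> b \<le> Suc a \<and>
                  (0 < column_width m n k a \<or> 0 < row_height m n k b)}"

text \<open>
  Lower left corner at the origin. Next to the lower right boundary of the polygon (\<open>a = Suc b\<close>) only
  the upper left half of the rectangle belongs to it, next to the upper left boundary
  (\<open>b = Suc a\<close>) only the lower right half.
\<close>

definition cell_region :: "nat \<Rightarrow> nat \<Rightarrow> nat \<times> nat \<times> nat \<Rightarrow> plane set" where
  "cell_region m n = (\<lambda>(k, a, b).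
     {z. 0 \<le> z $ 1 \<and> z $ 1 \<le> column_width m n k a \<and> 0 \<le> z $ 2 \<and> z $ 2 \<le> row_height m n k b \<and>
         (a = Suc b \<longrightarrow> z $ 1 * row_height m n k b \<le> z $ 2 * column_width m n k a) \<and>
         (b = Suc a \<longrightarrow> z $ 2 * column_width m n k a \<le> z $ 1 * row_height m n k b)})"

definition cell_edge :: "nat \<Rightarrow> nat \<times> nat \<times> nat \<Rightarrow> vertex \<times> vertex" where
  "cell_edge n = (\<lambda>(k, a, b). (even_vertex n k b, odd_vertex n k a))"

text \<open>
  The edge reached from \<open>e\<close> by turning about its endpoint of positive weight until both endpoints
  lie in the grid.
\<close>

definition settle :: "nat \<Rightarrow> nat \<Rightarrow> vertex \<times> vertex \<Rightarrow> vertex \<times> vertex" where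
  "settle m n e =
     (if fst e \<notin> grid_vertices m n then north m n e
      else if snd e \<notin> grid_vertices m n then east m n e else e)"

text \<open>The turned edge either lies in the grid already or has to be turned further;
  \<open>next_neighbour_step\<close> gives the same first edge in both cases.\<close>

lemma settle_even_turn:
  assumes "fst e \<in> grid_vertices m n" "m * n \<ge> 6"
    and "\<bar>fst (fst e) - fst (snd e)\<bar> + \<bar>snd (fst e) - snd (snd e)\<bar> = 1"
  shows "settle m n (fst e, fst e + quarter_turn (fst e) (snd e - fst e)) = east m n e"
proof -
  have "\<exists>k>0. fst e + (quarter_turn (fst e) ^^ k) (snd e - fst e) \<in> grid_vertices m n"
    using assms(3) by (intro ex_grid_neighbour[OF assms(1,2)]) simp
  from next_neighbour_step[OF this] show ?thesis
    using assms(1) by (simp add: settle_def east_def)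
qed

lemma settle_odd_turn:
  assumes "snd e \<in> grid_vertices m n" "m * n \<ge> 6"
    and "\<bar>fst (fst e) - fst (snd e)\<bar> + \<bar>snd (fst e) - snd (snd e)\<bar> = 1"
  shows "settle m n (snd e + quarter_turn (snd e) (fst e - snd e), snd e) = north m n e"
proof -
  have "\<exists>k>0. snd e + (quarter_turn (snd e) ^^ k) (fst e - snd e) \<in> grid_vertices m n"
    using assms(3) by (intro ex_grid_neighbour[OF assms(1,2)]) simp
  from next_neighbour_step[OF this] show ?thesis
    using assms(1) by (simp add: settle_def north_def)
qed

text \<open>Settling leaves the coordinates \<open>z\<close> unchanged: a flat cell becomes part of
  the left or the bottom side of the rectangle of its settled edge.\<close>

definition X_point :: "nat \<Rightarrow> nat \<Rightarrow> nat \<times> nat \<times> nat \<Rightarrow> plane \<Rightarrow> ((vertex \<times> vertex) \<times> plane) set" where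
  "X_point m n c z = surface_point (surface_X m n) (settle m n (cell_edge n c), z)"

definition column_start :: "nat \<Rightarrow> nat \<Rightarrow> nat \<Rightarrow> nat \<Rightarrow> real" where
  "column_start m n k a = (\<Sum>l<a. column_width m n k l)"

definition row_start :: "nat \<Rightarrow> nat \<Rightarrow> nat \<Rightarrow> nat \<Rightarrow> real" where
  "row_start m n k b = (\<Sum>l<b. row_height m n k l)"

definition cell_corner :: "nat \<Rightarrow> nat \<Rightarrow> nat \<times> nat \<times> nat \<Rightarrow> plane" where
  "cell_corner m n = (\<lambda>(k, a, b). vector [column_start m n k a, row_start m n k b])"

definition shear :: "nat \<Rightarrow> real^2^2" where
  "shear n = vector [vector [1 / sin (pi / real n), - cot (pi / real n)], vector [0, 1]]"

definition Y_point :: "nat \<Rightarrow> nat \<Rightarrow> nat \<times> nat \<times> nat \<Rightarrow> plane \<Rightarrow> (nat \<times> plane) set" where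
  "Y_point m n c z = surface_point (surface_Y m n) (fst c, shear n *v (z + cell_corner m n c))"

section \<open>Adjacent cells and the two halves of a rectangle\<close>

lemma column_start_Suc [simp]:
  "column_start m n k (Suc a) = column_start m n k a + column_width m n k a"
  by (simp add: column_start_def)

lemma row_start_Suc [simp]:
  "row_start m n k (Suc b) = row_start m n k b + row_height m n k b"
  by (simp add: row_start_def)

lemma Y_point_right:
  "Y_point m n (k, a, b) (vector [column_width m n k a, t]) = Y_point m n (k, Suc a, b) (vector [0, t])"
proof -
  have "vector [column_width m n k a, t] + cell_corner m n (k, a, b) =
        vector [0, t] + cell_corner m n (k, Suc a, b)"
    by (simp add: cell_corner_def vec_eq_iff forall_2)
  then show ?thesis by (simp add: Y_point_def)
qed

lemma Y_point_up:
  "Y_point m n (k, a, b) (vector [t, row_height m n k b]) = Y_point m n (k, a, Suc b) (vector [t, 0])"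
proof -
  have "vector [t, row_height m n k b] + cell_corner m n (k, a, b) =
        vector [t, 0] + cell_corner m n (k, a, Suc b)"
    by (simp add: cell_corner_def vec_eq_iff forall_2)
  then show ?thesis by (simp add: Y_point_def)
qed

lemma cell_iff:
  assumes "0 < n"
  shows "(k, a, b) \<in> cells m n \<longleftrightarrow> k < m \<and> a \<le> n \<and> b \<le> n \<and> a \<le> Suc b \<and> b \<le> Suc a \<and>
    (0 < side_length m n k (Suc a) \<and> 0 < a \<and> a < n \<or> 0 < side_length m n k b \<and> 0 < b \<and> b < n)"
  using assms by (auto simp: cells_def row_height_pos_iff column_width_pos_iff)

text \<open>If row \<open>b\<close> were flat, both cells would have positive width; that makes the
  lengths of both parities positive and puts \<open>b\<close> strictly between \<open>0\<close> and
  \<open>n\<close>, so the row would not be flat.\<close>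

lemma adjacent_columns_row_height:
  assumes "(k, a, b) \<in> cells m n" "(k, Suc a, b) \<in> cells m n" "0 < n"
  shows "row_height m n k b > 0"
proof -
  have "b = a \<or> b = Suc a" using assms(1,2) by (auto simp: cells_def)
  then show ?thesis
    using assms by (elim disjE) (auto simp: cell_iff row_height_pos_iff)
qed

lemma adjacent_rows_column_width:
  assumes "(k, a, b) \<in> cells m n" "(k, a, Suc b) \<in> cells m n" "0 < n"
  shows "column_width m n k a > 0"
proof -
  have "a = b \<or> a = Suc b" using assms(1,2) by (auto simp: cells_def)
  then show ?thesis
    using assms by (elim disjE) (auto simp: cell_iff column_width_pos_iff)
qed

lemma weight_cell_edge:
  "0 < n \<Longrightarrow> weight m n (fst (cell_edge n (k, a, b))) = row_height m n k b"
  "0 < n \<Longrightarrow> weight m n (snd (cell_edge n (k, a, b))) = column_width m n k a"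
  by (simp_all add: cell_edge_def weight_even_vertex weight_odd_vertex)

lemma cell_edge_in_grid:
  assumes "(k, a, b) \<in> cells m n" "0 < n"
  shows "fst (cell_edge n (k, a, b)) \<in> grid_vertices m n \<longleftrightarrow> row_height m n k b > 0"
    and "snd (cell_edge n (k, a, b)) \<in> grid_vertices m n \<longleftrightarrow> column_width m n k a > 0"
  using assms by (simp_all add: cells_def cell_edge_def even_vertex_in_grid odd_vertex_in_grid)

lemma cell_edge_in_grid_edges:
  assumes "(k, a, b) \<in> cells m n" "0 < n" "row_height m n k b > 0" "column_width m n k a > 0"
  shows "cell_edge n (k, a, b) \<in> grid_edges m n"
  using assms cell_edge_in_grid[OF assms(1,2)] even_sum_even_vertex odd_sum_odd_vertex
    adjacent_vertices[of a b n k]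
  by (auto simp: grid_edges_def cell_edge_def cells_def)

lemma settle_right:
  assumes c: "(k, a, b) \<in> cells m n" "(k, Suc a, b) \<in> cells m n" and "0 < n" "m * n \<ge> 6"
  shows "settle m n (cell_edge n (k, Suc a, b)) = east m n (cell_edge n (k, a, b))"
proof -
  have "fst (cell_edge n (k, a, b)) \<in> grid_vertices m n"
    using adjacent_columns_row_height[OF c assms(3)] cell_edge_in_grid(1)[OF c(1) assms(3)] by simp
  moreover have "b = a \<or> b = Suc a" using c by (auto simp: cells_def)
  ultimately show ?thesis
    using settle_even_turn[of "cell_edge n (k, a, b)" m n] adjacent_vertices[of a b n k] c(1) assms(4)
    by (simp add: cell_edge_def turn_to_odd_vertex cells_def)
qed

lemma settle_up:
  assumes c: "(k, a, b) \<in> cells m n" "(k, a, Suc b) \<in> cells m n" and "0 < n" "m * n \<ge> 6"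
  shows "settle m n (cell_edge n (k, a, Suc b)) = north m n (cell_edge n (k, a, b))"
proof -
  have "snd (cell_edge n (k, a, b)) \<in> grid_vertices m n"
    using adjacent_rows_column_width[OF c assms(3)] cell_edge_in_grid(2)[OF c(1) assms(3)] by simp
  moreover have "a = b \<or> a = Suc b" using c by (auto simp: cells_def)
  ultimately show ?thesis
    using settle_odd_turn[of "cell_edge n (k, a, b)" m n] adjacent_vertices[of a b n k] c(1) assms(4)
    by (simp add: cell_edge_def turn_to_even_vertex cells_def)
qed

lemma X_point_right:
  assumes c: "(k, a, b) \<in> cells m n" "(k, Suc a, b) \<in> cells m n" and n: "0 < n" and mn: "m * n \<ge> 6"
    and t: "0 \<le> t" "t \<le> row_height m n k b"
  shows "X_point m n (k, a, b) (vector [column_width m n k a, t]) = X_point m n (k, Suc a, b) (vector [0, t])"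
proof -
  let ?e = "cell_edge n (k, a, b)"
  have H: "row_height m n k b > 0" using adjacent_columns_row_height[OF c n] .
  then have v: "fst ?e \<in> grid_vertices m n" using cell_edge_in_grid(1)[OF c(1) n] by simp
  show ?thesis
  proof (cases "column_width m n k a > 0")
    case True
    then have "snd ?e \<in> grid_vertices m n" using cell_edge_in_grid(2)[OF c(1) n] by simp
    then have "settle m n ?e = ?e" using v by (simp add: settle_def)
    then show ?thesis
      using surface_X_east[OF cell_edge_in_grid_edges[OF c(1) n H True], of t] t
        settle_right[OF c n mn] by (simp add: X_point_def weight_cell_edge n)
  next
    \<comment> \<open>The two ends of a column of zero width coincide, and both cells settle to the
      same edge, so no gluing is used.\<close>
    case False
    then have "snd ?e \<notin> grid_vertices m n" using cell_edge_in_grid(2)[OF c(1) n] by simp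
    then have "settle m n ?e = east m n ?e" using v by (simp add: settle_def)
    moreover have "column_width m n k a = 0"
      using False column_width_nonneg[of k m a n] c(1) n by (auto simp: cells_def)
    ultimately show ?thesis
      using settle_right[OF c n mn] by (simp add: X_point_def)
  qed
qed

lemma X_point_up:
  assumes c: "(k, a, b) \<in> cells m n" "(k, a, Suc b) \<in> cells m n" and n: "0 < n" and mn: "m * n \<ge> 6"
    and t: "0 \<le> t" "t \<le> column_width m n k a"
  shows "X_point m n (k, a, b) (vector [t, row_height m n k b]) = X_point m n (k, a, Suc b) (vector [t, 0])"
proof -
  let ?e = "cell_edge n (k, a, b)"
  have W: "column_width m n k a > 0" using adjacent_rows_column_width[OF c n] .
  then have v: "snd ?e \<in> grid_vertices m n" using cell_edge_in_grid(2)[OF c(1) n] by simp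
  show ?thesis
  proof (cases "row_height m n k b > 0")
    case True
    then have "fst ?e \<in> grid_vertices m n" using cell_edge_in_grid(1)[OF c(1) n] by simp
    then have "settle m n ?e = ?e" using v by (simp add: settle_def)
    then show ?thesis
      using surface_X_north[OF cell_edge_in_grid_edges[OF c(1) n True W], of t] t
        settle_up[OF c n mn] by (simp add: X_point_def weight_cell_edge n)
  next
    case False
    then have "fst ?e \<notin> grid_vertices m n" using cell_edge_in_grid(1)[OF c(1) n] by simp
    then have "settle m n ?e = north m n ?e" by (simp add: settle_def)
    moreover have "row_height m n k b = 0"
      using False row_height_nonneg[of k m b n] c(1) n by (auto simp: cells_def)
    ultimately show ?thesis
      using settle_up[OF c n mn] by (simp add: X_point_def)
  qed
qed

text \<open>The two halves of a rectangle that lie in different polygons. They carry the same edge,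
  so their dimensions agree as weights of the same vertices, without any trigonometry.\<close>

lemma mirror_cell:
  assumes c: "(k, Suc b, b) \<in> cells m n" and n: "0 < n"
  shows "(mirror n k b, n - Suc b, n - b) \<in> cells m n"
    and "cell_edge n (mirror n k b, n - Suc b, n - b) = cell_edge n (k, Suc b, b)"
    and "column_width m n (mirror n k b) (n - Suc b) = column_width m n k (Suc b)"
    and "row_height m n (mirror n k b) (n - b) = row_height m n k b"
    and "mirror n (mirror n k b) (n - b) = k"
    and "0 < column n k b"
proof -
  have b: "Suc b \<le> n" "k < m" "side_length m n k b > 0"
    using c n by (auto simp: cell_iff)
  then have col: "0 < column n k b" "column n k b < m"
    by (auto simp: side_length_pos_iff)
  note mv = mirror_vertices[OF col(1)]
  show edge: "cell_edge n (mirror n k b, n - Suc b, n - b) = cell_edge n (k, Suc b, b)"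
    using mv b by (simp add: cell_edge_def)
  show W: "column_width m n (mirror n k b) (n - Suc b) = column_width m n k (Suc b)"
    using weight_cell_edge(2)[OF n, of m "mirror n k b" "n - Suc b" "n - b"]
      weight_cell_edge(2)[OF n, of m k "Suc b" b] edge by simp
  show H: "row_height m n (mirror n k b) (n - b) = row_height m n k b"
    using weight_cell_edge(1)[OF n, of m "mirror n k b" "n - Suc b" "n - b"]
      weight_cell_edge(1)[OF n, of m k "Suc b" b] edge by simp
  have "mirror n k b < m"
    using col b by (auto simp: mirror_def column_def split: if_splits)
  then show "(mirror n k b, n - Suc b, n - b) \<in> cells m n"
    using c W H b by (auto simp: cells_def)
  show "mirror n (mirror n k b) (n - b) = k" using mv b by simp
  show "0 < column n k b" by (rule col)
qed

text \<open>The folding facts are stated from the lower right half; this reaches them from the upper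
  left one.\<close>

lemma mirror_cell_lower:
  assumes c: "(k, a, Suc a) \<in> cells m n" and n: "0 < n"
  obtains k' b where "(k', Suc b, b) \<in> cells m n" "k = mirror n k' b" "a = n - Suc b" "Suc a = n - b"
    "Suc b \<le> n"
proof -
  define k' where "k' = mirror n k (Suc a)"
  have a: "Suc a \<le> n" "k < m" "side_length m n k (Suc a) > 0"
    using c n by (auto simp: cell_iff)
  then have col: "0 < column n k (Suc a)" "column n k (Suc a) < m"
    by (auto simp: side_length_pos_iff)
  note mv = mirror_vertices[OF col(1) a(1)]
  have edge: "cell_edge n (k', n - a, n - Suc a) = cell_edge n (k, a, Suc a)"
    using mv by (simp add: cell_edge_def k'_def)
  have W: "column_width m n k' (n - a) = column_width m n k a"
    using weight_cell_edge(2)[OF n, of m k' "n - a" "n - Suc a"]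
      weight_cell_edge(2)[OF n, of m k a "Suc a"] edge by simp
  have H: "row_height m n k' (n - Suc a) = row_height m n k (Suc a)"
    using weight_cell_edge(1)[OF n, of m k' "n - a" "n - Suc a"]
      weight_cell_edge(1)[OF n, of m k a "Suc a"] edge by simp
  have "k' < m"
    using col a by (auto simp: k'_def mirror_def column_def split: if_splits)
  then have "(k', n - a, n - Suc a) \<in> cells m n"
    using c W H a by (auto simp: cells_def)
  moreover have "n - a = Suc (n - Suc a)" using a by simp
  ultimately have "(k', Suc (n - Suc a), n - Suc a) \<in> cells m n" by metis
  then show ?thesis
  proof (rule that)
    show "k = mirror n k' (n - Suc a)" using mv(4) by (simp add: k'_def)
  qed (use a in auto)
qed

lemma X_point_fold:
  assumes "(k, Suc b, b) \<in> cells m n" "0 < n"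
  shows "X_point m n (mirror n k b, n - Suc b, n - b) z = X_point m n (k, Suc b, b) z"
  using mirror_cell(2)[OF assms] by (simp add: X_point_def)

section \<open>Sides and vertices of the polygons in sheared coordinates\<close>

lemma shear_mult: "shear n *v vector [x, y] = vector [(x - cos (pi / n) * y) / sin (pi / n), y]"
  by (simp add: shear_def vec_eq_iff forall_2 matrix_vector_mult_def sum_2 cot_def diff_divide_distrib)

lemma side_vector_shear:
  assumes n: "2 \<le> n"
  shows "side_vector m n k i = shear n *v vector [column_width m n k (Suc i), row_height m n k i]"
proof -
  have "sin (pi / n) > 0"
    using n by (intro sin_gt_zero) (auto simp: field_simps)
  \<comment> \<open>The addition formula that fixes the first row of \<open>shear n\<close>.\<close>
  moreover have "sin (real (Suc i) * pi / n) - cos (pi / n) * sin (real i * pi / n) =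
      sin (pi / n) * cos (real i * pi / n)"
    by (simp add: distrib_right add_divide_distrib sin_add)
  then have "side_length m n k i * sin (real (Suc i) * pi / n) - cos (pi / n) * (side_length m n k i * sin (real i * pi / n)) =
      side_length m n k i * (sin (pi / n) * cos (real i * pi / n))"
    by (metis (no_types, opaque_lifting) mult.left_commute right_diff_distrib)
  ultimately show ?thesis
    by (simp add: shear_mult side_vector_def polygon_edge_def column_width_def row_height_def
        vec_eq_iff forall_2 side_length_def[symmetric] del: of_nat_Suc)
qed

lemma side_start_shear:
  assumes n: "2 \<le> n"
  shows "side_start m n k i = shear n *v vector [column_start m n k (Suc i), row_start m n k i]"
proof (induction i)
  case 0
  have "(vector [0, 0] :: plane) = 0" by (simp add: vec_eq_iff forall_2)
  then show ?case
    by (simp add: side_start_def polygon_vertex_def column_start_def row_start_def column_width_def)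
next
  case (Suc i)
  have "side_start m n k (Suc i) = side_start m n k i + side_vector m n k i"
    by (simp add: side_start_def side_vector_def polygon_vertex_def)
  also have "\<dots> = shear n *v (vector [column_start m n k (Suc i), row_start m n k i] +
      vector [column_width m n k (Suc i), row_height m n k i])"
    unfolding Suc.IH side_vector_shear[OF n] by (simp add: matrix_vector_right_distrib)
  also have "vector [column_start m n k (Suc i), row_start m n k i] +
      vector [column_width m n k (Suc i), row_height m n k i] =
      (vector [column_start m n k (Suc (Suc i)), row_start m n k (Suc i)] :: plane)"
    by (simp add: vec_eq_iff forall_2)
  finally show ?case .
qed

text \<open>Terms at equal distance from \<open>n\<close> cancel, and the term at \<open>n\<close>
  is its own negative.\<close>

lemma sum_odd_reflection:
  fixes f :: "nat \<Rightarrow> real"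
  assumes f: "\<And>l. l \<le> n \<Longrightarrow> f (n + l) = - f (n - l)" and "j \<le> n"
  shows "(\<Sum>l<Suc (n + j). f l) = (\<Sum>l<n - j. f l)"
  using assms(2)
proof (induction j)
  case 0
  show ?case using f[of 0] by simp
next
  case (Suc j)
  have "(\<Sum>l<n - j. f l) = (\<Sum>l<n - Suc j. f l) + f (n - Suc j)"
    using Suc.prems by (metis Suc_diff_Suc Suc_le_eq sum.lessThan_Suc)
  then show ?case
    using Suc f[of "Suc j"] by simp
qed

lemma sin_add_sub_multiple_pi_div:
  assumes "0 < n" "l \<le> n"
  shows "sin (real (n + l) * pi / real n) = - sin (real (n - l) * pi / real n)"
proof -
  have "real (n + l) * pi / real n = pi + real l * pi / real n"
    "real (n - l) * pi / real n = pi - real l * pi / real n"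
    using assms by (simp_all add: field_simps of_nat_diff)
  then show ?thesis by (simp add: sin_add)
qed

lemma side_length_cong: "even l = even l' \<Longrightarrow> side_length m n k l = side_length m n k l'"
  by (simp add: side_length_def)

lemma column_width_reflect:
  "0 < n \<Longrightarrow> l \<le> n \<Longrightarrow> column_width m n k (n + l) = - column_width m n k (n - l)"
  using side_length_cong[of "Suc (n + l)" "Suc (n - l)" m n k]
  by (simp add: column_width_def sin_add_sub_multiple_pi_div del: of_nat_add)

lemma row_height_reflect:
  "0 < n \<Longrightarrow> l \<le> n \<Longrightarrow> row_height m n k (n + l) = - row_height m n k (n - l)"
  using side_length_cong[of "n + l" "n - l" m n k]
  by (simp add: row_height_def sin_add_sub_multiple_pi_div del: of_nat_add)

text \<open>From side \<open>n\<close> on the sines become negative. Cancellation brings the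
  vertices back to smaller indices, so that both boundary chains are described by the same column
  and row positions.\<close>

lemma side_start_upper:
  assumes n: "2 \<le> n" and j: "j \<le> n"
  shows "side_start m n k (n + j) = shear n *v vector [column_start m n k (n - j), row_start m n k (Suc (n - j))]"
proof -
  have "column_start m n k (Suc (n + j)) = column_start m n k (n - j)"
    unfolding column_start_def by (rule sum_odd_reflection) (use n j column_width_reflect in auto)
  moreover have "row_start m n k (n + j) = row_start m n k (Suc (n - j))"
  proof (cases j)
    case 0
    have "row_height m n k n = 0" using row_height_reflect[of n 0 m k] n by simp
    then show ?thesis using 0 by simp
  next
    \<comment> \<open>The row sum has one term fewer than the column sum, hence the reflection at
      \<open>j - 1\<close>.\<close>
    case (Suc i)
    have "(\<Sum>l<Suc (n + i). row_height m n k l) = (\<Sum>l<n - i. row_height m n k l)"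
      by (rule sum_odd_reflection) (use n j Suc row_height_reflect in auto)
    moreover have "Suc (n - j) = n - i" using Suc j by simp
    ultimately show ?thesis using Suc by (simp only: row_start_def add_Suc_right)
  qed
  ultimately show ?thesis using side_start_shear[OF n] by metis
qed

subsection \<open>The polygon sides and the position of a point\<close>

lemma gluings_surface_Y:
  "gluings (surface_Y m n) =
     {((k, side_start m n k i), (glued_to k i, side_start m n (glued_to k i) (opposite n i + 1)),
       side_vector m n k i) | k i. k < m \<and> odd k \<and> i < 2 * n \<and> side_vector m n k i \<noteq> 0}"
  by (simp add: surface_Y_def)

lemma side_vector_nonzero:
  assumes "side_length m n k i > 0"
  shows "side_vector m n k i \<noteq> 0"
proof
  let ?x = "real i * pi / real n"
  assume "side_vector m n k i = 0"
  then have "cos ?x = 0 \<and> sin ?x = 0"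
    using assms by (auto simp: side_vector_def polygon_edge_def vec_eq_iff forall_2 side_length_def
        split: if_splits)
  then show False using sin_cos_squared_add[of ?x] by simp
qed

lemma surface_Y_side:
  assumes "k < m" "odd k" "i < 2 * n" "side_length m n k i > 0" "0 \<le> r" "r \<le> 1"
  shows "surface_point (surface_Y m n) (k, side_start m n k i + r *\<^sub>R side_vector m n k i) =
         surface_point (surface_Y m n) (glued_to k i,
           side_start m n (glued_to k i) (opposite n i + 1) + r *\<^sub>R side_vector m n k i)"
  by (rule surface_point_gluing) (use assms side_vector_nonzero in \<open>auto simp: gluings_surface_Y\<close>)

definition cell_diagonal :: "nat \<Rightarrow> nat \<Rightarrow> nat \<times> nat \<times> nat \<Rightarrow> plane" where
  "cell_diagonal m n = (\<lambda>(k, a, b). vector [column_width m n k a, row_height m n k b])"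

text \<open>Gluings are listed from odd polygons only. For odd \<open>k\<close> the listed side is
  the lower right side \<open>b\<close>, the diagonal of the cell; its partner is the diagonal of
  the upper left cell in the mirror polygon, at the same parameter.\<close>

lemma fold_side_odd:
  assumes c: "(k, Suc b, b) \<in> cells m n" and n: "2 \<le> n" and k: "odd k"
  defines "w \<equiv> cell_diagonal m n (k, Suc b, b)" and "k' \<equiv> mirror n k b"
  shows "glued_to k b = k'"
    and "side_start m n k b + r *\<^sub>R side_vector m n k b =
      shear n *v (r *\<^sub>R w + cell_corner m n (k, Suc b, b))"
    and "side_start m n k' (opposite n b + 1) + r *\<^sub>R side_vector m n k b =
      shear n *v (r *\<^sub>R w + cell_corner m n (k', n - Suc b, n - b))"
proof -
  have n0: "0 < n" using n by simp
  have b: "Suc b \<le> n" using c by (auto simp: cells_def)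
  show "glued_to k b = k'"
    using k mirror_cell(6)[OF c n0] by (auto simp: glued_to_def k'_def mirror_def column_def)
  have Sb: "Suc (n - Suc b) = n - b" and opp: "opposite n b + 1 = n + Suc b"
    using b by (simp_all add: opposite_def)
  have corner: "side_start m n k b = shear n *v cell_corner m n (k, Suc b, b)"
    by (simp add: side_start_shear[OF n] cell_corner_def)
  have vec: "side_vector m n k b = shear n *v w"
    by (simp add: side_vector_shear[OF n] w_def cell_diagonal_def)
  have corner': "side_start m n k' (opposite n b + 1) = shear n *v cell_corner m n (k', n - Suc b, n - b)"
    unfolding opp using side_start_upper[OF n b, of m k'] Sb
    by (simp add: cell_corner_def del: row_start_Suc)
  have along: "shear n *v x + r *\<^sub>R (shear n *v w) = shear n *v (r *\<^sub>R w + x)" for x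
    by (simp add: matrix_vector_right_distrib matrix_vector_mult_scaleR)
  show "side_start m n k b + r *\<^sub>R side_vector m n k b =
      shear n *v (r *\<^sub>R w + cell_corner m n (k, Suc b, b))"
    unfolding corner vec by (rule along)
  show "side_start m n k' (opposite n b + 1) + r *\<^sub>R side_vector m n k b =
      shear n *v (r *\<^sub>R w + cell_corner m n (k', n - Suc b, n - b))"
    unfolding corner' vec by (rule along)
qed

text \<open>For even \<open>k\<close> the gluing is listed from the mirror polygon, where the side
  has number \<open>n + b\<close> and runs along the diagonal in the opposite direction; hence the
  parameter \<open>1 - r\<close>.\<close>

lemma fold_side_even:
  assumes c: "(k, Suc b, b) \<in> cells m n" and n: "2 \<le> n" and k: "even k"
  defines "w \<equiv> cell_diagonal m n (k, Suc b, b)" and "k' \<equiv> mirror n k b"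
  shows "glued_to k' (n + b) = k" and "odd k'" and "side_length m n k' (n + b) > 0"
    and "side_start m n k' (n + b) + r *\<^sub>R side_vector m n k' (n + b) =
      shear n *v ((1 - r) *\<^sub>R w + cell_corner m n (k', n - Suc b, n - b))"
    and "side_start m n k (opposite n (n + b) + 1) + r *\<^sub>R side_vector m n k' (n + b) =
      shear n *v ((1 - r) *\<^sub>R w + cell_corner m n (k, Suc b, b))"
proof -
  have n0: "0 < n" using n by simp
  note mc = mirror_cell[OF c n0, folded k'_def]
  have b: "Suc b \<le> n" using c by (auto simp: cells_def)
  have Sb: "Suc (n - Suc b) = n - b" using b by simp
  show "odd k'"
    using k mc(6) by (auto simp: k'_def mirror_def column_def split: if_splits)
  have "side_length m n k' (n - b) > 0"
    using mc(1) n0 b by (auto simp: cell_iff Sb)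
  then show "side_length m n k' (n + b) > 0"
    using side_length_cong[of "n + b" "n - b" m n k'] b by simp
  show "glued_to k' (n + b) = k"
    using k mc(6) by (auto simp: glued_to_def k'_def mirror_def column_def)
  have "n + b + n = b + 2 * n" by simp
  then have "opposite n (n + b) = (b + 2 * n) mod (2 * n)"
    by (simp only: opposite_def)
  then have opp: "opposite n (n + b) + 1 = Suc b"
    using b by (simp only: mod_add_self2) simp
  have vec': "side_vector m n k' (n + b) = shear n *v (- w)"
  proof -
    have "column_width m n k' (n + Suc b) = - column_width m n k (Suc b)"
      using column_width_reflect[OF n0 b(1), of m k'] mc(3) by simp
    moreover have "row_height m n k' (n + b) = - row_height m n k b"
      using row_height_reflect[OF n0, of b m k'] b mc(4) by simp
    moreover have "vector [- x, - y] = - (vector [x, y] :: plane)" for x y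
      by (simp add: vec_eq_iff forall_2)
    ultimately show ?thesis
      by (simp add: side_vector_shear[OF n] w_def cell_diagonal_def)
  qed
  have start': "side_start m n k' (n + b) = shear n *v (cell_corner m n (k', n - Suc b, n - b) + w)"
  proof -
    have "column_start m n k' (n - b) = column_start m n k' (n - Suc b) + column_width m n k' (n - Suc b)"
      using column_start_Suc[of m n k' "n - Suc b"] Sb by simp
    then have "vector [column_start m n k' (n - b), row_start m n k' (Suc (n - b))] =
        cell_corner m n (k', n - Suc b, n - b) + w"
      by (simp add: cell_corner_def w_def cell_diagonal_def vec_eq_iff forall_2 mc(3,4))
    then show ?thesis using side_start_upper[OF n, of b m k'] b by simp
  qed
  have start: "side_start m n k (opposite n (n + b) + 1) = shear n *v (cell_corner m n (k, Suc b, b) + w)"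
  proof -
    have "vector [column_start m n k (Suc (Suc b)), row_start m n k (Suc b)] =
        cell_corner m n (k, Suc b, b) + w"
      by (simp add: cell_corner_def w_def cell_diagonal_def vec_eq_iff forall_2)
    then show ?thesis by (simp only: opp side_start_shear[OF n])
  qed
  have along: "shear n *v (x + w) + r *\<^sub>R (shear n *v (- w)) = shear n *v ((1 - r) *\<^sub>R w + x)" for x
  proof -
    have "shear n *v (x + w) + r *\<^sub>R (shear n *v (- w)) = shear n *v ((x + w) + r *\<^sub>R (- w))"
      by (simp only: matrix_vector_right_distrib matrix_vector_mult_scaleR)
    also have "(x + w) + r *\<^sub>R (- w) = (1 - r) *\<^sub>R w + x"
      by (simp add: scaleR_diff_left)
    finally show ?thesis .
  qed
  show "side_start m n k' (n + b) + r *\<^sub>R side_vector m n k' (n + b) =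
      shear n *v ((1 - r) *\<^sub>R w + cell_corner m n (k', n - Suc b, n - b))"
    unfolding start' vec' by (rule along)
  show "side_start m n k (opposite n (n + b) + 1) + r *\<^sub>R side_vector m n k' (n + b) =
      shear n *v ((1 - r) *\<^sub>R w + cell_corner m n (k, Suc b, b))"
    unfolding start vec' by (rule along)
qed

lemma Y_point_fold:
  assumes c: "(k, Suc b, b) \<in> cells m n" and n: "2 \<le> n"
    and z: "0 \<le> z $ 1" "z $ 1 \<le> column_width m n k (Suc b)" "0 \<le> z $ 2" "z $ 2 \<le> row_height m n k b"
      "z $ 1 * row_height m n k b = z $ 2 * column_width m n k (Suc b)"
  shows "Y_point m n (mirror n k b, n - Suc b, n - b) z = Y_point m n (k, Suc b, b) z"
proof -
  have n0: "0 < n" using n by simp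
  have b: "Suc b \<le> n" "k < m" "side_length m n k b > 0"
    using c n0 by (auto simp: cell_iff)
  \<comment> \<open>The position along the diagonal, measured by the width or, if that vanishes, by
    the height.\<close>
  obtain r where r: "0 \<le> r" "r \<le> 1" "z = r *\<^sub>R cell_diagonal m n (k, Suc b, b)"
  proof (cases "column_width m n k (Suc b) > 0")
    case True
    then have "z $ 2 = z $ 1 / column_width m n k (Suc b) * row_height m n k b"
      using z(5) by (simp add: field_simps)
    then show ?thesis
      using that[of "z $ 1 / column_width m n k (Suc b)"] z True
      by (auto simp: cell_diagonal_def vec_eq_iff forall_2)
  next
    case False
    then have W: "column_width m n k (Suc b) = 0" using z by simp
    then have H: "row_height m n k b > 0" using c by (auto simp: cells_def)
    then show ?thesis
      using that[of "z $ 2 / row_height m n k b"] z W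
      by (auto simp: cell_diagonal_def vec_eq_iff forall_2)
  qed
  show ?thesis
  proof (cases "odd k")
    case True
    note fold = fold_side_odd[OF c n True]
    show ?thesis
      using surface_Y_side[of k m b n r] True b r unfolding fold by (simp add: Y_point_def)
  next
    case False
    then have k: "even k" by simp
    note fold = fold_side_even[OF c n k]
    have "mirror n k b < m" using mirror_cell(1)[OF c n0] by (simp add: cells_def)
    then show ?thesis
      using surface_Y_side[of "mirror n k b" m "n + b" n "1 - r"] fold(2,3) b r
      unfolding fold by (simp add: Y_point_def)
  qed
qed

section \<open>Cells sharing a position in one polygon\<close>

lemma mem_cell_region:
  "z \<in> cell_region m n (k, a, b) \<longleftrightarrow>
     0 \<le> z $ 1 \<and> z $ 1 \<le> column_width m n k a \<and> 0 \<le> z $ 2 \<and> z $ 2 \<le> row_height m n k b \<and>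
     (a = Suc b \<longrightarrow> z $ 1 * row_height m n k b \<le> z $ 2 * column_width m n k a) \<and>
     (b = Suc a \<longrightarrow> z $ 2 * column_width m n k a \<le> z $ 1 * row_height m n k b)"
  by (simp add: cell_region_def)

lemma vector_2_components: "x = vector [x $ 1, x $ 2]" for x :: plane
  by (simp add: vec_eq_iff forall_2)

lemma X_point_eq_same_row:
  assumes c: "(k, a, b) \<in> cells m n" "(k, a', b) \<in> cells m n" and n: "2 \<le> n" and mn: "m * n \<ge> 6"
    and le: "a \<le> a'" and z: "z \<in> cell_region m n (k, a, b)" "z' \<in> cell_region m n (k, a', b)"
    and eq: "column_start m n k a + z $ 1 = column_start m n k a' + z' $ 1" "z $ 2 = z' $ 2"
  shows "X_point m n (k, a, b) z = X_point m n (k, a', b) z'"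
proof -
  have n0: "0 < n" using n by simp
  have "a' = a \<or> a' = Suc a \<or> a' = Suc (Suc a)"
    using c le by (auto simp: cells_def)
  then consider "a' = a" | "a' = Suc a" | "a' = Suc (Suc a)" by blast
  then show ?thesis
  proof cases
    case 1
    then have "z = z'" using eq by (simp add: vec_eq_iff forall_2)
    then show ?thesis using 1 by simp
  next
    case 2
    then have "z = vector [column_width m n k a, z $ 2]" "z' = vector [0, z $ 2]"
      using eq z by (auto simp: mem_cell_region vec_eq_iff forall_2)
    then show ?thesis
      using X_point_right[of k a b m n "z $ 2"] c n0 mn z 2 by (metis mem_cell_region)
  next
    \<comment> \<open>Cells on both sides of column \<open>Suc a\<close> can only touch if this
      column has width zero. The middle cell exists because row \<open>b\<close> has positive
      height.\<close>
    case 3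
    then have b: "b = Suc a" using c by (auto simp: cells_def)
    have mid: "(k, Suc a, b) \<in> cells m n"
      using c 3 n0 b by (auto simp: cell_iff)
    have W: "column_width m n k (Suc a) \<ge> 0"
      using mid column_width_nonneg[of k m "Suc a" n] n0 by (auto simp: cells_def)
    then have "z = vector [column_width m n k a, z $ 2]" "z' = vector [0, z $ 2]"
      "column_width m n k (Suc a) = 0"
      using eq z 3 by (auto simp: mem_cell_region vec_eq_iff forall_2)
    then show ?thesis
      using X_point_right[of k a b m n "z $ 2"] X_point_right[of k "Suc a" b m n "z $ 2"]
        c mid n0 mn z 3 by (metis mem_cell_region)
  qed
qed

text \<open>A point on the top of a cell is handed to row \<open>Suc b\<close>. Straight above there
  may be no cell, either because the polygon ends there or because that cell is flat in both
  directions; the path then first goes sideways within row \<open>b\<close>. The last hypothesis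
  guarantees a cell to arrive at.\<close>

lemma X_point_move_up:
  assumes c: "(k, a, b) \<in> cells m n" and m: "2 \<le> m" and n: "2 \<le> n" and mn: "m * n \<ge> 6"
    and z: "z \<in> cell_region m n (k, a, b)" "z $ 2 = row_height m n k b"
    and b: "Suc b < n \<or> (k, b, Suc b) \<in> cells m n"
  shows "\<exists>a' x. (k, a', Suc b) \<in> cells m n \<and> vector [x, 0] \<in> cell_region m n (k, a', Suc b) \<and>
     column_start m n k a + z $ 1 = column_start m n k a' + x \<and>
     X_point m n (k, a, b) z = X_point m n (k, a', Suc b) (vector [x, 0])"
proof -
  have n0: "0 < n" using n by simp
  let ?W = "column_width m n k" and ?H = "row_height m n k"
  have km: "k < m" and bn: "Suc b \<le> n" using c b by (auto simp: cells_def)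
  have Hb: "?H (Suc b) \<ge> 0" using row_height_nonneg[OF km bn n0] .
  have diag: "(k, Suc b, Suc b) \<in> cells m n" if "Suc b < n"
    using that km n0 side_length_pos_or[OF km m, of n b] by (auto simp: cell_iff)
  have Wk: "?W l \<ge> 0" if "l \<le> n" for l using column_width_nonneg[OF km that n0] .
  have Hk: "?H l \<ge> 0" if "l \<le> n" for l using row_height_nonneg[OF km that n0] .
  define Q where "Q = (\<lambda>x0 P. \<exists>a' x. (k, a', Suc b) \<in> cells m n \<and>
      vector [x, 0] \<in> cell_region m n (k, a', Suc b) \<and> x0 = column_start m n k a' + x \<and>
      P = X_point m n (k, a', Suc b) (vector [x, 0]))"
  have middle: "Q (column_start m n k b + x) (X_point m n (k, b, b) (vector [x, ?H b]))"
    if bb: "(k, b, b) \<in> cells m n" and x: "0 \<le> x" "x \<le> ?W b" for x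
  proof (cases "(k, b, Suc b) \<in> cells m n")
    case True
    then have "X_point m n (k, b, b) (vector [x, ?H b]) = X_point m n (k, b, Suc b) (vector [x, 0])"
      using X_point_up bb n0 mn x by blast
    moreover have "vector [x, 0] \<in> cell_region m n (k, b, Suc b)"
      using x Hk[OF bn] by (simp add: mem_cell_region)
    ultimately show ?thesis
      unfolding Q_def using True by blast
  next
    \<comment> \<open>The cell above the diagonal cell is missing, so column \<open>b\<close> is
      flat and the point passes through \<open>(k, Suc b, b)\<close> instead.\<close>
    case False
    then have W0: "?W b = 0"
      using Wk[of b] bn km by (auto simp: cells_def)
    then have x0: "x = 0" using x by simp
    have up: "(k, Suc b, b) \<in> cells m n"
      using bb bn W0 by (auto simp: cells_def)
    have up2: "(k, Suc b, Suc b) \<in> cells m n"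
      using diag b False by blast
    have "X_point m n (k, b, b) (vector [?W b, ?H b]) = X_point m n (k, Suc b, b) (vector [0, ?H b])"
      using X_point_right[OF bb up n0 mn, of "?H b"] Hk[of b] bn by simp
    also have "\<dots> = X_point m n (k, Suc b, Suc b) (vector [0, 0])"
      using X_point_up[OF up up2 n0 mn, of 0] Wk[OF bn] by simp
    finally have "X_point m n (k, b, b) (vector [x, ?H b]) = X_point m n (k, Suc b, Suc b) (vector [0, 0])"
      using W0 x0 by simp
    moreover have "vector [0, 0] \<in> cell_region m n (k, Suc b, Suc b)"
      using Wk[OF bn] Hk[OF bn] by (simp add: mem_cell_region)
    moreover have "column_start m n k b + x = column_start m n k (Suc b) + 0"
      using W0 x0 by simp
    ultimately show ?thesis
      unfolding Q_def using up2 by blast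
  qed
  have zv: "z = vector [z $ 1, ?H b]"
    using z(2) vector_2_components[of z] by simp
  have zW: "0 \<le> z $ 1" "z $ 1 \<le> ?W a"
    using z(1) by (auto simp: mem_cell_region)
  consider "a = b" | "a = Suc b" "Suc b < n" | "a = Suc b" "(k, b, Suc b) \<in> cells m n" "Suc b = n" | "b = Suc a"
    using c b by (force simp: cells_def)
  then have "Q (column_start m n k a + z $ 1) (X_point m n (k, a, b) z)"
  proof cases
    case 1
    then show ?thesis using middle[of "z $ 1"] c zv zW by metis
  next
    case 2
    have "X_point m n (k, a, b) z = X_point m n (k, a, Suc b) (vector [z $ 1, 0])"
      using X_point_up[of k a b m n "z $ 1"] c diag 2 n0 mn zv zW by metis
    moreover have "vector [z $ 1, 0] \<in> cell_region m n (k, a, Suc b)"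
      using 2 zW Hk[OF bn] by (simp add: mem_cell_region)
    ultimately show ?thesis
      unfolding Q_def using diag 2 by blast
  next
    \<comment> \<open>There is no cell above in the last column \<open>n\<close>; this column is
      flat, so stepping left does not move the point.\<close>
    case 3
    have W: "?W (Suc b) = 0"
      using 3 Wk[OF bn] column_width_pos_iff[OF km bn n0] by (metis less_irrefl order_le_less)
    then have z1: "z $ 1 = 0" using 3 zW by simp
    have "?H b > 0" using c 3 W by (auto simp: cells_def)
    then have bb: "(k, b, b) \<in> cells m n" using c by (auto simp: cells_def)
    have "X_point m n (k, b, b) (vector [?W b, ?H b]) = X_point m n (k, a, b) z"
      using X_point_right[of k b b m n "?H b"] c bb n0 mn 3 \<open>?H b > 0\<close> zv z1 by simp
    moreover have "column_start m n k a + z $ 1 = column_start m n k b + ?W b"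
      unfolding 3(1) z1 by simp
    ultimately show ?thesis
      using middle[OF bb, of "?W b"] Wk[of b] bn by simp
  next
    \<comment> \<open>A lower right half meets the top of its rectangle only in the upper right
      corner, from which the diagonal cell is reached.\<close>
    case 4
    have "?H b > 0"
      using c 4 n0 bn by (auto simp: cell_iff row_height_pos_iff)
    then have bb: "(k, b, b) \<in> cells m n" using c by (auto simp: cells_def)
    have "?H b * ?W a \<le> z $ 1 * ?H b"
      using z 4 by (auto simp: mem_cell_region)
    then have "?W a \<le> z $ 1"
      using \<open>?H b > 0\<close> by (simp add: mult.commute)
    then have z1: "z $ 1 = ?W a" using zW by simp
    have "X_point m n (k, a, b) z = X_point m n (k, b, b) (vector [0, ?H b])"
      using X_point_right[of k a b m n "?H b"] c bb n0 mn 4 \<open>?H b > 0\<close> zv z1 by simp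
    then show ?thesis
      using middle[OF bb, of 0] Wk[of b] bn z1 4 by simp
  qed
  then show ?thesis unfolding Q_def .
qed

lemma row_start_mono:
  assumes "b \<le> b'" "b' \<le> Suc n" "k < m" "0 < n"
  shows "row_start m n k b \<le> row_start m n k b'"
  unfolding row_start_def
  by (rule sum_mono2) (use assms row_height_nonneg in auto)

text \<open>Lying in rows \<open>b\<close> and \<open>b'\<close> at once forces every row strictly
  between to be flat, the first point onto the top of its row and the second onto the bottom of its
  own. Climbing row by row does not change the position.\<close>

lemma X_point_eq_upward:
  assumes m: "2 \<le> m" and n: "2 \<le> n" and mn: "m * n \<ge> 6"
    and c: "(k, a, b) \<in> cells m n" "(k, a', b') \<in> cells m n" and le: "b < b'"
    and z: "z \<in> cell_region m n (k, a, b)" "z' \<in> cell_region m n (k, a', b')"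
    and eq: "z + cell_corner m n (k, a, b) = z' + cell_corner m n (k, a', b')"
  shows "\<exists>a'' x. (k, a'', b') \<in> cells m n \<and> vector [x, 0] \<in> cell_region m n (k, a'', b') \<and>
     column_start m n k a'' + x = column_start m n k a' + z' $ 1 \<and> z' $ 2 = 0 \<and>
     X_point m n (k, a, b) z = X_point m n (k, a'', b') (vector [x, 0])"
  using c(1) z(1) eq le
proof (induction "b' - b" arbitrary: a b z)
  case (Suc d)
  have n0: "0 < n" and km: "k < m" and b'n: "b' \<le> n" and b'a': "b' \<le> Suc a'" "a' \<le> Suc b'"
    using n c(2) by (auto simp: cells_def)
  have e: "column_start m n k a + z $ 1 = column_start m n k a' + z' $ 1"
    "row_start m n k b + z $ 2 = row_start m n k b' + z' $ 2"
    using Suc.prems(3) by (simp_all add: cell_corner_def vec_eq_iff forall_2)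
  have "row_start m n k (Suc b) \<le> row_start m n k b'"
    using Suc.prems(4) b'n km n0 by (intro row_start_mono) auto
  then have z2: "z $ 2 = row_height m n k b" "z' $ 2 = 0" "row_start m n k (Suc b) = row_start m n k b'"
    using e(2) Suc.prems(2) z(2) by (auto simp: mem_cell_region)
  \<comment> \<open>Row \<open>n\<close> is flat, and the only cell it can contain is
    \<open>(k, n - 1, n)\<close>.\<close>
  have next_row: "Suc b < n \<or> (k, b, Suc b) \<in> cells m n"
  proof (cases "Suc b = n")
    case True
    then have b': "b' = Suc b" using Suc.prems(4) b'n by simp
    have "a' = b"
      using c(2) True b' n0 b'a' by (auto simp: cell_iff)
    then show ?thesis using c(2) b' by simp
  qed (use Suc.prems(4) b'n in auto)
  obtain a2 x where a2: "(k, a2, Suc b) \<in> cells m n" "vector [x, 0] \<in> cell_region m n (k, a2, Suc b)"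
    "column_start m n k a + z $ 1 = column_start m n k a2 + x"
    "X_point m n (k, a, b) z = X_point m n (k, a2, Suc b) (vector [x, 0])"
    using X_point_move_up[OF Suc.prems(1) m n mn Suc.prems(2) z2(1) next_row] by blast
  show ?case
  proof (cases "Suc b = b'")
    case True
    then show ?thesis using a2 e z2 by metis
  next
    case False
    have "vector [x, 0] + cell_corner m n (k, a2, Suc b) = z' + cell_corner m n (k, a', b')"
      using a2(3) e z2 by (simp add: cell_corner_def vec_eq_iff forall_2 add.commute)
    from Suc.hyps(1)[OF _ a2(1,2) this] Suc.hyps(2) False Suc.prems(4) a2(4)
    show ?thesis by fastforce
  qed
qed simp

lemma X_point_eq_of_position_eq:
  assumes m: "2 \<le> m" and n: "2 \<le> n" and mn: "m * n \<ge> 6"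
    and c: "(k, a, b) \<in> cells m n" "(k, a', b') \<in> cells m n"
    and z: "z \<in> cell_region m n (k, a, b)" "z' \<in> cell_region m n (k, a', b')"
    and eq: "z + cell_corner m n (k, a, b) = z' + cell_corner m n (k, a', b')"
  shows "X_point m n (k, a, b) z = X_point m n (k, a', b') z'"
proof -
  have row: "X_point m n (k, a, b) z = X_point m n (k, a', b) z'"
    if "(k, a, b) \<in> cells m n" "(k, a', b) \<in> cells m n"
      "z \<in> cell_region m n (k, a, b)" "z' \<in> cell_region m n (k, a', b)"
      "column_start m n k a + z $ 1 = column_start m n k a' + z' $ 1" "z $ 2 = z' $ 2" for a b a' z z'
    using X_point_eq_same_row[of k a b m n a' z z'] X_point_eq_same_row[of k a' b m n a z' z] that n mn
    by (metis nle_le)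
  have up: "X_point m n (k, a, b) z = X_point m n (k, a', b') z'"
    if h: "(k, a, b) \<in> cells m n" "(k, a', b') \<in> cells m n" "b < b'"
      "z \<in> cell_region m n (k, a, b)" "z' \<in> cell_region m n (k, a', b')"
      "z + cell_corner m n (k, a, b) = z' + cell_corner m n (k, a', b')" for a b a' b' z z'
  proof -
    obtain a'' x where x: "(k, a'', b') \<in> cells m n" "vector [x, 0] \<in> cell_region m n (k, a'', b')"
      "column_start m n k a'' + x = column_start m n k a' + z' $ 1" "z' $ 2 = 0"
      "X_point m n (k, a, b) z = X_point m n (k, a'', b') (vector [x, 0])"
      using X_point_eq_upward[OF m n mn h] by blast
    then show ?thesis
      using row[OF x(1) h(2) x(2) h(5)] by simp
  qed
  consider "b < b'" | "b = b'" | "b' < b" by linarith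
  then show ?thesis
  proof cases
    case 2
    then have "column_start m n k a + z $ 1 = column_start m n k a' + z' $ 1" "z $ 2 = z' $ 2"
      using eq by (simp_all add: cell_corner_def vec_eq_iff forall_2)
    then show ?thesis using row c z 2 by blast
  qed (use up[OF c _ z eq] up[OF c(2,1) _ z(2,1) eq[symmetric]] in auto)
qed

subsection \<open>Cells of a given edge\<close>

definition real_cells :: "nat \<Rightarrow> nat \<Rightarrow> (nat \<times> nat \<times> nat) set" where
  "real_cells m n = {(k, a, b) \<in> cells m n. 0 < column_width m n k a \<and> 0 < row_height m n k b}"

lemma settle_real_cell:
  assumes "(k, a, b) \<in> real_cells m n" "0 < n"
  shows "settle m n (cell_edge n (k, a, b)) = cell_edge n (k, a, b)"
  using assms cell_edge_in_grid[of k a b m n] by (simp add: real_cells_def settle_def)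

text \<open>Turning about the even vertex is followed through the cells: each turn is one step to
  the right across a flat column. Any number \<open>d\<close> of turns that reaches the grid will
  do, as it only drives the induction.\<close>

lemma settle_cell_east:
  assumes n: "2 \<le> n" and mn: "m * n \<ge> 6"
    and c: "(k, a, b) \<in> cells m n" and H: "0 < row_height m n k b"
    and z: "vector [0, t] \<in> cell_region m n (k, a, b)"
    and d: "even_vertex n k b + (quarter_turn (even_vertex n k b) ^^ d) (odd_vertex n k a - even_vertex n k b)
              \<in> grid_vertices m n"
  shows "\<exists>c'\<in>real_cells m n. vector [0, t] \<in> cell_region m n c' \<and>
     cell_edge n c' = settle m n (cell_edge n (k, a, b)) \<and>
     Y_point m n c' (vector [0, t]) = Y_point m n (k, a, b) (vector [0, t])"
  using c H z d
proof (induction d arbitrary: k a b)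
  case 0
  then have "odd_vertex n k a \<in> grid_vertices m n" by simp
  then have "(k, a, b) \<in> real_cells m n"
    using 0 n odd_vertex_in_grid[of k m a n] by (auto simp: real_cells_def cells_def)
  then show ?case using 0 settle_real_cell[of k a b m n] n by fastforce
next
  case (Suc d)
  have n0: "0 < n" using n by simp
  have step: "\<exists>c'\<in>real_cells m n. vector [0, t] \<in> cell_region m n c' \<and>
      cell_edge n c' = settle m n (cell_edge n (k, a, b)) \<and>
      Y_point m n c' (vector [0, t]) = Y_point m n (k, a, b) (vector [0, t])"
    if c: "(k, a, b) \<in> cells m n" "0 < row_height m n k b" "column_width m n k a = 0"
      "vector [0, t] \<in> cell_region m n (k, a, b)" "b = a \<or> b = Suc a"
      "even_vertex n k b + (quarter_turn (even_vertex n k b) ^^ Suc d) (odd_vertex n k a - even_vertex n k b)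
         \<in> grid_vertices m n" for k a b
  proof -
    have "k < m" "b < n" "b \<le> n"
      using c(1,2) row_height_pos_iff[of k m b n] n0 by (auto simp: cells_def)
    then have "Suc a \<le> n" using c(5) by auto
    then have W: "0 \<le> column_width m n k (Suc a)"
      using \<open>k < m\<close> n0 by (intro column_width_nonneg)
    have c': "(k, Suc a, b) \<in> cells m n"
      using c \<open>k < m\<close> \<open>Suc a \<le> n\<close> by (auto simp: cells_def)
    have z': "vector [0, t] \<in> cell_region m n (k, Suc a, b)"
      using c(4,5) W by (auto simp: mem_cell_region)
    have "even_vertex n k b + (quarter_turn (even_vertex n k b) ^^ d)
        (odd_vertex n k (Suc a) - even_vertex n k b) \<in> grid_vertices m n"
      using c(6) by (simp add: turn_to_odd_vertex[OF c(5), of n k, symmetric] funpow_swap1)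
    note IH = Suc.IH[OF c' c(2) z' this]
    have "fst (cell_edge n (k, a, b)) \<in> grid_vertices m n" "snd (cell_edge n (k, a, b)) \<notin> grid_vertices m n"
      using cell_edge_in_grid[OF c(1) n0] c by auto
    then have "settle m n (cell_edge n (k, a, b)) = settle m n (cell_edge n (k, Suc a, b))"
      using settle_right[OF c(1) c' n0 mn] by (simp add: settle_def)
    moreover have "Y_point m n (k, a, b) (vector [0, t]) = Y_point m n (k, Suc a, b) (vector [0, t])"
      using Y_point_right[of m n k a b t] c(3) by simp
    ultimately show ?thesis using IH by simp
  qed
  show ?case
  proof (cases "0 < column_width m n k a")
    case True
    then have "(k, a, b) \<in> real_cells m n"
      using Suc by (auto simp: real_cells_def)
    then show ?thesis using Suc settle_real_cell[of k a b m n] n by fastforce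
  next
    case False
    then have W: "column_width m n k a = 0"
      using Suc.prems(1) n0 column_width_nonneg[of k m a n] by (auto simp: cells_def)
    show ?thesis
    \<comment> \<open>At the lower right boundary the row continues from the upper left boundary of
      the mirror polygon. Folding keeps the edge and uses no turn, so a step to the right follows at
      once.\<close>
    proof (cases "a = Suc b")
      case True
      note c = Suc.prems(1)[unfolded True]
      note mc = mirror_cell[OF c n0]
      have Sb: "n - b = Suc (n - Suc b)" using c by (auto simp: cells_def)
      have vert: "even_vertex n (mirror n k b) (n - b) = even_vertex n k b"
        "odd_vertex n (mirror n k b) (n - Suc b) = odd_vertex n k (Suc b)"
        using mc(2) by (simp_all add: cell_edge_def)
      have t: "0 \<le> t" "t \<le> row_height m n k b"
        using Suc.prems(3) by (auto simp: mem_cell_region)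
      then have "vector [0, t] \<in> cell_region m n (mirror n k b, n - Suc b, n - b)"
        using mc(3,4) W True by (simp add: mem_cell_region)
      moreover have "Y_point m n (mirror n k b, n - Suc b, n - b) (vector [0, t]) =
          Y_point m n (k, Suc b, b) (vector [0, t])"
        using Y_point_fold[OF c n, of "vector [0, t]"] t W True by simp
      ultimately show ?thesis
        using step[OF mc(1), unfolded mc(2,3,4) vert] Suc.prems(2,4) W True Sb by simp
    next
      case False
      then have "b = a \<or> b = Suc a" using Suc.prems(1) by (auto simp: cells_def)
      then show ?thesis using step[OF Suc.prems(1,2) W Suc.prems(3) _ Suc.prems(4)] by blast
    qed
  qed
qed

text \<open>The transposed argument: steps go upwards across flat rows, and a column leaves through
  the upper left boundary and re-enters at the lower right one.\<close>

lemma settle_cell_north: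
  assumes n: "2 \<le> n" and mn: "m * n \<ge> 6"
    and c: "(k, a, b) \<in> cells m n" and W: "0 < column_width m n k a"
    and z: "vector [t, 0] \<in> cell_region m n (k, a, b)"
    and d: "odd_vertex n k a + (quarter_turn (odd_vertex n k a) ^^ d) (even_vertex n k b - odd_vertex n k a)
              \<in> grid_vertices m n"
  shows "\<exists>c'\<in>real_cells m n. vector [t, 0] \<in> cell_region m n c' \<and>
     cell_edge n c' = settle m n (cell_edge n (k, a, b)) \<and>
     Y_point m n c' (vector [t, 0]) = Y_point m n (k, a, b) (vector [t, 0])"
  using c W z d
proof (induction d arbitrary: k a b)
  case 0
  then have "even_vertex n k b \<in> grid_vertices m n" by simp
  then have "(k, a, b) \<in> real_cells m n"
    using 0 n even_vertex_in_grid[of k m b n] by (auto simp: real_cells_def cells_def)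
  then show ?case using 0 settle_real_cell[of k a b m n] n by fastforce
next
  case (Suc d)
  have n0: "0 < n" using n by simp
  have step: "\<exists>c'\<in>real_cells m n. vector [t, 0] \<in> cell_region m n c' \<and>
      cell_edge n c' = settle m n (cell_edge n (k, a, b)) \<and>
      Y_point m n c' (vector [t, 0]) = Y_point m n (k, a, b) (vector [t, 0])"
    if c: "(k, a, b) \<in> cells m n" "0 < column_width m n k a" "row_height m n k b = 0"
      "vector [t, 0] \<in> cell_region m n (k, a, b)" "a = b \<or> a = Suc b"
      "odd_vertex n k a + (quarter_turn (odd_vertex n k a) ^^ Suc d) (even_vertex n k b - odd_vertex n k a)
         \<in> grid_vertices m n" for k a b
  proof -
    have "k < m" "a < n" "a \<le> n"
      using c(1,2) column_width_pos_iff[of k m a n] n0 by (auto simp: cells_def)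
    then have "Suc b \<le> n" using c(5) by auto
    then have H: "0 \<le> row_height m n k (Suc b)"
      using \<open>k < m\<close> n0 by (intro row_height_nonneg)
    have c': "(k, a, Suc b) \<in> cells m n"
      using c \<open>k < m\<close> \<open>Suc b \<le> n\<close> by (auto simp: cells_def)
    have z': "vector [t, 0] \<in> cell_region m n (k, a, Suc b)"
      using c(4,5) H by (auto simp: mem_cell_region)
    have "odd_vertex n k a + (quarter_turn (odd_vertex n k a) ^^ d)
        (even_vertex n k (Suc b) - odd_vertex n k a) \<in> grid_vertices m n"
      using c(6) by (simp add: turn_to_even_vertex[OF c(5), of n k, symmetric] funpow_swap1)
    note IH = Suc.IH[OF c' c(2) z' this]
    have "fst (cell_edge n (k, a, b)) \<notin> grid_vertices m n"
      using cell_edge_in_grid[OF c(1) n0] c by auto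
    then have "settle m n (cell_edge n (k, a, b)) = settle m n (cell_edge n (k, a, Suc b))"
      using settle_up[OF c(1) c' n0 mn] by (simp add: settle_def)
    moreover have "Y_point m n (k, a, b) (vector [t, 0]) = Y_point m n (k, a, Suc b) (vector [t, 0])"
      using Y_point_up[of m n k a b t] c(3) by simp
    ultimately show ?thesis using IH by simp
  qed
  show ?case
  proof (cases "0 < row_height m n k b")
    case True
    then have "(k, a, b) \<in> real_cells m n"
      using Suc by (auto simp: real_cells_def)
    then show ?thesis using Suc settle_real_cell[of k a b m n] n by fastforce
  next
    case False
    then have H: "row_height m n k b = 0"
      using Suc.prems(1) n0 row_height_nonneg[of k m b n] by (auto simp: cells_def)
    show ?thesis
    proof (cases "b = Suc a")
      case True
      obtain k' b' where c: "(k', Suc b', b') \<in> cells m n" and kab: "k = mirror n k' b'" "a = n - Suc b'"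
        "Suc a = n - b'" "Suc b' \<le> n"
        using mirror_cell_lower Suc.prems(1) True n0 by blast
      have b: "b = n - b'" using True kab by simp
      note mc = mirror_cell[OF c n0, folded kab(1,2) b]
      have vert: "even_vertex n k b = even_vertex n k' b'" "odd_vertex n k a = odd_vertex n k' (Suc b')"
        using mc(2) by (simp_all add: cell_edge_def)
      have t: "0 \<le> t" "t \<le> column_width m n k a"
        using Suc.prems(3) by (auto simp: mem_cell_region)
      then have "vector [t, 0] \<in> cell_region m n (k', Suc b', b')"
        using mc(3,4) H by (simp add: mem_cell_region)
      moreover have "Y_point m n (k, a, b) (vector [t, 0]) = Y_point m n (k', Suc b', b') (vector [t, 0])"
        using Y_point_fold[OF c n, of "vector [t, 0]"] t H mc(3,4) kab b by simp
      ultimately show ?thesis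
        using step[OF c] Suc.prems(2,4) H mc(2,3,4) vert by simp
    next
      case False
      then have "a = b \<or> a = Suc b" using Suc.prems(1) by (auto simp: cells_def)
      then show ?thesis using step[OF Suc.prems(1,2) H Suc.prems(3) _ Suc.prems(4)] by blast
    qed
  qed
qed

lemma settle_cell:
  assumes n: "2 \<le> n" and mn: "m * n \<ge> 6"
    and c: "c \<in> cells m n" and z: "z \<in> cell_region m n c"
  shows "\<exists>c'\<in>real_cells m n. z \<in> cell_region m n c' \<and>
     cell_edge n c' = settle m n (cell_edge n c) \<and> Y_point m n c' z = Y_point m n c z"
proof -
  obtain k a b where kab: "c = (k, a, b)" by (cases c) auto
  have n0: "0 < n" using n by simp
  note c' = c[unfolded kab] and z' = z[unfolded kab]
  have nonneg: "0 \<le> column_width m n k a" "0 \<le> row_height m n k b"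
    using c' n0 column_width_nonneg[of k m a n] row_height_nonneg[of k m b n] by (auto simp: cells_def)
  have adj: "\<bar>fst (even_vertex n k b - odd_vertex n k a)\<bar> + \<bar>snd (even_vertex n k b - odd_vertex n k a)\<bar> = 1"
    using adjacent_vertices[of a b n k] c' by (simp add: cells_def)
  consider "0 < column_width m n k a" "0 < row_height m n k b"
    | "column_width m n k a = 0" "0 < row_height m n k b"
    | "0 < column_width m n k a" "row_height m n k b = 0"
    using c' nonneg by (fastforce simp: cells_def)
  then show ?thesis
  proof cases
    case 1
    then have "c \<in> real_cells m n" using c' kab by (simp add: real_cells_def)
    then show ?thesis using z settle_real_cell[of k a b m n] n0 kab by auto
  next
    case 2
    have "even_vertex n k b \<in> grid_vertices m n"
      using cell_edge_in_grid(1)[OF c' n0] 2 by (simp add: cell_edge_def)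
    from ex_grid_neighbour[OF this mn, of "odd_vertex n k a - even_vertex n k b"] adj
    obtain d where d: "even_vertex n k b + (quarter_turn (even_vertex n k b) ^^ d)
        (odd_vertex n k a - even_vertex n k b) \<in> grid_vertices m n"
      by (auto simp: abs_minus_commute)
    have "z = vector [0, z $ 2]" using z' 2 by (simp add: mem_cell_region vec_eq_iff forall_2)
    then show ?thesis
      using settle_cell_east[OF n mn c' 2(2) _ d, of "z $ 2"] z' kab by metis
  next
    case 3
    have "odd_vertex n k a \<in> grid_vertices m n"
      using cell_edge_in_grid(2)[OF c' n0] 3 by (simp add: cell_edge_def)
    from ex_grid_neighbour[OF this mn, of "even_vertex n k b - odd_vertex n k a"] adj
    obtain d where d: "odd_vertex n k a + (quarter_turn (odd_vertex n k a) ^^ d)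
        (even_vertex n k b - odd_vertex n k a) \<in> grid_vertices m n"
      by auto
    have "z = vector [z $ 1, 0]" using z' 3 by (simp add: mem_cell_region vec_eq_iff forall_2)
    then show ?thesis
      using settle_cell_north[OF n mn c' 3(1) _ d, of "z $ 1"] z' kab by metis
  qed
qed

text \<open>Different polygons with a common edge are neighbours and number the rows oppositely. A
  cell with \<open>a = b\<close> has endpoints in both columns \<open>k\<close> and
  \<open>k + 1\<close>, which determines \<open>k\<close>; so only boundary cells are
  shared.\<close>

lemma cell_edge_eq_cases:
  assumes eq: "cell_edge n (k, a, b) = cell_edge n (k', a', b')"
    and c: "(k, a, b) \<in> cells m n" "(k', a', b') \<in> cells m n"
  shows "(k, a, b) = (k', a', b') \<or>
     a = Suc b \<and> (k', a', b') = (mirror n k b, n - Suc b, n - b) \<or>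
     a' = Suc b' \<and> (k, a, b) = (mirror n k' b', n - Suc b', n - b')"
proof (cases "k = k'")
  case True
  then show ?thesis
    using eq c by (auto simp: cell_edge_def even_vertex_def odd_vertex_def row_def cells_def split: if_splits)
next
  case False
  have bnd: "a \<le> n" "b \<le> n" "a' \<le> n" "b' \<le> n" "a \<le> Suc b" "b \<le> Suc a"
    using c by (auto simp: cells_def)
  have col: "column n k b = column n k' b'" "column n k (Suc a) = column n k' (Suc a')"
    and row: "row n k b = row n k' b'" "row n k a = row n k' a'"
    using eq by (simp_all add: cell_edge_def even_vertex_def odd_vertex_def)
  have near: "column n i l = i \<or> column n i l = Suc i" for i l
    by (simp add: column_def)
  have k': "k' = Suc k \<or> k = Suc k'"
    using near[of k b] near[of k' b'] col(1) False by auto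
  then have b': "b' = n - b" and a': "a' = n - a"
    using row bnd by (auto simp: row_def split: if_splits)
  have "a \<noteq> b"
  proof
    assume "a = b"
    then have "column n k' (Suc b') \<noteq> column n k' b'" "column n k (Suc b) \<noteq> column n k b" "a' = b'"
      using a' b' by (auto simp: column_def)
    then show False
      using col \<open>a = b\<close> near[of k b] near[of k "Suc b"] near[of k' b'] near[of k' "Suc b'"] False by auto
  qed
  then consider "a = Suc b" | "b = Suc a" using bnd by linarith
  then show ?thesis
  proof cases
    case 1
    have "k' = mirror n k b"
      using near[of k b] near[of k' b'] col(1) False by (auto simp: mirror_def)
    then show ?thesis using 1 a' b' by simp
  next
    case 2
    have "k = mirror n k' b'"
      using near[of k b] near[of k' b'] col(1) False by (auto simp: mirror_def)
    moreover have "a' = Suc b'" "a = n - Suc b'" "b = n - b'"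
      using 2 a' b' bnd by auto
    ultimately show ?thesis by simp
  qed
qed

lemma Y_point_eq_of_same_edge:
  assumes n: "2 \<le> n" and c: "c \<in> real_cells m n" "c' \<in> real_cells m n"
    and eq: "cell_edge n c = cell_edge n c'"
    and z: "z \<in> cell_region m n c" "z \<in> cell_region m n c'"
  shows "Y_point m n c z = Y_point m n c' z"
proof -
  have n0: "0 < n" using n by simp
  have fold: "Y_point m n (mirror n k b, n - Suc b, n - b) z = Y_point m n (k, Suc b, b) z"
    if "(k, Suc b, b) \<in> cells m n" "z \<in> cell_region m n (k, Suc b, b)"
      "z \<in> cell_region m n (mirror n k b, n - Suc b, n - b)" for k b
  proof -
    have "n - b = Suc (n - Suc b)" using that(1) by (auto simp: cells_def)
    then show ?thesis
      using that mirror_cell(3,4)[OF that(1) n0] by (intro Y_point_fold[OF that(1) n]) (auto simp: mem_cell_region)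
  qed
  obtain k a b k' a' b' where kab: "c = (k, a, b)" "c' = (k', a', b')"
    by (cases c, cases c') auto
  have "(k, a, b) \<in> cells m n" "(k', a', b') \<in> cells m n"
    using c kab by (auto simp: real_cells_def)
  from cell_edge_eq_cases[OF eq[unfolded kab] this] show ?thesis
    using fold[of k b] fold[of k' b'] z kab \<open>(k, a, b) \<in> cells m n\<close> \<open>(k', a', b') \<in> cells m n\<close>
    by (elim disjE conjE) auto
qed

text \<open>Inverse of \<open>row n k\<close> on the rows from \<open>0\<close> to
  \<open>n\<close>.\<close>

definition row_index :: "nat \<Rightarrow> nat \<Rightarrow> int \<Rightarrow> nat" where
  "row_index n k r = (if odd k then nat r else nat (int n - r))"

lemma even_vertex_row_index:
  assumes "int k = c \<or> int k = c - 1" "0 \<le> r" "r \<le> int n" "even (c + r)"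
  shows "even_vertex n k (row_index n k r) = (c, r)"
proof -
  have "c = int k \<or> c = int k + 1" using assms(1) by linarith
  then show ?thesis
    using assms(2-4) by (auto simp: even_vertex_def row_index_def column_def row_def even_nat_iff)
qed

lemma odd_vertex_row_index:
  assumes "int k = c \<or> int k = c - 1" "0 \<le> r" "r \<le> int n" "odd (c + r)"
  shows "odd_vertex n k (row_index n k r) = (c, r)"
proof -
  have "c = int k \<or> c = int k + 1" using assms(1) by linarith
  then show ?thesis
    using assms(2-4) by (auto simp: odd_vertex_def row_index_def column_def row_def even_nat_iff)
qed

text \<open>The choice \<open>lower\<close> matters for edges inside a column, whose rectangle is
  halved: \<open>a \<le> b\<close> selects a cell containing the right side and the lower right
  half, \<open>b \<le> a\<close> one containing the top side and the upper left half.\<close>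

lemma ex_real_cell_of_edge:
  assumes e: "e \<in> grid_edges m n" and n: "0 < n"
  shows "\<exists>k a b. (k, a, b) \<in> real_cells m n \<and> cell_edge n (k, a, b) = e \<and> (if lower then a \<le> b else b \<le> a)"
proof -
  obtain c r c' r' where e': "e = ((c, r), (c', r'))" by (metis surj_pair)
  have g: "1 \<le> c" "c < int m" "1 \<le> r" "r < int n" "1 \<le> c'" "c' < int m" "1 \<le> r'" "r' < int n"
    "even (c + r)" "odd (c' + r')" "\<bar>c - c'\<bar> + \<bar>r - r'\<bar> = 1"
    using e by (auto simp: e' grid_edges_def grid_vertices_def)
  \<comment> \<open>For an edge inside a column, \<open>a \<le> b\<close> says that the odd vertex
    lies below the even one if rows are numbered upwards, above it if downwards; \<open>P\<close> is
    the resulting condition for \<open>k\<close> to be odd.\<close>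
  define P where "P \<longleftrightarrow> (lower \<longleftrightarrow> r' < r)"
  define k where "k = (if c \<noteq> c' then nat (min c c') else if odd c \<longleftrightarrow> P then nat c else nat (c - 1))"
  have diff: "r = r' \<and> (c' = c + 1 \<or> c' = c - 1) \<or> c = c' \<and> (r' = r + 1 \<or> r' = r - 1)"
    using g(11) by (auto simp: abs_if split: if_splits)
  then have k: "int k = c \<or> int k = c - 1" "int k = c' \<or> int k = c' - 1" "k < m"
    using g by (auto simp: k_def min_def)
  have par: "odd k \<longleftrightarrow> P" if "c = c'"
    using that g by (auto simp: k_def even_nat_iff)
  define a where "a = row_index n k r'"
  define b where "b = row_index n k r"
  have vert: "even_vertex n k b = (c, r)" "odd_vertex n k a = (c', r')"
    unfolding a_def b_def using k g by (auto intro!: even_vertex_row_index odd_vertex_row_index)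
  have ab: "a \<le> n" "b \<le> n" "a \<le> Suc b" "b \<le> Suc a"
    using g by (auto simp: a_def b_def row_index_def)
  have "row_height m n k b > 0"
    using even_vertex_in_grid[OF k(3) ab(2) n] vert e by (auto simp: e' grid_edges_def)
  moreover have "column_width m n k a > 0"
    using odd_vertex_in_grid[OF k(3) ab(1) n] vert e by (auto simp: e' grid_edges_def)
  ultimately have "(k, a, b) \<in> real_cells m n"
    using k ab by (auto simp: real_cells_def cells_def)
  moreover have "if lower then a \<le> b else b \<le> a"
    using diff par g by (auto simp: a_def b_def row_index_def P_def)
  moreover have "cell_edge n (k, a, b) = e" using vert by (simp add: cell_edge_def e')
  ultimately show ?thesis by blast
qed

section \<open>Identifications in the two surfaces agree\<close>

lemma shear_invertible:
  assumes "2 \<le> n"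
  shows "invertible (shear n)"
proof -
  have "sin (pi / n) > 0"
    using assms by (intro sin_gt_zero) (auto simp: field_simps)
  then have "det (shear n) \<noteq> 0"
    by (simp add: det_2 shear_def)
  then show ?thesis by (simp add: invertible_det_nz)
qed

lemma shear_inj:
  assumes "2 \<le> n"
  shows "shear n *v x = shear n *v y \<longleftrightarrow> x = y"
  using shear_invertible[OF assms] by (metis invertible_eq_bij bij_is_inj injD)

text \<open>Coincident labels are handled by \<open>settle_cell\<close> and folding; each gluing of
  rectangles is realised by two adjacent cells of one polygon.\<close>

lemma Y_point_eq_of_X_point_eq:
  assumes n: "2 \<le> n" and mn: "m * n \<ge> 6"
    and c: "c \<in> cells m n" "z \<in> cell_region m n c" "d \<in> cells m n" "w \<in> cell_region m n d"
    and eq: "X_point m n c z = X_point m n d w"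
  shows "Y_point m n c z = Y_point m n d w"
proof -
  have n0: "0 < n" using n by simp
  let ?e = "\<lambda>p. (settle m n (cell_edge n (fst p)), snd p)" and ?g = "\<lambda>p. Y_point m n (fst p) (snd p)"
  let ?Z = "Sigma (cells m n) (cell_region m n)"
  have "?g (c, z) = ?g (d, w)"
  proof (rule surface_point_lift[where e = ?e and g = ?g and Z = ?Z and S = "surface_X m n"])
    fix p q assume p: "p \<in> ?Z" and q: "q \<in> ?Z" and pq: "?e p = ?e q"
    obtain c1 where c1: "c1 \<in> real_cells m n" "snd p \<in> cell_region m n c1"
      "cell_edge n c1 = settle m n (cell_edge n (fst p))" "Y_point m n c1 (snd p) = ?g p"
      using settle_cell[OF n mn, of "fst p" "snd p"] p by (auto simp: mem_Sigma_iff)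
    obtain c2 where c2: "c2 \<in> real_cells m n" "snd q \<in> cell_region m n c2"
      "cell_edge n c2 = settle m n (cell_edge n (fst q))" "Y_point m n c2 (snd q) = ?g q"
      using settle_cell[OF n mn, of "fst q" "snd q"] q by (auto simp: mem_Sigma_iff)
    show "?g p = ?g q"
      using Y_point_eq_of_same_edge[OF n c1(1) c2(1)] c1 c2 pq by simp
  next
    fix p q assume "(p, q) \<in> side_identification (surface_X m n)"
    then show "\<exists>z\<in>?Z. \<exists>w\<in>?Z. ?e z = p \<and> ?e w = q \<and> ?g z = ?g w"
    proof (cases rule: side_identification_surface_X)
      case (1 e r)
      \<comment> \<open>With \<open>a \<le> b\<close> the cell contains the whole right side of the
        rectangle, and the cell to its right still belongs to the polygon.\<close>
      obtain k a b where kab: "(k, a, b) \<in> real_cells m n" "cell_edge n (k, a, b) = e" "a \<le> b"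
        using ex_real_cell_of_edge[OF 1(1) n0, of True] by auto
      have c: "(k, a, b) \<in> cells m n" and W: "0 < column_width m n k a" and H: "0 < row_height m n k b"
        using kab by (auto simp: real_cells_def)
      have wt: "weight m n (fst e) = row_height m n k b" "weight m n (snd e) = column_width m n k a"
        using weight_cell_edge[OF n0, of m k a b] kab by simp_all
      have bn: "k < m" "b < n" "b \<le> n"
        using c H row_height_pos_iff[of k m b n] n0 by (auto simp: cells_def)
      have c': "(k, Suc a, b) \<in> cells m n"
        using c H bn kab(3) by (auto simp: cells_def)
      have z: "vector [column_width m n k a, r] \<in> cell_region m n (k, a, b)"
        using 1 W kab(3) wt by (auto simp: mem_cell_region mult.commute)
      have "0 \<le> column_width m n k (Suc a)"
        using c' n0 by (intro column_width_nonneg) (auto simp: cells_def)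
      then have w: "vector [0, r] \<in> cell_region m n (k, Suc a, b)"
        using 1 kab(3) wt c by (auto simp: mem_cell_region cells_def)
      show ?thesis
      proof (intro bexI conjI)
        show "?e ((k, a, b), vector [column_width m n k a, r]) = p"
          using settle_real_cell[OF kab(1) n0] 1 kab(2) wt by simp
        show "?e ((k, Suc a, b), vector [0, r]) = q"
          using settle_right[OF c c' n0 mn] 1 kab(2) by simp
        show "?g ((k, a, b), vector [column_width m n k a, r]) = ?g ((k, Suc a, b), vector [0, r])"
          by (simp add: Y_point_right)
      qed (use c c' z w in auto)
    next
      case (2 e r)
      obtain k a b where kab: "(k, a, b) \<in> real_cells m n" "cell_edge n (k, a, b) = e" "b \<le> a"
        using ex_real_cell_of_edge[OF 2(1) n0, of False] by auto
      have c: "(k, a, b) \<in> cells m n" and W: "0 < column_width m n k a" and H: "0 < row_height m n k b"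
        using kab by (auto simp: real_cells_def)
      have wt: "weight m n (fst e) = row_height m n k b" "weight m n (snd e) = column_width m n k a"
        using weight_cell_edge[OF n0, of m k a b] kab by simp_all
      have an: "k < m" "a < n" "a \<le> n"
        using c W column_width_pos_iff[of k m a n] n0 by (auto simp: cells_def)
      have c': "(k, a, Suc b) \<in> cells m n"
        using c W an kab(3) by (auto simp: cells_def)
      have z: "vector [r, row_height m n k b] \<in> cell_region m n (k, a, b)"
        using 2 H kab(3) wt by (auto simp: mem_cell_region mult.commute)
      have "0 \<le> row_height m n k (Suc b)"
        using c' n0 by (intro row_height_nonneg) (auto simp: cells_def)
      then have w: "vector [r, 0] \<in> cell_region m n (k, a, Suc b)"
        using 2 kab(3) wt c by (auto simp: mem_cell_region cells_def)
      show ?thesis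
      proof (intro bexI conjI)
        show "?e ((k, a, b), vector [r, row_height m n k b]) = p"
          using settle_real_cell[OF kab(1) n0] 2 kab(2) wt by simp
        show "?e ((k, a, Suc b), vector [r, 0]) = q"
          using settle_up[OF c c' n0 mn] 2 kab(2) by simp
        show "?g ((k, a, b), vector [r, row_height m n k b]) = ?g ((k, a, Suc b), vector [r, 0])"
          by (simp add: Y_point_up)
      qed (use c c' z w in auto)
    qed
  next
    show "surface_point (surface_X m n) (?e (c, z)) = surface_point (surface_X m n) (?e (d, w))"
      using eq by (simp add: X_point_def)
  qed (use c in auto)
  then show ?thesis by simp
qed

lemma diagonal_in_cell_region:
  assumes c: "(k, Suc b, b) \<in> cells m n" and n: "0 < n" and r: "0 \<le> r" "r \<le> 1"
  shows "r *\<^sub>R cell_diagonal m n (k, Suc b, b) \<in> cell_region m n (k, Suc b, b)"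
    and "r *\<^sub>R cell_diagonal m n (k, Suc b, b) \<in> cell_region m n (mirror n k b, n - Suc b, n - b)"
proof -
  have "k < m" "Suc b \<le> n" "b \<le> n" using c by (auto simp: cells_def)
  then have "0 \<le> column_width m n k (Suc b)" "0 \<le> row_height m n k b"
    using n by (simp_all add: column_width_nonneg row_height_nonneg)
  then show "r *\<^sub>R cell_diagonal m n (k, Suc b, b) \<in> cell_region m n (k, Suc b, b)"
    "r *\<^sub>R cell_diagonal m n (k, Suc b, b) \<in> cell_region m n (mirror n k b, n - Suc b, n - b)"
    using r mirror_cell(3,4)[OF c n]
    by (auto simp: mem_cell_region cell_diagonal_def mult_left_le_one_le)
qed

lemma X_point_eq_of_Y_point_eq:
  assumes m: "2 \<le> m" and n: "2 \<le> n" and mn: "m * n \<ge> 6"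
    and c: "c \<in> cells m n" "z \<in> cell_region m n c" "d \<in> cells m n" "w \<in> cell_region m n d"
    and eq: "Y_point m n c z = Y_point m n d w"
  shows "X_point m n c z = X_point m n d w"
proof -
  have n0: "0 < n" using n by simp
  let ?e = "\<lambda>p. (fst (fst p), shear n *v (snd p + cell_corner m n (fst p)))"
    and ?g = "\<lambda>p. X_point m n (fst p) (snd p)"
  let ?Z = "Sigma (cells m n) (cell_region m n)"
  have "?g (c, z) = ?g (d, w)"
  proof (rule surface_point_lift[where e = ?e and g = ?g and Z = ?Z and S = "surface_Y m n"])
    fix p q assume p: "p \<in> ?Z" and q: "q \<in> ?Z" and pq: "?e p = ?e q"
    obtain k a b z a' b' z' where "p = ((k, a, b), z)" "q = ((k, a', b'), z')"
      using pq by (metis Pair_inject prod.exhaust_sel)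
    then show "?g p = ?g q"
      using X_point_eq_of_position_eq[OF m n mn, of k a b a' b' z z'] p q pq shear_inj[OF n] by auto
  next
    fix p q assume "(p, q) \<in> side_identification (surface_Y m n)"
    then obtain k x j y v r where g: "((k, x), (j, y), v) \<in> gluings (surface_Y m n)" "0 \<le> r" "r \<le> 1"
      and pq: "p = (k, x + r *\<^sub>R v)" "q = (j, y + r *\<^sub>R v)"
      unfolding side_identification_def by blast
    then obtain i where i: "k < m" "odd k" "i < 2 * n" "side_vector m n k i \<noteq> 0"
      and p: "p = (k, side_start m n k i + r *\<^sub>R side_vector m n k i)"
      and q: "q = (glued_to k i, side_start m n (glued_to k i) (opposite n i + 1) + r *\<^sub>R side_vector m n k i)"
      by (auto simp: gluings_surface_Y)
    have "side_length m n k i \<noteq> 0"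
      using i(4) by (auto simp: side_vector_def polygon_edge_def side_length_def split: if_splits)
    then have len: "side_length m n k i > 0"
      using side_length_nonneg[OF i(1), of n i] by simp
    show "\<exists>z\<in>?Z. \<exists>w\<in>?Z. ?e z = p \<and> ?e w = q \<and> ?g z = ?g w"
    \<comment> \<open>Sides below \<open>n\<close> of the odd polygon are diagonals of lower right
      cells. Side \<open>n + j\<close> is the diagonal of an upper left cell, the mirror image of
      \<open>(k', Suc j, j)\<close> with \<open>k'\<close> even.\<close>
    proof (cases "i < n")
      case True
      have c: "(k, Suc i, i) \<in> cells m n"
        using True len i n by (auto simp: cell_iff)
      let ?z = "r *\<^sub>R cell_diagonal m n (k, Suc i, i)"
      note fold = fold_side_odd[OF c n i(2)]
      show ?thesis
      proof (intro bexI conjI)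
        show "?e ((k, Suc i, i), ?z) = p"
          unfolding p by (simp only: fold fst_conv snd_conv)
        show "?e ((mirror n k i, n - Suc i, n - i), ?z) = q"
          unfolding q by (simp only: fold fst_conv snd_conv)
        show "?g ((k, Suc i, i), ?z) = ?g ((mirror n k i, n - Suc i, n - i), ?z)"
          using X_point_fold[OF c n0] by simp
      qed (use c mirror_cell(1)[OF c n0] diagonal_in_cell_region[OF c n0 g(2,3)] in auto)
    next
      case False
      define j where "j = i - n"
      have j: "i = n + j" "j < n" using False i by (auto simp: j_def)
      have Sj: "Suc (n - Suc j) = n - j" using j by simp
      have "side_length m n k (n - j) > 0"
        using len side_length_cong[of "n + j" "n - j" m n k] j by simp
      then have "side_length m n k (Suc (n - Suc j)) > 0" by (simp only: Sj)
      then have "(k, n - Suc j, Suc (n - Suc j)) \<in> cells m n"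
        using i n j by (auto simp: cell_iff)
      then obtain k' b where c: "(k', Suc b, b) \<in> cells m n" and k: "k = mirror n k' b"
        and b: "n - Suc j = n - Suc b" "Suc b \<le> n"
        using mirror_cell_lower n0 by blast
      have bj: "b = j" using b j by linarith
      have "even k'"
        using k i(2) mirror_cell(6)[OF c n0] by (auto simp: mirror_def column_def split: if_splits)
      have kj: "mirror n k' j = k" using k bj by simp
      note fold = fold_side_even[OF c n \<open>even k'\<close>, folded k, unfolded bj, folded j(1)]
      let ?z = "(1 - r) *\<^sub>R cell_diagonal m n (k', Suc b, b)"
      show ?thesis
      proof (intro bexI conjI)
        show "?e ((mirror n k' b, n - Suc b, n - b), ?z) = p"
          unfolding p by (simp only: fold fst_conv snd_conv bj kj)
        show "?e ((k', Suc b, b), ?z) = q"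
          unfolding q by (simp only: fold fst_conv snd_conv bj kj)
        show "?g ((mirror n k' b, n - Suc b, n - b), ?z) = ?g ((k', Suc b, b), ?z)"
          using X_point_fold[OF c n0] by simp
      qed (use c mirror_cell(1)[OF c n0] diagonal_in_cell_region[OF c n0, of "1 - r"] g(2,3) in auto)
    qed
  next
    show "surface_point (surface_Y m n) (?e (c, z)) = surface_point (surface_Y m n) (?e (d, w))"
      using eq by (simp add: Y_point_def)
  qed (use c in auto)
  then show ?thesis by simp
qed

subsection \<open>The sheared polygons are covered by their cells\<close>

lemma half_plane:
  fixes \<alpha> \<beta> \<gamma> :: real
  shows "convex {z :: plane. \<alpha> * z $ 1 + \<beta> * z $ 2 \<le> \<gamma>}"
    and "closed {z :: plane. \<alpha> * z $ 1 + \<beta> * z $ 2 \<le> \<gamma>}"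
    and "open {z :: plane. \<alpha> * z $ 1 + \<beta> * z $ 2 < \<gamma>}"
proof -
  have eq: "\<alpha> * z $ 1 + \<beta> * z $ 2 = (vector [\<alpha>, \<beta>] :: plane) \<bullet> z" for z
    by (simp add: inner_vec_def sum_2)
  show "convex {z :: plane. \<alpha> * z $ 1 + \<beta> * z $ 2 \<le> \<gamma>}"
    "closed {z :: plane. \<alpha> * z $ 1 + \<beta> * z $ 2 \<le> \<gamma>}"
    "open {z :: plane. \<alpha> * z $ 1 + \<beta> * z $ 2 < \<gamma>}"
    unfolding eq by (rule convex_halfspace_le closed_halfspace_le open_halfspace_lt)+
qed

lemma cell_region_half_planes:
  "cell_region m n (k, a, b) =
     {z. (-1) * z $ 1 + 0 * z $ 2 \<le> 0} \<inter> {z. 1 * z $ 1 + 0 * z $ 2 \<le> column_width m n k a} \<inter>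
     {z. 0 * z $ 1 + (-1) * z $ 2 \<le> 0} \<inter> {z. 0 * z $ 1 + 1 * z $ 2 \<le> row_height m n k b} \<inter>
     (if a = Suc b then {z. row_height m n k b * z $ 1 + (- column_width m n k a) * z $ 2 \<le> 0} else UNIV) \<inter>
     (if b = Suc a then {z. (- row_height m n k b) * z $ 1 + column_width m n k a * z $ 2 \<le> 0} else UNIV)"
  by (auto simp: mem_cell_region mult.commute)

lemma convex_cell_region: "convex (cell_region m n c)"
proof -
  obtain k a b where c: "c = (k, a, b)" by (cases c) auto
  have if_set: "convex (if Q then S else UNIV)" if "convex S" for Q and S :: "plane set"
    using that by simp
  show ?thesis
    unfolding c cell_region_half_planes by (intro convex_Int half_plane(1) if_set)
qed

lemma compact_cell_region: "compact (cell_region m n c)"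
proof -
  obtain k a b where c: "c = (k, a, b)" by (cases c) auto
  have if_set: "closed (if Q then S else UNIV)" if "closed S" for Q and S :: "plane set"
    using that by simp
  have "closed (cell_region m n c)"
    unfolding c cell_region_half_planes by (intro closed_Int half_plane(2) if_set)
  moreover have "cell_region m n c \<subseteq> cbox 0 (vector [column_width m n k a, row_height m n k b])"
    by (auto simp: c mem_cell_region mem_box_cart forall_2)
  then have "bounded (cell_region m n c)"
    using bounded_cbox bounded_subset by blast
  ultimately show ?thesis by (simp add: compact_eq_bounded_closed)
qed

lemma interior_cell_region:
  assumes "c \<in> real_cells m n"
  shows "interior (cell_region m n c) \<noteq> {}"
proof -
  obtain k a b where c: "c = (k, a, b)" by (cases c) auto
  let ?W = "column_width m n k a" and ?H = "row_height m n k b"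
  have pos: "0 < ?W" "0 < ?H" using assms by (auto simp: c real_cells_def)
  define A where "A = {z :: plane. (-1) * z $ 1 + 0 * z $ 2 < 0} \<inter> {z. 1 * z $ 1 + 0 * z $ 2 < ?W} \<inter>
    {z. 0 * z $ 1 + (-1) * z $ 2 < 0} \<inter> {z. 0 * z $ 1 + 1 * z $ 2 < ?H}"
  define P where "P = (if a = Suc b then {z :: plane. ?H * z $ 1 + (- ?W) * z $ 2 < 0}
    else {z. (- ?H) * z $ 1 + ?W * z $ 2 < 0})"
  have "open A"
    unfolding A_def by (intro open_Int half_plane(3))
  moreover have "open P"
    unfolding P_def by (simp only: half_plane(3) split: if_split) simp
  ultimately have "open (A \<inter> P)"
    by (rule open_Int)
  moreover have "A \<inter> P \<subseteq> cell_region m n c"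
    by (auto simp: A_def P_def c mem_cell_region mult.commute split: if_splits)
  ultimately have "A \<inter> P \<subseteq> interior (cell_region m n c)"
    by (rule interior_maximal[rotated])
  \<comment> \<open>A point strictly above the diagonal for an upper left half, strictly below it
    otherwise.\<close>
  moreover have "(if a = Suc b then vector [?W / 4, ?H / 2] else vector [?W / 2, ?H / 4]) \<in> A \<inter> P"
    using pos by (auto simp: A_def P_def)
  ultimately show ?thesis by blast
qed

lemma finite_cells: "finite (cells m n)"
  by (rule finite_subset[of _ "{..<m} \<times> {..n} \<times> {..n}"]) (auto simp: cells_def)

definition sheared_polygon :: "nat \<Rightarrow> nat \<Rightarrow> nat \<Rightarrow> plane set" where
  "sheared_polygon m n k =
     {p. shear n *v p \<in> semiregular_polygon n (even_length m n k) (odd_length m n k)}"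

lemma convex_sheared_polygon: "convex (sheared_polygon m n k)"
proof -
  have "sheared_polygon m n k =
      (*v) (shear n) -` semiregular_polygon n (even_length m n k) (odd_length m n k)"
    by (auto simp: sheared_polygon_def)
  then show ?thesis
    by (simp add: convex_linear_vimage semiregular_polygon_def convex_convex_hull)
qed

section \<open>Cells lie in the polygon\<close>

lemma segment_in_convex:
  fixes K :: "plane set"
  assumes "convex K" "vector [x, y] \<in> K" "vector [x', y'] \<in> K" "0 \<le> t" "t \<le> 1"
  shows "vector [x + t * (x' - x), y + t * (y' - y)] \<in> K"
proof -
  have "(1 - t) *\<^sub>R vector [x, y] + t *\<^sub>R vector [x', y'] \<in> K"
    using convexD_alt[OF assms] .
  also have "(1 - t) *\<^sub>R vector [x, y] + t *\<^sub>R vector [x', y'] =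
      (vector [x + t * (x' - x), y + t * (y' - y)] :: plane)"
    by (simp add: vec_eq_iff forall_2 algebra_simps)
  finally show ?thesis .
qed

lemma horizontal_in_convex:
  fixes K :: "plane set"
  assumes K: "convex K" "vector [x, y] \<in> K" "vector [x', y] \<in> K" and u: "x \<le> u" "u \<le> x'"
  shows "vector [u, y] \<in> K"
proof (cases "x = x'")
  case False
  then have "0 \<le> (u - x) / (x' - x)" "(u - x) / (x' - x) \<le> 1" "(u - x) / (x' - x) * (x' - x) = u - x"
    using u by (simp_all add: divide_le_eq_1)
  then show ?thesis
    using segment_in_convex[OF K, of "(u - x) / (x' - x)"] by simp
qed (use assms in auto)

text \<open>The slice at height \<open>t\<close> runs from the left side to the hypotenuse; the flat
  triangle is treated apart because of the ratio \<open>t / h\<close>.\<close>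

lemma upper_left_triangle_in_convex:
  fixes K :: "plane set"
  assumes K: "convex K" and P: "vector [x, y] \<in> K" "vector [x, y + h] \<in> K" "vector [x + w, y + h] \<in> K"
    and z: "0 \<le> s" "s \<le> w" "0 \<le> t" "t \<le> h" "s * h \<le> t * w"
  shows "vector [x + s, y + t] \<in> K"
proof (cases "h = 0")
  case True
  then show ?thesis
    using horizontal_in_convex[OF K, of x y "x + w" "x + s"] P z by simp
next
  case False
  then have h: "h > 0" using z by simp
  then have t: "0 \<le> t / h" "t / h \<le> 1" using z by simp_all
  have left: "vector [x, y + t] \<in> K"
    using segment_in_convex[OF K P(1,2) t] h by simp
  have right: "vector [x + t / h * w, y + t] \<in> K"
    using segment_in_convex[OF K P(1,3) t] h by simp
  have "s \<le> t / h * w"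
    using z(5) h by (simp add: pos_le_divide_eq)
  then have "x + s \<le> x + t / h * w" "x \<le> x + s" using z(1) by linarith+
  then show ?thesis by (intro horizontal_in_convex[OF K left right])
qed

lemma lower_right_triangle_in_convex:
  fixes K :: "plane set"
  assumes K: "convex K" and P: "vector [x, y] \<in> K" "vector [x + w, y] \<in> K" "vector [x + w, y + h] \<in> K"
    and z: "0 \<le> s" "s \<le> w" "0 \<le> t" "t \<le> h" "t * w \<le> s * h"
  shows "vector [x + s, y + t] \<in> K"
proof (cases "h = 0")
  case True
  then show ?thesis
    using horizontal_in_convex[OF K, of x y "x + w" "x + s"] P z by simp
next
  case False
  then have h: "h > 0" using z by simp
  then have t: "0 \<le> t / h" "t / h \<le> 1" using z by simp_all
  have right: "vector [x + w, y + t] \<in> K"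
    using segment_in_convex[OF K P(2,3) t] h by simp
  have left: "vector [x + t / h * w, y + t] \<in> K"
    using segment_in_convex[OF K P(1,3) t] h by simp
  have "t / h * w \<le> s"
    using z(5) h by (simp add: pos_divide_le_eq)
  then have "x + t / h * w \<le> x + s" "x + s \<le> x + w" using z(2) by linarith+
  then show ?thesis by (intro horizontal_in_convex[OF K left right])
qed

lemma side_start_in_polygon:
  assumes "i < 2 * n"
  shows "side_start m n k i \<in> semiregular_polygon n (even_length m n k) (odd_length m n k)"
  unfolding semiregular_polygon_def side_start_def by (rule hull_inc) (use assms in auto)

lemma lower_vertex:
  assumes "2 \<le> n" "l \<le> n"
  shows "vector [column_start m n k (Suc l), row_start m n k l] \<in> sheared_polygon m n k"
  using side_start_in_polygon[of l n m k] side_start_shear[of n m k l] assms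
  by (simp add: sheared_polygon_def del: column_start_Suc)

lemma upper_vertex:
  assumes "2 \<le> n" "l \<le> n"
  shows "vector [column_start m n k l, row_start m n k (Suc l)] \<in> sheared_polygon m n k"
proof (cases "l = 0")
  case True
  then show ?thesis
    using lower_vertex[of n 0 m k] assms
    by (simp add: column_start_def row_start_def column_width_def row_height_def)
next
  case False
  then show ?thesis
    using side_start_in_polygon[of "n + (n - l)" n m k] side_start_upper[of n "n - l" m k] assms
    by (simp add: sheared_polygon_def del: row_start_Suc)
qed

text \<open>The grid point lies on the horizontal segment from the upper left vertex at column
  position \<open>l - 1\<close> to the lower right vertex at column position
  \<open>l + 1\<close>.\<close>

lemma middle_vertex:
  assumes n: "2 \<le> n" and k: "k < m" and l: "0 < l" "l \<le> n"
  shows "vector [column_start m n k l, row_start m n k l] \<in> sheared_polygon m n k"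
proof -
  obtain l' where l': "l = Suc l'" using l by (cases l) auto
  have "0 \<le> column_width m n k l'" "0 \<le> column_width m n k l"
    using n k l l' by (simp_all add: column_width_nonneg)
  then have "column_start m n k l' \<le> column_start m n k l" "column_start m n k l \<le> column_start m n k (Suc l)"
    using l' by simp_all
  then show ?thesis
    using horizontal_in_convex[OF convex_sheared_polygon] upper_vertex[OF n, of l' m k]
      lower_vertex[OF n l(2), of m k] l l' by (metis Suc_leD)
qed

lemma cell_in_sheared_polygon:
  assumes n: "2 \<le> n" and c: "(k, a, b) \<in> cells m n" and z: "z \<in> cell_region m n (k, a, b)"
  shows "z + cell_corner m n (k, a, b) \<in> sheared_polygon m n k"
proof -
  have n0: "0 < n" using n by simp
  have k: "k < m" "a \<le> n" "b \<le> n" "a \<le> Suc b" "b \<le> Suc a" using c by (auto simp: cells_def)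
  let ?x = "column_start m n k" and ?y = "row_start m n k"
  let ?K = "sheared_polygon m n k"
  have zc: "z + cell_corner m n (k, a, b) = vector [?x a + z $ 1, ?y b + z $ 2]"
    by (simp add: cell_corner_def vec_eq_iff forall_2)
  have z': "0 \<le> z $ 1" "z $ 1 \<le> column_width m n k a" "0 \<le> z $ 2" "z $ 2 \<le> row_height m n k b"
    using z by (auto simp: mem_cell_region)
  have UL: ?thesis if "z $ 1 * row_height m n k b \<le> z $ 2 * column_width m n k a"
    "vector [?x a, ?y b] \<in> ?K" "vector [?x a, ?y (Suc b)] \<in> ?K" "vector [?x (Suc a), ?y (Suc b)] \<in> ?K"
    unfolding zc using upper_left_triangle_in_convex[OF convex_sheared_polygon _ _ _ z'] that by simp
  have LR: ?thesis if "z $ 2 * column_width m n k a \<le> z $ 1 * row_height m n k b"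
    "vector [?x a, ?y b] \<in> ?K" "vector [?x (Suc a), ?y b] \<in> ?K" "vector [?x (Suc a), ?y (Suc b)] \<in> ?K"
    unfolding zc using lower_right_triangle_in_convex[OF convex_sheared_polygon _ _ _ z'] that by simp
  \<comment> \<open>A full rectangle is split by its diagonal into both triangles, a boundary cell
    is one of them; every corner needed is a vertex of the polygon or a point from
    \<open>middle_vertex\<close>.\<close>
  consider "a = b" | "a = Suc b" | "b = Suc a" using k by linarith
  then show ?thesis
  proof cases
    case 1
    then have b: "0 < b" "b < n" using c n0 by (auto simp: cell_iff)
    show ?thesis
      using UL LR lower_vertex[OF n, of b m k] upper_vertex[OF n, of b m k]
        middle_vertex[OF n k(1), of b] middle_vertex[OF n k(1), of "Suc b"] b 1
      by (metis Suc_leI less_imp_le linear zero_less_Suc)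
  next
    case 2
    then show ?thesis
      using UL lower_vertex[OF n, of b m k] lower_vertex[OF n, of "Suc b" m k]
        middle_vertex[OF n k(1), of "Suc b"] z k by (simp add: mem_cell_region del: column_start_Suc row_start_Suc)
  next
    case 3
    then show ?thesis
      using LR upper_vertex[OF n, of a m k] upper_vertex[OF n, of "Suc a" m k]
        middle_vertex[OF n k(1), of "Suc a"] z k by (simp add: mem_cell_region del: column_start_Suc row_start_Suc)
  qed
qed

section \<open>Points of the polygon lie in cells\<close>

lemma sheared_polygon_half_plane:
  assumes n: "2 \<le> n" and p: "p \<in> sheared_polygon m n k"
    and lower: "\<And>l. l \<le> n \<Longrightarrow> \<gamma> \<le> \<alpha> * column_start m n k (Suc l) + \<beta> * row_start m n k l"
    and upper: "\<And>l. 0 < l \<Longrightarrow> l \<le> n \<Longrightarrow> \<gamma> \<le> \<alpha> * column_start m n k l + \<beta> * row_start m n k (Suc l)"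
  shows "\<gamma> \<le> \<alpha> * p $ 1 + \<beta> * p $ 2"
proof -
  define A where "A = {z :: plane. (- \<alpha>) * z $ 1 + (- \<beta>) * z $ 2 \<le> - \<gamma>}"
  have "side_start m n k i \<in> (*v) (shear n) ` A" if i: "i < 2 * n" for i
  proof (cases "i < n")
    case True
    then show ?thesis
      using lower[of i] by (auto simp: side_start_shear[OF n] A_def)
  next
    case False
    then obtain j where j: "i = n + j" "j < n" using i le_Suc_ex[of n i] by auto
    have "vector [column_start m n k (n - j), row_start m n k (Suc (n - j))] \<in> A"
      using upper[of "n - j"] j by (simp add: A_def)
    moreover have "side_start m n k i =
        shear n *v vector [column_start m n k (n - j), row_start m n k (Suc (n - j))]"
      using side_start_upper[OF n, of j m k] j by simp
    ultimately show ?thesis by (metis imageI)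
  qed
  then have "semiregular_polygon n (even_length m n k) (odd_length m n k) \<subseteq> (*v) (shear n) ` A"
    unfolding semiregular_polygon_def A_def
    by (intro hull_minimal convex_linear_image half_plane matrix_vector_mul_linear)
      (auto simp: side_start_def)
  then obtain q where "q \<in> A" "shear n *v p = shear n *v q"
    using p by (auto simp: sheared_polygon_def)
  then show ?thesis using shear_inj[OF n] by (auto simp: A_def)
qed

text \<open>Discrete convexity. The quantity changes at step \<open>l\<close> by
  \<open>S l * sin (pi / n) * sin ((l - b) * pi / n)\<close>, which is nonpositive before
  \<open>b\<close> and nonnegative from \<open>b\<close> on, so its minimum is the value
  \<open>0\<close> at \<open>b\<close>. It serves both boundary chains, with the coordinates
  exchanged.\<close>

lemma ascent_nonneg:
  fixes F G S :: "nat \<Rightarrow> real" and n :: nat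
  defines "s \<equiv> \<lambda>l. sin (real l * pi / real n)"
  assumes F: "\<And>l. F (Suc l) = F l + S l * s l" and G: "\<And>l. G (Suc l) = G l + S l * s (Suc l)"
    and S: "\<And>l. 0 \<le> S l" and n: "0 < n" and bl: "b \<le> n" "l \<le> n"
  shows "0 \<le> s (Suc b) * (F l - F b) - s b * (G l - G b)"
proof -
  define D where "D = (\<lambda>l. s (Suc b) * (F l - F b) - s b * (G l - G b))"
  have s1: "0 \<le> sin (pi / n)"
    using n by (intro sin_ge_zero) (auto simp: field_simps)
  have D_Suc: "D (Suc l) = D l + S l * (sin (pi / n) * sin (real l * pi / n - real b * pi / n))" for l
  proof -
    have s_Suc: "s (Suc i) = sin (real i * pi / n) * cos (pi / n) + cos (real i * pi / n) * sin (pi / n)" for i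
    proof -
      have "real (Suc i) * pi / n = real i * pi / n + pi / n"
        by (simp add: distrib_right add_divide_distrib)
      then show ?thesis unfolding s_def by (simp only: sin_add)
    qed
    have "s (Suc b) * s l - s b * s (Suc l) = sin (pi / n) * sin (real l * pi / n - real b * pi / n)"
      unfolding s_Suc sin_diff unfolding s_def by algebra
    moreover have "D (Suc l) = D l + S l * (s (Suc b) * s l - s b * s (Suc l))"
      unfolding D_def F G by algebra
    ultimately show ?thesis by simp
  qed
  have pos: "0 \<le> sin (real j * pi / n - real i * pi / n)" if "i \<le> j" "j \<le> n" for i j
  proof -
    have "real j * pi / n - real i * pi / n = real (j - i) * pi / n"
      using that by (simp add: of_nat_diff left_diff_distrib diff_divide_distrib)
    then show ?thesis using sin_multiple_pi_div(1)[of "j - i" n] that n by simp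
  qed
  have "0 \<le> D l"
  proof (cases "b \<le> l")
    case True
    then show ?thesis using bl(2)
    proof (induction l rule: dec_induct)
      case base
      show ?case by (simp add: D_def)
    next
      case (step l)
      then have "0 \<le> S l * (sin (pi / n) * sin (real l * pi / n - real b * pi / n))"
        using S s1 pos[of b l] by simp
      then show ?case using step D_Suc[of l] by simp
    qed
  next
    case False
    then have "l \<le> b" by simp
    then show ?thesis
    proof (induction l rule: inc_induct)
      case base
      show ?case by (simp add: D_def)
    next
      case (step l)
      have "sin (real l * pi / n - real b * pi / n) = - sin (real b * pi / n - real l * pi / n)"
        by (metis minus_diff_eq sin_minus)
      then have "S l * (sin (pi / n) * sin (real l * pi / n - real b * pi / n)) \<le> 0"
        using S[of l] s1 pos[of l b] step.hyps bl(1) by (simp add: mult_nonneg_nonneg)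
      then show ?case using step D_Suc[of l] by simp
    qed
  qed
  then show ?thesis by (simp add: D_def)
qed

lemma row_start_nonneg:
  assumes "k < m" "0 < n" "b \<le> Suc n"
  shows "0 \<le> row_start m n k b"
  using row_start_mono[of 0 b n k m] assms by (simp add: row_start_def)

text \<open>The polygon lies on one side of the line through side \<open>b\<close>. On the lower
  chain this is \<open>ascent_nonneg\<close> multiplied by the side length; an upper vertex is a
  lower one moved left by a column and up by a row, which stays on that side.\<close>

lemma right_of_lower_sides:
  assumes n: "2 \<le> n" and k: "k < m" and b: "b < n" and p: "p \<in> sheared_polygon m n k"
  shows "row_height m n k b * (p $ 1 - column_start m n k (Suc b)) \<le>
         column_width m n k (Suc b) * (p $ 2 - row_start m n k b)"
proof -
  have n0: "0 < n" using n by simp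
  let ?s = "\<lambda>l. sin (real l * pi / real n)" and ?x = "column_start m n k" and ?y = "row_start m n k"
  let ?C = "side_length m n k b"
  have asc: "0 \<le> ?s (Suc b) * (?y l - ?y b) - ?s b * (?x (Suc l) - ?x (Suc b))" if "l \<le> n" for l
    by (rule ascent_nonneg[where S = "side_length m n k" and G = "\<lambda>l. ?x (Suc l)"])
      (use n0 b that side_length_nonneg[OF k] in \<open>auto simp: column_width_def row_height_def\<close>)
  have C: "0 \<le> ?C" using side_length_nonneg[OF k] .
  have H: "0 \<le> row_height m n k b" using row_height_nonneg[OF k _ n0, of b] b by simp
  have WH: "column_width m n k (Suc b) = ?C * ?s (Suc b)" "row_height m n k b = ?C * ?s b"
    by (simp_all add: column_width_def row_height_def)
  have W: "0 \<le> column_width m n k (Suc b)"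
    using column_width_nonneg[OF k _ n0, of "Suc b"] b by simp
  have low: "column_width m n k (Suc b) * ?y b - row_height m n k b * ?x (Suc b) \<le>
      (- row_height m n k b) * ?x (Suc l) + column_width m n k (Suc b) * ?y l" if "l \<le> n" for l
  proof -
    have "0 \<le> ?C * (?s (Suc b) * (?y l - ?y b) - ?s b * (?x (Suc l) - ?x (Suc b)))"
      using C asc[OF that] by (rule mult_nonneg_nonneg)
    then show ?thesis unfolding WH by (simp add: algebra_simps)
  qed
  have "column_width m n k (Suc b) * ?y b - row_height m n k b * ?x (Suc b) \<le>
      (- row_height m n k b) * p $ 1 + column_width m n k (Suc b) * p $ 2"
  proof (rule sheared_polygon_half_plane[OF n p low])
    fix l assume l: "0 < l" "l \<le> n"
    have "0 \<le> row_height m n k b * column_width m n k l" "0 \<le> column_width m n k (Suc b) * row_height m n k l"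
      using H W column_width_nonneg[OF k l(2) n0] row_height_nonneg[OF k l(2) n0] by simp_all
    then show "column_width m n k (Suc b) * ?y b - row_height m n k b * ?x (Suc b) \<le>
        (- row_height m n k b) * ?x l + column_width m n k (Suc b) * ?y (Suc l)"
      using low[OF l(2)] by (simp add: algebra_simps)
  qed
  then show ?thesis by (simp add: algebra_simps)
qed

text \<open>The same argument for the upper chain, with the roles of columns and rows
  exchanged.\<close>

lemma left_of_upper_sides:
  assumes n: "2 \<le> n" and k: "k < m" and b: "b < n" and p: "p \<in> sheared_polygon m n k"
  shows "column_width m n k b * (p $ 2 - row_start m n k (Suc b)) \<le>
         row_height m n k (Suc b) * (p $ 1 - column_start m n k b)"
proof -
  have n0: "0 < n" using n by simp
  let ?s = "\<lambda>l. sin (real l * pi / real n)" and ?x = "column_start m n k" and ?y = "row_start m n k"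
  let ?C = "side_length m n k (Suc b)"
  have asc: "0 \<le> ?s (Suc b) * (?x l - ?x b) - ?s b * (?y (Suc l) - ?y (Suc b))" if "l \<le> n" for l
    by (rule ascent_nonneg[where S = "\<lambda>l. side_length m n k (Suc l)" and G = "\<lambda>l. ?y (Suc l)"])
      (use n0 b that side_length_nonneg[OF k] in \<open>auto simp: column_width_def row_height_def\<close>)
  have C: "0 \<le> ?C" using side_length_nonneg[OF k] .
  have H: "0 \<le> row_height m n k (Suc b)" using row_height_nonneg[OF k _ n0, of "Suc b"] b by simp
  have W: "0 \<le> column_width m n k b" using column_width_nonneg[OF k _ n0, of b] b by simp
  have WH: "column_width m n k b = ?C * ?s b" "row_height m n k (Suc b) = ?C * ?s (Suc b)"
    by (simp_all add: column_width_def row_height_def)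
  have up: "row_height m n k (Suc b) * ?x b - column_width m n k b * ?y (Suc b) \<le>
      row_height m n k (Suc b) * ?x l + (- column_width m n k b) * ?y (Suc l)" if "l \<le> n" for l
  proof -
    have "0 \<le> ?C * (?s (Suc b) * (?x l - ?x b) - ?s b * (?y (Suc l) - ?y (Suc b)))"
      using C asc[OF that] by (rule mult_nonneg_nonneg)
    then show ?thesis unfolding WH by (simp add: algebra_simps)
  qed
  have "row_height m n k (Suc b) * ?x b - column_width m n k b * ?y (Suc b) \<le>
      row_height m n k (Suc b) * p $ 1 + (- column_width m n k b) * p $ 2"
  proof (rule sheared_polygon_half_plane[OF n p _ up])
    fix l assume l: "l \<le> n"
    have "0 \<le> row_height m n k (Suc b) * column_width m n k l" "0 \<le> column_width m n k b * row_height m n k l"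
      using H W column_width_nonneg[OF k l n0] row_height_nonneg[OF k l n0] by simp_all
    then show "row_height m n k (Suc b) * ?x b - column_width m n k b * ?y (Suc b) \<le>
        row_height m n k (Suc b) * ?x (Suc l) + (- column_width m n k b) * ?y l"
      using up[OF l] by (simp add: algebra_simps)
  qed
  then show ?thesis by (simp add: algebra_simps)
qed

lemma ex_row_of_height:
  assumes y: "0 \<le> y" "y \<le> row_start m n k n" and pos: "0 < row_start m n k n"
    and k: "k < m" and n: "0 < n"
  obtains b where "b < n" "0 < row_height m n k b" "row_start m n k b \<le> y" "y \<le> row_start m n k (Suc b)"
proof -
  \<comment> \<open>Positivity of the upper end skips flat rows at the bottom when
    \<open>y = 0\<close>, so that the least row found has positive height.\<close>
  let ?P = "\<lambda>b. y \<le> row_start m n k (Suc b) \<and> 0 < row_start m n k (Suc b)"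
  define b where "b = (LEAST b. ?P b)"
  have Pn: "?P (n - 1)" using y pos n by simp
  have Pb: "?P b" unfolding b_def by (rule LeastI[of ?P, OF Pn])
  have bn: "b < n" using Least_le[of ?P, OF Pn] n unfolding b_def by linarith
  have "row_start m n k b \<le> 0 \<or> row_start m n k b < y"
  proof (cases b)
    case 0
    then show ?thesis by (simp add: row_start_def)
  next
    case (Suc b')
    then have "\<not> ?P b'" using not_less_Least[of b' ?P] unfolding b_def by simp
    then show ?thesis using Suc by auto
  qed
  then have "row_start m n k b \<le> y" "0 < row_height m n k b"
    using y(1) Pb by auto
  with bn Pb that show ?thesis by blast
qed

lemma row_height_last: "row_height m n k n = 0" if "0 < n"
  using that by (simp add: row_height_def)

lemma sheared_polygon_height:
  assumes n: "2 \<le> n" and k: "k < m" and p: "p \<in> sheared_polygon m n k"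
  shows "0 \<le> p $ 2" "p $ 2 \<le> row_start m n k n"
proof -
  have n0: "0 < n" using n by simp
  have last: "row_start m n k (Suc n) = row_start m n k n"
    using row_height_last[OF n0] by simp
  have nonneg: "0 \<le> row_start m n k l" if "l \<le> Suc n" for l
    using row_start_nonneg[OF k n0 that] .
  have le: "row_start m n k l \<le> row_start m n k n" if "l \<le> Suc n" for l
    using row_start_mono[OF that _ k n0] last by simp
  have "0 \<le> 0 * p $ 1 + 1 * p $ 2"
    by (rule sheared_polygon_half_plane[OF n p]) (use nonneg in \<open>auto simp del: row_start_Suc\<close>)
  then show "0 \<le> p $ 2" by simp
  have "- row_start m n k n \<le> 0 * p $ 1 + (-1) * p $ 2"
    by (rule sheared_polygon_half_plane[OF n p]) (use le in \<open>auto simp del: row_start_Suc\<close>)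
  then show "p $ 2 \<le> row_start m n k n" by simp
qed

lemma sheared_polygon_covered:
  assumes m: "2 \<le> m" and n: "2 \<le> n" and k: "k < m" and p: "p \<in> sheared_polygon m n k"
  shows "\<exists>a b z. (k, a, b) \<in> cells m n \<and> z \<in> cell_region m n (k, a, b) \<and> z + cell_corner m n (k, a, b) = p"
proof -
  have n0: "0 < n" using n by simp
  let ?x = "column_start m n k" and ?y = "row_start m n k"
  let ?W = "column_width m n k" and ?H = "row_height m n k"
  have cell: ?thesis if "(k, a, b) \<in> cells m n"
    "vector [p $ 1 - ?x a, p $ 2 - ?y b] \<in> cell_region m n (k, a, b)" for a b
  proof -
    have "vector [p $ 1 - ?x a, p $ 2 - ?y b] + cell_corner m n (k, a, b) = p"
      by (simp add: cell_corner_def vec_eq_iff forall_2)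
    then show ?thesis using that by blast
  qed
  note height = sheared_polygon_height[OF n k p]
  show ?thesis
  proof (cases "0 < ?y n")
    case True
    obtain b where b: "b < n" "0 < ?H b" "?y b \<le> p $ 2" "p $ 2 \<le> ?y (Suc b)"
      using ex_row_of_height[OF height True k n0] by blast
    then have "0 < b" using row_height_pos_iff[OF k _ n0, of b] by simp
    then obtain a where a: "b = Suc a" by (cases b) auto
    define t where "t = p $ 2 - ?y b"
    have t: "0 \<le> t" "t \<le> ?H b" using b by (simp_all add: t_def)
    have nonneg: "0 \<le> ?W l" if "l \<le> n" for l using column_width_nonneg[OF k that n0] .
    have right: "?H b * (p $ 1 - ?x (Suc b)) \<le> t * ?W (Suc b)"
      using right_of_lower_sides[OF n k b(1) p] by (simp add: t_def mult.commute)
    have left: "t * ?W a \<le> ?H b * (p $ 1 - ?x a)"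
      using left_of_upper_sides[OF n k _ p, of a] a b by (simp add: t_def mult.commute del: row_start_Suc)
    \<comment> \<open>Row \<open>b\<close> consists of at most the three columns
      \<open>b - 1\<close>, \<open>b\<close> and \<open>b + 1\<close>; in the outer two the
      supporting lines of the sides keep the point inside the half rectangle.\<close>
    consider "p $ 1 < ?x b" | "?x b \<le> p $ 1" "p $ 1 \<le> ?x (Suc b)" | "?x (Suc b) < p $ 1" by linarith
    then show ?thesis
    proof cases
      case 1
      have "0 \<le> t * ?W a"
        using t(1) nonneg[of a] a b(1) by (intro mult_nonneg_nonneg) auto
      then have "0 \<le> ?H b * (p $ 1 - ?x a)"
        using left by linarith
      then have "0 \<le> p $ 1 - ?x a" using b(2) by (simp add: zero_le_mult_iff)
      then have "vector [p $ 1 - ?x a, p $ 2 - ?y b] \<in> cell_region m n (k, a, b)"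
        using left t 1 a by (simp add: mem_cell_region t_def mult.commute del: row_start_Suc)
      moreover have "(k, a, b) \<in> cells m n" using a b k by (auto simp: cells_def)
      ultimately show ?thesis by (intro cell)
    next
      case 2
      have "vector [p $ 1 - ?x b, p $ 2 - ?y b] \<in> cell_region m n (k, b, b)"
        using 2 t by (simp add: mem_cell_region t_def)
      moreover have "(k, b, b) \<in> cells m n" using b k by (auto simp: cells_def)
      ultimately show ?thesis by (intro cell)
    next
      case 3
      have "t * ?W (Suc b) \<le> ?H b * ?W (Suc b)"
        using t nonneg[of "Suc b"] b(1) by (intro mult_right_mono) auto
      then have "?H b * (p $ 1 - ?x (Suc b)) \<le> ?H b * ?W (Suc b)"
        using right by linarith
      then have "p $ 1 - ?x (Suc b) \<le> ?W (Suc b)"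
        using b(2) by (simp only: mult_le_cancel_left_pos)
      then have "vector [p $ 1 - ?x (Suc b), p $ 2 - ?y b] \<in> cell_region m n (k, Suc b, b)"
        using right t 3 by (simp add: mem_cell_region t_def mult.commute del: column_start_Suc)
      moreover have "(k, Suc b, b) \<in> cells m n" using b k by (auto simp: cells_def)
      ultimately show ?thesis by (intro cell)
    qed
  next
    case False
    \<comment> \<open>Here the polygon is a horizontal segment. Consecutive side lengths do not both
      vanish, which forces \<open>n = 2\<close>, and the single cell \<open>(k, 1, 1)\<close> covers
      it.\<close>
    have flat: "?y l = 0" if "l \<le> n" for l
      using row_start_mono[of l n n k m] row_start_nonneg[OF k n0, of l] False k n0 that by simp
    have H0: "?H l = 0" if "l < n" for l
      using row_start_Suc[of m n k l] flat[of l] flat[of "Suc l"] that by simp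
    have S0: "\<not> 0 < side_length m n k l" if "0 < l" "l < n" for l
      using H0[of l] row_height_pos_iff[OF k _ n0, of l] that by simp
    have "n = 2"
    proof (rule ccontr)
      assume "n \<noteq> 2"
      then show False
        using S0[of 1] S0[of 2] side_length_pos_or[OF k m, of n 1] n by (simp add: numeral_2_eq_2)
    qed
    have "0 < side_length m n k (Suc 1)"
      using S0[of 1] side_length_pos_or[OF k m, of n 1] n by auto
    then have W1: "0 < ?W 1"
      using column_width_pos_iff[OF k _ n0, of 1] n by simp
    have x: "?x 0 = 0" "?x (Suc 0) = 0" "?x (Suc (Suc 0)) = ?W 1" "?x (Suc (Suc (Suc 0))) = ?W 1"
      using \<open>n = 2\<close> by (simp_all add: column_start_def column_width_def)
    have l: "l = 0 \<or> l = Suc 0 \<or> l = Suc (Suc 0)" if "l \<le> n" for l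
      using that \<open>n = 2\<close> by linarith
    have x_bounds: "0 \<le> ?x l" "0 \<le> ?x (Suc l)" "?x l \<le> ?W 1" "?x (Suc l) \<le> ?W 1" if "l \<le> n" for l
      using l[OF that] x W1 by (elim disjE; simp del: column_start_Suc)+
    have "0 \<le> 1 * p $ 1 + 0 * p $ 2"
      by (rule sheared_polygon_half_plane[OF n p]) (simp_all only: x_bounds mult_1 mult_zero_left add_0_right)
    moreover have "- ?W 1 \<le> (-1) * p $ 1 + 0 * p $ 2"
      by (rule sheared_polygon_half_plane[OF n p])
        (simp_all only: x_bounds mult_minus1 neg_le_iff_le mult_zero_left add_0_right)
    moreover have "p $ 2 = 0" using height flat[of n] by simp
    ultimately have "vector [p $ 1 - ?x 1, p $ 2 - ?y 1] \<in> cell_region m n (k, 1, 1)"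
      using x flat[of 1] H0[of 1] n by (simp add: mem_cell_region)
    moreover have "(k, 1, 1) \<in> cells m n" using W1 k n by (simp add: cells_def)
    ultimately show ?thesis by (intro cell)
  qed
qed

section \<open>Assembling the affine homeomorphisms\<close>

lemma faces_surface_X [simp]: "faces (surface_X m n) = grid_edges m n"
  and face_surface_X: "face (surface_X m n) e =
    {x. 0 \<le> x $ 1 \<and> x $ 1 \<le> weight m n (snd e) \<and> 0 \<le> x $ 2 \<and> x $ 2 \<le> weight m n (fst e)}"
  by (simp_all add: surface_X_def)

lemma faces_surface_Y [simp]: "faces (surface_Y m n) = {..<m}"
  and face_surface_Y: "shear n *v p \<in> face (surface_Y m n) k \<longleftrightarrow> p \<in> sheared_polygon m n k"
  by (simp_all add: surface_Y_def sheared_polygon_def)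

lemma zero_in_cell_region:
  assumes "c \<in> cells m n" "0 < n"
  shows "0 \<in> cell_region m n c"
proof -
  obtain k a b where c: "c = (k, a, b)" by (cases c) auto
  show ?thesis
    using assms column_width_nonneg[of k m a n] row_height_nonneg[of k m b n]
    by (auto simp: c mem_cell_region cells_def)
qed

lemma cell_region_in_face:
  assumes n: "2 \<le> n" and mn: "m * n \<ge> 6" and c: "c \<in> cells m n" and z: "z \<in> cell_region m n c"
  shows "settle m n (cell_edge n c) \<in> grid_edges m n"
    and "z \<in> face (surface_X m n) (settle m n (cell_edge n c))"
proof -
  have n0: "0 < n" using n by simp
  obtain k a b where kab: "(k, a, b) \<in> real_cells m n" "z \<in> cell_region m n (k, a, b)"
    "cell_edge n (k, a, b) = settle m n (cell_edge n c)"
    using settle_cell[OF n mn c z] by auto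
  then show "settle m n (cell_edge n c) \<in> grid_edges m n"
    using cell_edge_in_grid_edges[of k a b m n] n0 by (auto simp: real_cells_def)
  show "z \<in> face (surface_X m n) (settle m n (cell_edge n c))"
    using kab(2) weight_cell_edge[OF n0, of m k a b] kab(3) by (simp add: face_surface_X mem_cell_region)
qed

text \<open>The half is chosen by the side of the diagonal on which \<open>x\<close> lies. The cells
  obtained have positive area, as the solid pieces of the refinement must.\<close>

lemma face_covered_by_cells:
  assumes n: "0 < n" and e: "e \<in> grid_edges m n" and x: "x \<in> face (surface_X m n) e"
  shows "\<exists>c\<in>real_cells m n. x \<in> cell_region m n c \<and> cell_edge n c = e"
proof -
  have real: "?thesis"
    if "(k, a, b) \<in> real_cells m n" "cell_edge n (k, a, b) = e"
      "if lower then a \<le> b else b \<le> a"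
      "lower \<longleftrightarrow> x $ 2 * weight m n (snd e) \<le> x $ 1 * weight m n (fst e)" for k a b lower
  proof -
    have "x \<in> cell_region m n (k, a, b)"
      using x that weight_cell_edge[OF n, of m k a b]
      by (auto simp: face_surface_X mem_cell_region split: if_splits)
    then show ?thesis using that by blast
  qed
  show ?thesis
    using ex_real_cell_of_edge[OF e n, of "x $ 2 * weight m n (snd e) \<le> x $ 1 * weight m n (fst e)"] real
    by blast
qed

text \<open>Here \<open>S\<close> is \<open>surface_X m n\<close> up to affine changes of the
  rectangles with common linear part \<open>L\<close>: the identity for the first map, the
  reflection for the second.\<close>

lemma affine_homeomorphism_to_surface_Y:
  fixes S :: "'i glued_polygons" and \<phi> :: "vertex \<times> vertex \<Rightarrow> 'i" and s :: "vertex \<times> vertex \<Rightarrow> plane"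
  assumes m: "2 \<le> m" and n: "2 \<le> n" and mn: "m * n \<ge> 6"
    and L: "invertible L" and M: "invertible M" and prod: "M ** L = shear n"
    and im: "\<And>e z. e \<in> grid_edges m n \<Longrightarrow> z \<in> face (surface_X m n) e \<Longrightarrow>
      \<phi> e \<in> faces S \<and> L *v z + s e \<in> face S (\<phi> e)"
    and cov: "\<And>k x. k \<in> faces S \<Longrightarrow> x \<in> face S k \<Longrightarrow>
      \<exists>e\<in>grid_edges m n. \<exists>z\<in>face (surface_X m n) e. \<phi> e = k \<and> L *v z + s e = x"
    and same: "\<And>e e' z z'. surface_point S (\<phi> e, L *v z + s e) = surface_point S (\<phi> e', L *v z' + s e') \<longleftrightarrow>
      surface_point (surface_X m n) (e, z) = surface_point (surface_X m n) (e', z')"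
  shows "\<exists>f. affine_homeomorphism S (surface_Y m n) M f"
proof (rule affine_homeomorphism_of_refinement[where C = "cells m n" and D = "cell_region m n"
      and i = "\<lambda>c. \<phi> (settle m n (cell_edge n c))" and L = L and s = "\<lambda>c. s (settle m n (cell_edge n c))"
      and j = fst and t = "\<lambda>c. shear n *v cell_corner m n c"])
  have n0: "0 < n" using n by simp
  have Y: "(M ** L) *v z + shear n *v cell_corner m n c = shear n *v (z + cell_corner m n c)" for z c
    by (simp add: prod matrix_vector_right_distrib)
  show "finite (cells m n)" by (rule finite_cells)
  show "compact (cell_region m n c)" for c by (rule compact_cell_region)
  show "\<phi> (settle m n (cell_edge n c)) \<in> faces S" if "c \<in> cells m n" for c
    using im cell_region_in_face[OF n mn that zero_in_cell_region[OF that n0]] by blast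
  show "L *v z + s (settle m n (cell_edge n c)) \<in> face S (\<phi> (settle m n (cell_edge n c)))"
    if "c \<in> cells m n" "z \<in> cell_region m n c" for c z
    using im cell_region_in_face[OF n mn that] by blast
  show "fst c \<in> faces (surface_Y m n)" if "c \<in> cells m n" for c
    using that by (auto simp: cells_def)
  show "(M ** L) *v z + shear n *v cell_corner m n c \<in> face (surface_Y m n) (fst c)"
    if "c \<in> cells m n" "z \<in> cell_region m n c" for c z
  proof -
    obtain k a b where c: "c = (k, a, b)" by (cases c) auto
    show ?thesis
      using cell_in_sheared_polygon[OF n, of k a b m z] that unfolding Y face_surface_Y by (simp add: c)
  qed
  show "invertible L" "invertible M" by (rule L M)+
  show "\<exists>c\<in>cells m n. \<exists>z\<in>cell_region m n c. \<phi> (settle m n (cell_edge n c)) = k \<and>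
      L *v z + s (settle m n (cell_edge n c)) = x \<and> convex (cell_region m n c) \<and>
      interior (cell_region m n c) \<noteq> {}" if kx: "k \<in> faces S" "x \<in> face S k" for k x
  proof -
    obtain e z where e: "e \<in> grid_edges m n" "z \<in> face (surface_X m n) e" "\<phi> e = k" "L *v z + s e = x"
      using cov[OF kx] by blast
    obtain c where c: "c \<in> real_cells m n" "z \<in> cell_region m n c" "cell_edge n c = e"
      using face_covered_by_cells[OF n0 e(1,2)] by blast
    have "settle m n (cell_edge n c) = e" "c \<in> cells m n"
      using c settle_real_cell[OF _ n0] by (cases c, auto simp: real_cells_def)+
    then show ?thesis
      using e c convex_cell_region interior_cell_region by blast
  qed
  show "\<exists>c\<in>cells m n. \<exists>z\<in>cell_region m n c. fst c = k \<and>
      (M ** L) *v z + shear n *v cell_corner m n c = x"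
    if kx: "k \<in> faces (surface_Y m n)" "x \<in> face (surface_Y m n) k" for k x
  proof -
    have "surj ((*v) (shear n))"
      using shear_invertible[OF n] by (simp add: invertible_eq_bij bij_is_surj)
    then obtain p where p: "x = shear n *v p" by (metis surjD)
    then have "p \<in> sheared_polygon m n k" "k < m" using kx face_surface_Y by auto
    then obtain a b z where "(k, a, b) \<in> cells m n" "z \<in> cell_region m n (k, a, b)"
      "z + cell_corner m n (k, a, b) = p"
      using sheared_polygon_covered[OF m n] by blast
    then show ?thesis unfolding Y p by force
  qed
  show "surface_point S (\<phi> (settle m n (cell_edge n c)), L *v z + s (settle m n (cell_edge n c))) =
      surface_point S (\<phi> (settle m n (cell_edge n d)), L *v w + s (settle m n (cell_edge n d))) \<longleftrightarrow>
      surface_point (surface_Y m n) (fst c, (M ** L) *v z + shear n *v cell_corner m n c) =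
      surface_point (surface_Y m n) (fst d, (M ** L) *v w + shear n *v cell_corner m n d)"
    if "c \<in> cells m n" "d \<in> cells m n" "z \<in> cell_region m n c" "w \<in> cell_region m n d" for c d z w
    using Y_point_eq_of_X_point_eq[OF n mn that(1,3,2,4)] X_point_eq_of_Y_point_eq[OF m n mn that(1,3,2,4)]
    unfolding same Y by (auto simp: X_point_def Y_point_def)
qed

theorem theorem15:
  fixes m n :: nat
  assumes "m \<ge> 2" and "n \<ge> 2" and "m * n \<ge> 6"
  shows "(\<exists>\<mu>. affine_homeomorphism (surface_X m n) (surface_Y m n)
              (vector [vector [1 / sin (pi / real n), - cot (pi / real n)],
                       vector [0, 1]]) \<mu>) \<and>
         (\<exists>\<nu>. affine_homeomorphism (surface_X m n) (surface_Y n m)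
              (vector [vector [- (1 / sin (pi / real m)), - cot (pi / real m)],
                       vector [0, 1]]) \<nu>)"
proof
  show "\<exists>\<mu>. affine_homeomorphism (surface_X m n) (surface_Y m n)
      (vector [vector [1 / sin (pi / real n), - cot (pi / real n)], vector [0, 1]]) \<mu>"
    unfolding shear_def[symmetric]
    by (rule affine_homeomorphism_to_surface_Y[OF assms, where L = "mat 1" and \<phi> = "\<lambda>e. e" and s = "\<lambda>_. 0"])
      (use shear_invertible[OF assms(2)] in \<open>auto simp: invertible_def\<close>)
  define R :: "real^2^2" where "R = vector [vector [-1, 0], vector [0, 1]]"
  let ?M = "vector [vector [- (1 / sin (pi / real m)), - cot (pi / real m)], vector [0, 1]] :: real^2^2"
  let ?s = "\<lambda>e. vector [weight n m (snd e), 0] :: plane"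
  have Rv: "R *v z + ?s e = vector [weight n m (snd e) - z $ 1, z $ 2]" for z e
    by (simp add: R_def vec_eq_iff forall_2 matrix_vector_mult_def sum_2)
  have R: "invertible R"
    by (simp add: invertible_det_nz det_2 R_def)
  have nm: "n * m \<ge> 6" using assms(3) by (simp add: mult.commute)
  have sin: "sin (pi / real m) > 0"
    using assms(1) by (intro sin_gt_zero) (auto simp: field_simps)
  then have M: "invertible ?M"
    by (simp add: invertible_det_nz det_2)
  \<comment> \<open>Composing \<open>shear m\<close> with the reflection negates its first column
    only, which gives the minus sign of the cosecant and leaves the cotangent entry alone.\<close>
  have MR: "?M ** R = shear m"
    by (simp add: R_def shear_def vec_eq_iff forall_2 matrix_matrix_mult_def sum_2)
  show "\<exists>\<nu>. affine_homeomorphism (surface_X m n) (surface_Y n m) ?M \<nu>"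
  \<comment> \<open>With \<open>m\<close> and \<open>n\<close> exchanged the cells belong to
    \<open>surface_X n m\<close>, and \<open>surface_X m n\<close> enters through the reflected
    rectangles.\<close>
  proof (rule affine_homeomorphism_to_surface_Y[OF assms(2,1) nm R M MR, where \<phi> = swap_edge and s = ?s])
    show "swap_edge e \<in> faces (surface_X m n) \<and> R *v z + ?s e \<in> face (surface_X m n) (swap_edge e)"
      if "e \<in> grid_edges n m" "z \<in> face (surface_X n m) e" for e z
      unfolding Rv using that swap_edge_in_grid_edges[OF that(1)]
      by (simp add: face_surface_X swap_edge_def weight_swap)
    show "\<exists>e\<in>grid_edges n m. \<exists>z\<in>face (surface_X n m) e. swap_edge e = k \<and> R *v z + ?s e = x"
      if "k \<in> faces (surface_X m n)" "x \<in> face (surface_X m n) k" for k x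
    proof (intro bexI conjI)
      let ?z = "vector [weight n m (snd (swap_edge k)) - x $ 1, x $ 2] :: plane"
      show "swap_edge (swap_edge k) = k" by simp
      show "R *v ?z + ?s (swap_edge k) = x" unfolding Rv by (simp add: vec_eq_iff forall_2)
      show "?z \<in> face (surface_X n m) (swap_edge k)"
        using that(2) by (simp add: face_surface_X swap_edge_def weight_swap)
      show "swap_edge k \<in> grid_edges n m"
        using that(1) swap_edge_in_grid_edges by simp
    qed
    show "surface_point (surface_X m n) (swap_edge e, R *v z + ?s e) =
        surface_point (surface_X m n) (swap_edge e', R *v z' + ?s e') \<longleftrightarrow>
        surface_point (surface_X n m) (e, z) = surface_point (surface_X n m) (e', z')" for e e' z z'
      unfolding Rv using surface_point_reflect_iff[OF nm, of "(e, z)" "(e', z')"]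
      by (simp add: reflect_def)
  qed
qed

end
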